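(* Let $q\in L_1[0,1]$ be complex-valued with $\int_0^1 q(x)\,dx=0$, let $\alpha\in\mathbb{C}$, $\alpha\neq\pm1$, and let $T_3$ be the operator in $L_2[0,1]$ generated by $-y''+q(x)y$ and the boundary conditions $y'(0)-y'(1)=0$, $y(0)+\alpha y(1)=0$. Put $s_k=\int_0^1 q(x)\sin 2\pi kx\,dx$ and $\gamma_3=\dfrac{16\pi(1+\alpha)}{1-\alpha}$. If $$\lim_{n\to\infty}\frac{\ln|n|}{n\,s_{2n}}=0,$$ then the large eigenvalues $\lambda_{n,j,3}$ of $T_3$ are simple and satisfy the asymptotic formulas $$\lambda_{n,j,3}=(2\pi n)^2+(-1)^j\frac{\sqrt{2\gamma_3}}{2}\sqrt{n s_{2n}}\,(1+o(1))$$ for $j=1,2$. The normalized eigenfunctions $\Psi_{n,j,3}$ corresponding to $\lambda_{n,j,3}$ obey (up to multiplication by a constant of modulus one) $$\Psi_{n,j,3}(x)=\sqrt{2}\sin 2\pi nx+O(n^{-1/2}).$$ Moreover, if there exists a sequence $\{n_k\}$ of positive integers with $n_k\to\infty$ such that $\lim_{k\to\infty}\dfrac{\ln|n_k|}{n_k\,s_{2n_k}}=0$, then the root functions of $T_3$ do not form a Riesz basis in $L_2[0,1]$.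
   Context: The eigenvalues of $T_3$ consist of two sequences $\{\lambda_{n,1,3}\},\{\lambda_{n,2,3}\}$ (counted with algebraic multiplicity) with $\lambda_{n,j,3}=(2\pi n)^2+O(n^{1/2})$, $j=1,2$. "Large eigenvalues are simple" means that there is $N$ such that $\lambda_{n,j,3}$ is simple for all $n>N$, $j=1,2$. For each large $n$ the labels $j=1,2$ are assigned suitably, with a fixed choice of branch of the square roots. Eigenfunctions are normalized by $\|\Psi_{n,j,3}\|_{L_2[0,1]}=1$, and the $O$-term is uniform in $x\in[0,1]$ as $n\to\infty$. The root functions of an operator are its eigenfunctions and associated functions. *)

theory Defs
  imports
    "HOL-Analysis.Analysis"
    "HOL-Library.Function_Algebras"
    "HOL-Library.Landau_Symbols"
begin

global_interpretation cfun: vector_space "\<lambda>(c::complex) (f::real \<Rightarrow> complex) x. c * f x"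
  defines cfun_dim = cfun.dim
  by unfold_locales (auto simp: fun_eq_iff algebra_simps)

text \<open>The space of square integrable functions on the unit interval is represented by functions
  on the real line; only their values on the interval matter, up to null sets.\<close>

definition L2 :: "(real \<Rightarrow> complex) \<Rightarrow> bool" where
  "L2 f \<longleftrightarrow> f \<in> borel_measurable (lebesgue_on {0..1}) \<and>
     (\<lambda>x. (cmod (f x))\<^sup>2) integrable_on {0..1}"

definition L2_inner :: "(real \<Rightarrow> complex) \<Rightarrow> (real \<Rightarrow> complex) \<Rightarrow> complex" where
  "L2_inner f g = integral {0..1} (\<lambda>x. f x * cnj (g x))"

definition L2_norm :: "(real \<Rightarrow> complex) \<Rightarrow> real" where
  "L2_norm f = sqrt (integral {0..1} (\<lambda>x. (cmod (f x))\<^sup>2))"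

definition L2_eq :: "(real \<Rightarrow> complex) \<Rightarrow> (real \<Rightarrow> complex) \<Rightarrow> bool" where
  "L2_eq f g \<longleftrightarrow> (AE x in lebesgue_on {0..1}. f x = g x)"

text \<open>Boundedness makes such a map compatible with \<^const>\<open>L2_eq\<close>.\<close>

definition L2_bounded_operator :: "((real \<Rightarrow> complex) \<Rightarrow> (real \<Rightarrow> complex)) \<Rightarrow> bool" where
  "L2_bounded_operator A \<longleftrightarrow>
     (\<forall>f. L2 f \<longrightarrow> L2 (A f)) \<and>
     (\<forall>f g a b. L2 f \<longrightarrow> L2 g \<longrightarrow>
        L2_eq (A (\<lambda>x. a * f x + b * g x)) (\<lambda>x. a * A f x + b * A g x)) \<and>
     (\<exists>M. \<forall>f. L2 f \<longrightarrow> L2_norm (A f) \<le> M * L2_norm f)"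

definition L2_orthonormal_basis :: "(nat \<Rightarrow> real \<Rightarrow> complex) \<Rightarrow> bool" where
  "L2_orthonormal_basis u \<longleftrightarrow>
     (\<forall>i. L2 (u i)) \<and>
     (\<forall>i j. L2_inner (u i) (u j) = (if i = j then 1 else 0)) \<and>
     (\<forall>f. L2 f \<and> (\<forall>i. L2_inner f (u i) = 0) \<longrightarrow> L2_eq f (\<lambda>x. 0))"

definition L2_riesz_basis :: "(nat \<Rightarrow> real \<Rightarrow> complex) \<Rightarrow> bool" where
  "L2_riesz_basis e \<longleftrightarrow>
     (\<exists>u A B. L2_orthonormal_basis u \<and>
        L2_bounded_operator A \<and> L2_bounded_operator B \<and>
        (\<forall>f. L2 f \<longrightarrow> L2_eq (A (B f)) f \<and> L2_eq (B (A f)) f) \<and>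
        (\<forall>i. L2_eq (e i) (A (u i))))"

text \<open>\<open>T3 q \<alpha> y f\<close> says that \<open>y\<close> is in the domain of \<open>T\<^sub>3\<close> and \<open>T\<^sub>3 y = f\<close>. The function \<open>y1\<close> is the
  derivative of \<open>y\<close>; it is absolutely continuous, being an indefinite Lebesgue integral, and \<open>y2\<close>
  is its almost everywhere defined derivative. Elements of the domain are taken to vanish off
  the interval, so that distinct functions \<open>y\<close> are distinct elements of the space.\<close>

definition T3 :: "(real \<Rightarrow> complex) \<Rightarrow> complex \<Rightarrow> (real \<Rightarrow> complex) \<Rightarrow> (real \<Rightarrow> complex) \<Rightarrow> bool" where
  "T3 q \<alpha> y f \<longleftrightarrow>
     (\<forall>x. x \<notin> {0..1} \<longrightarrow> y x = 0) \<and> L2 f \<and>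
     (\<exists>y1 y2.
        (\<forall>x\<in>{0..1}. (y has_vector_derivative y1 x) (at x within {0..1})) \<and>
        y2 absolutely_integrable_on {0..1} \<and>
        (\<forall>x\<in>{0..1}. (y2 has_integral (y1 x - y1 0)) {0..x}) \<and>
        L2_eq f (\<lambda>x. - y2 x + q x * y x) \<and>
        y1 0 - y1 1 = 0 \<and> y 0 + \<alpha> * y 1 = 0)"

definition T3_eigenfunction ::
    "(real \<Rightarrow> complex) \<Rightarrow> complex \<Rightarrow> complex \<Rightarrow> (real \<Rightarrow> complex) \<Rightarrow> bool" where
  "T3_eigenfunction q \<alpha> \<mu> y \<longleftrightarrow> y \<noteq> 0 \<and> T3 q \<alpha> y (\<lambda>x. \<mu> * y x)"

text \<open>The kernel of \<open>(T\<^sub>3 - \<mu>)\<^sup>k\<close>.\<close>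

primrec T3_kernel ::
    "(real \<Rightarrow> complex) \<Rightarrow> complex \<Rightarrow> complex \<Rightarrow> nat \<Rightarrow> (real \<Rightarrow> complex) set" where
  "T3_kernel q \<alpha> \<mu> 0 = {0}"
| "T3_kernel q \<alpha> \<mu> (Suc k) = {y. \<exists>g\<in>T3_kernel q \<alpha> \<mu> k. T3 q \<alpha> y (\<lambda>x. \<mu> * y x + g x)}"

definition T3_root_space ::
    "(real \<Rightarrow> complex) \<Rightarrow> complex \<Rightarrow> complex \<Rightarrow> (real \<Rightarrow> complex) set" where
  "T3_root_space q \<alpha> \<mu> = (\<Union>k. T3_kernel q \<alpha> \<mu> k)"

definition T3_alg_mult :: "(real \<Rightarrow> complex) \<Rightarrow> complex \<Rightarrow> complex \<Rightarrow> nat" where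
  "T3_alg_mult q \<alpha> \<mu> = cfun_dim (T3_root_space q \<alpha> \<mu>)"

definition T3_simple_eigenvalue :: "(real \<Rightarrow> complex) \<Rightarrow> complex \<Rightarrow> complex \<Rightarrow> bool" where
  "T3_simple_eigenvalue q \<alpha> \<mu> \<longleftrightarrow> T3_alg_mult q \<alpha> \<mu> = 1"

text \<open>The two sequences are \<open>lam n 1\<close> for \<open>n \<ge> 0\<close> and \<open>lam n 2\<close> for \<open>n \<ge> 1\<close>: for \<open>q = 0\<close> the eigenvalue
  \<open>0\<close> is simple, while \<open>(2\<pi>n)\<^sup>2\<close> has algebraic multiplicity two for every \<open>n \<ge> 1\<close>.\<close>

definition T3_eigenvalue_sequences ::
    "(real \<Rightarrow> complex) \<Rightarrow> complex \<Rightarrow> (nat \<Rightarrow> nat \<Rightarrow> complex) \<Rightarrow> bool" where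
  "T3_eigenvalue_sequences q \<alpha> lam \<longleftrightarrow>
     (\<forall>\<mu>. finite {(n, j). j \<in> {1, 2} \<and> (n = 0 \<longrightarrow> j = 1) \<and> lam n j = \<mu>} \<and>
        card {(n, j). j \<in> {1, 2} \<and> (n = 0 \<longrightarrow> j = 1) \<and> lam n j = \<mu>} = T3_alg_mult q \<alpha> \<mu>) \<and>
     (\<forall>j\<in>{1, 2}. (\<lambda>n. cmod (lam n j - of_real ((2 * pi * real n)\<^sup>2))) \<in> O(\<lambda>n. sqrt (real n)))"

text \<open>A system of root functions contains, for every eigenvalue, a basis of its root space, and
  nothing else. Neither the normalization nor the choice of the associated functions is prescribed.\<close>

definition T3_root_function_system ::
    "(real \<Rightarrow> complex) \<Rightarrow> complex \<Rightarrow> (nat \<Rightarrow> real \<Rightarrow> complex) \<Rightarrow> bool" where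
  "T3_root_function_system q \<alpha> e \<longleftrightarrow>
     inj e \<and>
     (\<forall>i. \<exists>\<mu>. e i \<in> T3_root_space q \<alpha> \<mu>) \<and>
     (\<forall>\<mu>. cfun.independent (range e \<inter> T3_root_space q \<alpha> \<mu>) \<and>
        T3_root_space q \<alpha> \<mu> \<subseteq> cfun.span (range e \<inter> T3_root_space q \<alpha> \<mu>))"

definition sine_coeff :: "(real \<Rightarrow> complex) \<Rightarrow> nat \<Rightarrow> complex" where
  "sine_coeff q k = integral {0..1} (\<lambda>x. q x * of_real (sin (2 * pi * real k * x)))"

definition gamma3 :: "complex \<Rightarrow> complex" where
  "gamma3 \<alpha> = 16 * of_real pi * (1 + \<alpha>) / (1 - \<alpha>)"

end

theory Submission
  imports Defs "HOL-Complex_Analysis.Complex_Analysis"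
begin

text \<open>
  Everything is read off from one entire function. Let \<open>c\<close> and \<open>s\<close> solve \<open>- y'' + q y = \<mu> y\<close> with
  \<open>c(0) = s'(0) = 1\<close> and \<open>c'(0) = s(0) = 0\<close>. Their Wronskian is one, and therefore the determinant of the two boundary
  conditions collapses to \<open>\<Delta>(\<mu>) = s'(1) - \<alpha> c(1) - (1 - \<alpha>)\<close>, which is linear in the fundamental solutions. For \<open>q = 0\<close> it is
  \<open>(1 - \<alpha>)(cos \<rho> - 1)\<close> with \<open>\<mu> = \<rho>\<^sup>2\<close>, whose zeros \<open>(2\<pi>n)\<^sup>2\<close>, \<open>n \<ge> 1\<close>, are double.

  Variation of constants gives, because \<open>q\<close> has mean value zero,
  \<open>\<Delta>(\<rho>\<^sup>2) = (1 - \<alpha>)(cos \<rho> - 1) - (1 + \<alpha>)/(2\<rho>) \<integral> q(t) sin \<rho>(1 - 2t) dt + O(\<rho>\<^sup>-\<^sup>2)\<close> in strips around the real axis.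
  Near \<open>\<rho> = 2\<pi>n\<close> the integral is close to \<open>- s\<^sub>2\<^sub>n\<close>. In terms of \<open>z = \<mu> - (2\<pi>n)\<^sup>2 = O(n\<^sup>1\<^sup>/\<^sup>2)\<close> this says that, up to a constant
  factor, \<open>\<Delta>\<close> equals \<open>z\<^sup>2 - \<gamma>\<^sub>3 n s\<^sub>2\<^sub>n / 2 + O(1 + \<bar>z\<bar>)\<close> (\<open>charfun_near_free_eigenvalue\<close>). If \<open>n s\<^sub>2\<^sub>n\<close> tends to infinity, the
  error is negligible, and Rouche's theorem separates two simple zeros, within a constant of the two square roots of
  \<open>\<gamma>\<^sub>3 n s\<^sub>2\<^sub>n / 2\<close> (\<open>charfun_zero_pair\<close>).

  That the zeros account for all eigenvalues with their algebraic multiplicities has two parts. The multiplicity is the order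
  of the zero (\<open>alg_mult_eq_order\<close>): the Taylor coefficients, in the spectral parameter, of a solution that satisfies one
  boundary condition identically form a chain of root functions, which satisfies the other condition as long as the Taylor
  coefficients of \<open>\<Delta>\<close> vanish. And comparison with \<open>q = 0\<close> on the circle \<open>\<bar>\<mu>\<bar> = (2\<pi>(N + 1/2))\<^sup>2\<close> shows that the zeros inside
  have total order \<open>2 N + 1\<close> (\<open>charfun_zeros_in_disc\<close>), while every zero outside is within \<open>O(n\<^sup>1\<^sup>/\<^sup>2)\<close> of some \<open>(2\<pi>n)\<^sup>2\<close>
  with \<open>n > N\<close> (\<open>charfun_zero_localised\<close>).

  For an eigenfunction with such an eigenvalue the condition \<open>y(0) + \<alpha> y(1) = 0\<close> makes the cosine part small against the sine part
  (\<open>eigenfunction_asymptotics\<close>). So the two normalized eigenfunctions of a pair approach the same sine. In a Riesz basis two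
  elements of norm one keep a positive distance, whatever unimodular factors they carry (\<open>riesz_basis_bounds\<close>); hence the
  root functions form none, and infinitely many pairs suffice for this.
\<close>

section \<open>Integrals against a summable weight\<close>

lemma absolutely_integrable_times_continuous:
  fixes w u :: "real \<Rightarrow> complex"
  assumes "w absolutely_integrable_on {a..b}" "continuous_on {a..b} u"
  shows "(\<lambda>t. w t * u t) absolutely_integrable_on {a..b}"
proof -
  have "(\<lambda>t. u t * w t) absolutely_integrable_on {a..b}"
  proof (rule absolutely_integrable_bounded_measurable_product[OF bilinear_times _ _ _ assms(1)])
    show "u \<in> borel_measurable (lebesgue_on {a..b})"
      using assms(2) by (intro continuous_imp_measurable_on_sets_lebesgue) auto
    show "bounded (u ` {a..b})"
      by (intro compact_imp_bounded compact_continuous_image assms(2)) auto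
  qed auto
  then show ?thesis by (simp add: mult.commute)
qed

lemma continuous_on_bounded_cmod:
  fixes u :: "real \<Rightarrow> complex"
  assumes "continuous_on {0..1} u"
  obtains S where "S \<ge> 0" "\<And>t. t \<in> {0..1} \<Longrightarrow> cmod (u t) \<le> S"
proof -
  have "bounded (u ` {0..1})"
    by (intro compact_imp_bounded compact_continuous_image assms) auto
  then obtain S where "S > 0" "\<forall>y\<in>u ` {0..1}. cmod y \<le> S" by (auto simp: bounded_pos)
  then show ?thesis by (intro that[of S]) auto
qed

lemma absolutely_integrable_norm_integrable:
  fixes w :: "real \<Rightarrow> complex"
  assumes "w absolutely_integrable_on {0..1}" "x \<in> {0..1}"
  shows "w integrable_on {0..x}" "(\<lambda>t. cmod (w t)) integrable_on {0..x}"
proof -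
  have "w absolutely_integrable_on {0..x}"
    by (rule absolutely_integrable_on_subinterval[OF assms(1)]) (use assms(2) in auto)
  then show "w integrable_on {0..x}" "(\<lambda>t. cmod (w t)) integrable_on {0..x}"
    by (auto simp: absolutely_integrable_on_def)
qed

lemma norm_integral_mult_le:
  fixes w u :: "real \<Rightarrow> complex"
  assumes w: "w absolutely_integrable_on {0..1}" and u: "continuous_on {0..1} u"
    and x: "x \<in> {0..1}" and S: "\<And>t. t \<in> {0..x} \<Longrightarrow> cmod (u t) \<le> S"
  shows "cmod (integral {0..x} (\<lambda>t. w t * u t)) \<le> integral {0..1} (\<lambda>t. cmod (w t)) * S"
proof -
  have S0: "S \<ge> 0" using S[of 0] x norm_ge_zero[of "u 0"] by (smt (verit) atLeastAtMost_iff)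
  have i: "(\<lambda>t. w t * u t) integrable_on {0..x}"
    by (rule absolutely_integrable_norm_integrable(1)[OF absolutely_integrable_times_continuous[OF w u] x])
  have n: "(\<lambda>t. cmod (w t)) integrable_on {0..x}" "(\<lambda>t. cmod (w t)) integrable_on {0..1}"
    using absolutely_integrable_norm_integrable(2)[OF w] x by auto
  have "cmod (integral {0..x} (\<lambda>t. w t * u t)) \<le> integral {0..x} (\<lambda>t. cmod (w t) * S)"
    by (rule integral_norm_bound_integral[OF i])
       (use n S in \<open>auto intro!: integrable_on_mult_left mult_left_mono simp: norm_mult\<close>)
  also have "\<dots> = integral {0..x} (\<lambda>t. cmod (w t)) * S" by simp
  also have "\<dots> \<le> integral {0..1} (\<lambda>t. cmod (w t)) * S"
    by (intro mult_right_mono integral_subset_le n S0) (use x in auto)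
  finally show ?thesis .
qed

text \<open>A summable weight exceeds a large constant only by a function of small integral. This replaces any calculus
  with the absolutely continuous function \<open>x \<mapsto> \<integral>\<^sub>0\<^sup>x \<bar>w\<bar>\<close> in the fixed point estimate below.\<close>

lemma absolutely_integrable_bounded_plus_small:
  fixes w :: "real \<Rightarrow> complex"
  assumes w: "w absolutely_integrable_on {0..1}" and e: "e > 0"
  obtains M r where "M \<ge> 0" "r integrable_on {0..1}" "\<And>t. r t \<ge> 0"
    "\<And>t. cmod (w t) \<le> M + r t" "integral {0..1} r \<le> (e::real)"
proof -
  let ?r = "\<lambda>k t. max (cmod (w t) - real k) 0"
  have n: "(\<lambda>t. cmod (w t)) absolutely_integrable_on {0..1}"
    using w by (rule absolutely_integrable_norm[unfolded o_def])
  have i: "?r k integrable_on {0..1}" for k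
  proof -
    have "(\<lambda>t. cmod (w t) - real k) absolutely_integrable_on {0..1}"
      using n by (intro set_integral_diff) (auto intro: absolutely_integrable_continuous_real)
    then have "?r k absolutely_integrable_on {0..1}"
      by (intro absolutely_integrable_max_1) (auto intro: absolutely_integrable_continuous_real)
    then show ?thesis by (rule set_lebesgue_integral_eq_integral)
  qed
  have "(\<lambda>k. integral {0..1} (?r k)) \<longlonglongrightarrow> integral {0..1} (\<lambda>t::real. 0::real)"
  proof (rule dominated_convergence(2)[where h = "\<lambda>t. cmod (w t)"])
    show "?r k integrable_on {0..1}" for k by (rule i)
    show "(\<lambda>t. cmod (w t)) integrable_on {0..1}" using n by (rule set_lebesgue_integral_eq_integral)
    show "(\<lambda>k. ?r k t) \<longlonglongrightarrow> 0" for t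
    proof (rule tendsto_eventually)
      have "eventually (\<lambda>k. real k \<ge> cmod (w t)) sequentially"
        using filterlim_real_sequentially by (auto simp: filterlim_at_top)
      then show "eventually (\<lambda>k. ?r k t = 0) sequentially" by eventually_elim auto
    qed
    show "norm (?r k t) \<le> cmod (w t)" for k t
      using norm_ge_zero[of "w t"] by (simp add: max_def)
  qed
  then have "eventually (\<lambda>k. integral {0..1} (?r k) < e) sequentially"
    using e by (intro order_tendstoD) auto
  then obtain k where "integral {0..1} (?r k) < e" by (auto simp: eventually_sequentially)
  then show ?thesis by (intro that[of "real k" "?r k"] i) auto
qed

text \<open>Integration from \<open>0\<close>, with or without the weight \<open>w\<close>, is a contraction by \<open>1/2\<close> in the norm
  \<open>sup \<bar>u x\<bar> exp (- K x)\<close>. Stating this pointwise avoids a separate function space for every \<open>K\<close>.\<close>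

definition halved_by :: "(real \<Rightarrow> complex) \<Rightarrow> real \<Rightarrow> bool" where
  "halved_by w K \<longleftrightarrow> K \<ge> 0 \<and> (\<forall>u D. \<forall>x\<in>{0..1}. continuous_on {0..1} u \<longrightarrow> D \<ge> 0 \<longrightarrow>
      (\<forall>t\<in>{0..1}. cmod (u t) \<le> D * exp (K * t)) \<longrightarrow>
    cmod (integral {0..x} (\<lambda>t. w t * u t)) \<le> D / 2 * exp (K * x) \<and>
    cmod (integral {0..x} u) \<le> D / 2 * exp (K * x))"

text \<open>Split \<open>\<bar>w\<bar>\<close> into a constant \<open>M\<close> and a part of integral at most \<open>1/4\<close>. The exponential weight makes the
  contribution of the constant as small as \<open>M/K\<close>, and the small part contributes at most \<open>1/4\<close>.\<close>

lemma ex_halved_by: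
  fixes w :: "real \<Rightarrow> complex"
  assumes w: "w absolutely_integrable_on {0..1}"
  shows "\<exists>K. halved_by w K"
proof -
  obtain M r where M: "M \<ge> 0" "r integrable_on {0..1}" "\<And>t. r t \<ge> 0"
    "\<And>t. cmod (w t) \<le> M + r t" "integral {0..1} r \<le> (1/4::real)"
    using absolutely_integrable_bounded_plus_small[OF w, of "1/4"] by auto
  define K where "K = 4 * (M + 1)"
  have K: "K > 0" using M(1) by (simp add: K_def)
  have *: "cmod (integral {0..x} (\<lambda>t. W t * u t)) \<le> D / 2 * exp (K * x)"
    if u: "continuous_on {0..1} u" and D: "D \<ge> 0" and x: "x \<in> {0..1}"
      and uD: "\<And>t. t \<in> {0..1} \<Longrightarrow> cmod (u t) \<le> D * exp (K * t)"
      and W: "W absolutely_integrable_on {0..1}" and WM: "\<And>t. cmod (W t) \<le> (M + 1) + r t" for u D x W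
  proof -
    have e: "((\<lambda>t. exp (K * t)) has_integral (exp (K * x) / K - exp (K * 0) / K)) {0..x}"
      using x K by (intro fundamental_theorem_of_calculus)
        (auto intro!: derivative_eq_intros simp: has_real_derivative_iff_has_vector_derivative [symmetric])
    have r: "r integrable_on {0..x}"
      by (rule integrable_on_subinterval[OF M(2)]) (use x in auto)
    have "cmod (integral {0..x} (\<lambda>t. W t * u t))
        \<le> integral {0..x} (\<lambda>t. D * (M + 1) * exp (K * t) + D * exp (K * x) * r t)"
    proof (rule integral_norm_bound_integral)
      show "(\<lambda>t. W t * u t) integrable_on {0..x}"
        by (rule absolutely_integrable_norm_integrable(1)[OF absolutely_integrable_times_continuous[OF W u] x])
      show "(\<lambda>t. D * (M + 1) * exp (K * t) + D * exp (K * x) * r t) integrable_on {0..x}"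
        using r e by (intro integrable_add integrable_on_mult_right) auto
    next
      fix t assume t: "t \<in> {0..x}"
      have "cmod (W t * u t) \<le> ((M + 1) + r t) * (D * exp (K * t))"
        unfolding norm_mult using t x M(1) M(3)[of t] by (intro mult_mono WM uD) auto
      also have "\<dots> = D * (M + 1) * exp (K * t) + D * exp (K * t) * r t" by (simp add: algebra_simps)
      also have "D * exp (K * t) * r t \<le> D * exp (K * x) * r t"
        using D M(3)[of t] t K by (intro mult_right_mono mult_left_mono) auto
      finally show "cmod (W t * u t) \<le> D * (M + 1) * exp (K * t) + D * exp (K * x) * r t" by simp
    qed
    also have "\<dots> = D * (M + 1) * integral {0..x} (\<lambda>t. exp (K * t)) + D * exp (K * x) * integral {0..x} r"
      using r e by (subst integral_add) (auto intro!: integrable_on_mult_right)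
    finally have le: "cmod (integral {0..x} (\<lambda>t. W t * u t))
        \<le> D * (M + 1) * integral {0..x} (\<lambda>t. exp (K * t)) + D * exp (K * x) * integral {0..x} r" .
    have "D * (M + 1) * integral {0..x} (\<lambda>t. exp (K * t)) \<le> D * (M + 1) * (exp (K * x) / K)"
      using D M(1) K integral_unique[OF e] by (intro mult_left_mono) auto
    also have "\<dots> = D / 4 * exp (K * x)"
      using M(1) by (simp add: K_def field_simps)
    finally have 1: "D * (M + 1) * integral {0..x} (\<lambda>t. exp (K * t)) \<le> D / 4 * exp (K * x)" .
    have "integral {0..x} r \<le> integral {0..1} r"
      by (intro integral_subset_le r M(2)) (use x M(3) in auto)
    then have "integral {0..x} r \<le> 1/4" using M(5) by simp
    then have "D * exp (K * x) * integral {0..x} r \<le> D * exp (K * x) * (1/4)"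
      using D by (intro mult_left_mono) auto
    with le 1 show ?thesis by simp
  qed
  show ?thesis
    unfolding halved_by_def
  proof (intro exI[of _ K] conjI[OF less_imp_le[OF K]] allI ballI impI)
    fix u :: "real \<Rightarrow> complex" and D x :: real
    assume x: "x \<in> {0..1}" and u: "continuous_on {0..1} u" "D \<ge> 0" and uD: "\<forall>t\<in>{0..1}. cmod (u t) \<le> D * exp (K * t)"
    note a = u x bspec[OF uD]
    have "cmod (integral {0..x} (\<lambda>t. w t * u t)) \<le> D / 2 * exp (K * x)"
    proof (rule *[OF a w])
      show "cmod (w t) \<le> M + 1 + r t" for t using M(4)[of t] by simp
    qed
    moreover have "cmod (integral {0..x} (\<lambda>t. 1 * u t)) \<le> D / 2 * exp (K * x)"
    proof (rule *[OF a])
      show "cmod 1 \<le> M + 1 + r t" for t using M(1) M(3)[of t] by simp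
    qed (auto intro!: absolutely_integrable_continuous_real)
    ultimately show "cmod (integral {0..x} (\<lambda>t. w t * u t)) \<le> D / 2 * exp (K * x) \<and>
      cmod (integral {0..x} u) \<le> D / 2 * exp (K * x)" by simp
  qed
qed

lemma continuous_on_suminf:
  fixes u :: "nat \<Rightarrow> real \<Rightarrow> complex"
  assumes "\<And>n. continuous_on {0..1} (u n)" "\<And>n t. t \<in> {0..1} \<Longrightarrow> cmod (u n t) \<le> c n" "summable c"
  shows "continuous_on {0..1} (\<lambda>t. \<Sum>n. u n t)"
proof (rule uniform_limit_theorem)
  show "uniform_limit {0..1} (\<lambda>n t. \<Sum>i<n. u i t) (\<lambda>t. \<Sum>n. u n t) sequentially"
    using assms by (intro Weierstrass_m_test) auto
  show "\<forall>\<^sub>F n in sequentially. continuous_on {0..1} (\<lambda>t. \<Sum>i<n. u i t)"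
    using assms by (intro always_eventually allI continuous_on_sum) auto
qed auto

text \<open>A summable weight can be integrated termwise against a series that converges uniformly by the Weierstrass
  test: the remainder is at most the integral of the weight times the tail of the majorant.\<close>

lemma integral_mult_suminf:
  fixes u :: "nat \<Rightarrow> real \<Rightarrow> complex"
  assumes w: "w absolutely_integrable_on {0..1}" and x: "x \<in> {0..1}"
    and u: "\<And>n. continuous_on {0..1} (u n)" and c: "\<And>n t. t \<in> {0..1} \<Longrightarrow> cmod (u n t) \<le> c n" "summable c"
  shows "(\<lambda>n. integral {0..x} (\<lambda>t. w t * u n t)) sums integral {0..x} (\<lambda>t. w t * (\<Sum>n. u n t))"
proof -
  let ?U = "\<lambda>t. \<Sum>n. u n t" and ?W = "integral {0..1} (\<lambda>t. cmod (w t))"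
  have U: "continuous_on {0..1} ?U" by (rule continuous_on_suminf[OF u c])
  have int: "(\<lambda>t. w t * f t) integrable_on {0..x}" if "continuous_on {0..1} f" for f
    by (rule absolutely_integrable_norm_integrable(1)[OF absolutely_integrable_times_continuous[OF w that] x])
  have S: "continuous_on {0..1} (\<lambda>t. \<Sum>i<n. u i t)" for n by (intro continuous_on_sum u)
  have s: "summable (\<lambda>n. u n t)" if "t \<in> {0..1}" for t
    by (rule summable_comparison_test[OF _ c(2)]) (use c(1) that in auto)
  have eq: "(\<Sum>i<n. integral {0..x} (\<lambda>t. w t * u i t)) - integral {0..x} (\<lambda>t. w t * ?U t) =
      - integral {0..x} (\<lambda>t. w t * (?U t - (\<Sum>i<n. u i t)))" for n
  proof -
    have "(\<Sum>i<n. integral {0..x} (\<lambda>t. w t * u i t)) = integral {0..x} (\<lambda>t. \<Sum>i<n. w t * u i t)"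
      by (intro integral_sum[symmetric] int u) auto
    also have "\<dots> = integral {0..x} (\<lambda>t. w t * (\<Sum>i<n. u i t))" by (simp add: sum_distrib_left)
    finally have 1: "(\<Sum>i<n. integral {0..x} (\<lambda>t. w t * u i t)) = integral {0..x} (\<lambda>t. w t * (\<Sum>i<n. u i t))" .
    show ?thesis unfolding 1 right_diff_distrib
      by (subst integral_diff) (auto intro!: int S U)
  qed
  have le: "cmod (- integral {0..x} (\<lambda>t. w t * (?U t - (\<Sum>i<n. u i t)))) \<le> ?W * (\<Sum>i. c (i + n))" for n
    unfolding norm_minus_cancel
  proof (rule norm_integral_mult_le[OF w _ x])
    show "continuous_on {0..1} (\<lambda>t. ?U t - (\<Sum>i<n. u i t))" by (intro continuous_intros U S)
    fix t assume "t \<in> {0..x}"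
    then have t: "t \<in> {0..1}" using x by auto
    have "?U t - (\<Sum>i<n. u i t) = (\<Sum>i. u (i + n) t)"
      using suminf_split_initial_segment[OF s[OF t], of n] by simp
    also have "cmod \<dots> \<le> (\<Sum>i. c (i + n))"
      by (intro norm_suminf_le c(1)[OF t]) (use c(2) in \<open>auto simp: summable_iff_shift\<close>)
    finally show "cmod (?U t - (\<Sum>i<n. u i t)) \<le> (\<Sum>i. c (i + n))" .
  qed
  have "(\<lambda>n. ?W * (\<Sum>i. c (i + n))) \<longlonglongrightarrow> ?W * 0"
    by (intro tendsto_mult tendsto_const suminf_exist_split2 c)
  then have "(\<lambda>n. (\<Sum>i<n. integral {0..x} (\<lambda>t. w t * u i t)) - integral {0..x} (\<lambda>t. w t * ?U t)) \<longlonglongrightarrow> 0"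
    unfolding eq using Lim_null_comparison[OF always_eventually[OF allI[OF le]]] by simp
  then show ?thesis unfolding sums_def by (subst LIM_zero_iff[symmetric])
qed

section \<open>The initial value problem with summable coefficient\<close>

text \<open>The equation \<open>u'' = w u + h\<close> as a first order system \<open>u' = v\<close>, \<open>v' = w u + h\<close> in integrated form.
  With \<open>w = q - \<mu>\<close> and \<open>h = 0\<close> this is \<open>- u'' + q u = \<mu> u\<close>, and \<open>h = - g\<close> gives the equation
  \<open>- u'' + q u = \<mu> u + g\<close> of an associated function. The system form keeps a merely summable \<open>w\<close> harmless.\<close>

definition ivp :: "(real \<Rightarrow> complex) \<Rightarrow> (real \<Rightarrow> complex) \<Rightarrow> (real \<Rightarrow> complex) \<Rightarrow> (real \<Rightarrow> complex) \<Rightarrow> bool" where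
  "ivp w h u v \<longleftrightarrow> (\<forall>x\<in>{0..1}. (v has_integral (u x - u 0)) {0..x} \<and>
      ((\<lambda>t. w t * u t + h t) has_integral (v x - v 0)) {0..x})"

lemma continuous_on_primitive:
  fixes f g :: "real \<Rightarrow> complex"
  assumes "\<And>x. x \<in> {0..1} \<Longrightarrow> (g has_integral (f x - f 0)) {0..x}"
  shows "continuous_on {0..1} f"
proof -
  have "g integrable_on {0..1}" using assms[of 1] by auto
  then have "continuous_on {0..1} (\<lambda>x. f 0 + integral {0..x} g)"
    by (intro continuous_intros indefinite_integral_continuous_1)
  moreover have "f 0 + integral {0..x} g = f x" if "x \<in> {0..1}" for x
    using integral_unique[OF assms[OF that]] by simp
  ultimately show ?thesis by (subst continuous_on_cong[OF refl, of _ _ "\<lambda>x. f 0 + integral {0..x} g"]) auto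
qed

lemma ivp_continuous:
  assumes "ivp w h u v"
  shows "continuous_on {0..1} u" "continuous_on {0..1} v"
  using assms by (auto simp: ivp_def intro: continuous_on_primitive)

lemma ivp_linear:
  assumes "ivp w h u v" "ivp w k p r"
  shows "ivp w (\<lambda>t. a * h t + b * k t) (\<lambda>t. a * u t + b * p t) (\<lambda>t. a * v t + b * r t)"
  unfolding ivp_def
proof (intro ballI conjI)
  fix x :: real assume x: "x \<in> {0..1}"
  note 1 = assms(1)[unfolded ivp_def, rule_format, OF x] and 2 = assms(2)[unfolded ivp_def, rule_format, OF x]
  have "((\<lambda>t. a * v t + b * r t) has_integral (a * (u x - u 0) + b * (p x - p 0))) {0..x}"
    using 1 2 by (intro has_integral_add has_integral_mult_right) auto
  then show "((\<lambda>t. a * v t + b * r t) has_integral (a * u x + b * p x - (a * u 0 + b * p 0))) {0..x}"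
    by (simp add: algebra_simps)
  have "((\<lambda>t. a * (w t * u t + h t) + b * (w t * p t + k t)) has_integral (a * (v x - v 0) + b * (r x - r 0))) {0..x}"
    using 1 2 by (intro has_integral_add has_integral_mult_right) auto
  then show "((\<lambda>t. w t * (a * u t + b * p t) + (a * h t + b * k t)) has_integral
      (a * v x + b * r x - (a * v 0 + b * r 0))) {0..x}"
    by (simp add: algebra_simps)
qed

lemma ivp_cong:
  assumes "ivp w h u v" and "\<And>t. t \<in> {0..1} \<Longrightarrow> w t * u t + h t = w' t * u' t + h' t"
    and "\<And>t. t \<in> {0..1} \<Longrightarrow> u' t = u t" "\<And>t. t \<in> {0..1} \<Longrightarrow> v' t = v t"
  shows "ivp w' h' u' v'"
  unfolding ivp_def
proof (intro ballI conjI)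
  fix x :: real assume x: "x \<in> {0..1}"
  note 1 = assms(1)[unfolded ivp_def, rule_format, OF x]
  have "(v' has_integral (u x - u 0)) {0..x}"
    by (rule has_integral_eq[OF _ conjunct1[OF 1]]) (use x assms in auto)
  then show "(v' has_integral (u' x - u' 0)) {0..x}" using x assms by auto
  have "((\<lambda>t. w' t * u' t + h' t) has_integral (v x - v 0)) {0..x}"
    by (rule has_integral_eq[OF _ conjunct2[OF 1]]) (use x assms(2) in auto)
  then show "((\<lambda>t. w' t * u' t + h' t) has_integral (v' x - v' 0)) {0..x}" using x assms by auto
qed

lemma ivp_zero: "ivp w (\<lambda>_. 0) (\<lambda>_. 0) (\<lambda>_. 0)"
  by (simp add: ivp_def)

lemma ivp_scale: "ivp w h u v \<Longrightarrow> ivp w (\<lambda>t. c * h t) (\<lambda>t. c * u t) (\<lambda>t. c * v t)"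
  using ivp_linear[OF _ ivp_zero, of w h u v c 0] by simp

lemma ivp_sum:
  assumes "finite I" "\<And>i. i \<in> I \<Longrightarrow> ivp w (h i) (u i) (v i)"
  shows "ivp w (\<lambda>t. \<Sum>i\<in>I. c i * h i t) (\<lambda>t. \<Sum>i\<in>I. c i * u i t) (\<lambda>t. \<Sum>i\<in>I. c i * v i t)"
  using assms
proof (induction I rule: finite_induct)
  case (insert i I)
  have "ivp w (\<lambda>t. c i * h i t + 1 * (\<Sum>i\<in>I. c i * h i t)) (\<lambda>t. c i * u i t + 1 * (\<Sum>i\<in>I. c i * u i t))
      (\<lambda>t. c i * v i t + 1 * (\<Sum>i\<in>I. c i * v i t))"
    by (intro ivp_linear insert.prems insert.IH) simp_all
  then show ?case using insert.hyps by simp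
qed (simp add: ivp_zero)

lemma halved_byD:
  assumes "halved_by w K"
  shows "K \<ge> 0"
    and "continuous_on {0..1} u \<Longrightarrow> D \<ge> 0 \<Longrightarrow> \<forall>t\<in>{0..1}. cmod (u t) \<le> D * exp (K * t) \<Longrightarrow> x \<in> {0..1} \<Longrightarrow>
      cmod (integral {0..x} (\<lambda>t. w t * u t)) \<le> D / 2 * exp (K * x)"
    and "continuous_on {0..1} u \<Longrightarrow> D \<ge> 0 \<Longrightarrow> \<forall>t\<in>{0..1}. cmod (u t) \<le> D * exp (K * t) \<Longrightarrow> x \<in> {0..1} \<Longrightarrow>
      cmod (integral {0..x} u) \<le> D / 2 * exp (K * x)"
  using assms unfolding halved_by_def by blast+

text \<open>The right-hand side of the integrated system halves a weighted supremum of \<open>u\<close> and \<open>v\<close>, so this supremum is zero.\<close>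

lemma ivp_unique_zero:
  assumes w: "w absolutely_integrable_on {0..1}" and i: "ivp w (\<lambda>_. 0) u v" "u 0 = 0" "v 0 = 0"
    and x: "x \<in> {0..1}"
  shows "u x = 0" "v x = 0"
proof -
  note c = ivp_continuous[OF i(1)]
  obtain K where hK: "halved_by w K" using ex_halved_by[OF w] by blast
  note K = halved_byD[OF hK]
  obtain S1 where S1: "S1 \<ge> 0" "\<And>t. t \<in> {0..1} \<Longrightarrow> cmod (u t) \<le> S1" using continuous_on_bounded_cmod[OF c(1)] by blast
  obtain S2 where S2: "S2 \<ge> 0" "\<And>t. t \<in> {0..1} \<Longrightarrow> cmod (v t) \<le> S2" using continuous_on_bounded_cmod[OF c(2)] by blast
  define S where "S = S1 + S2"
  have eq: "u x = integral {0..x} v" "v x = integral {0..x} (\<lambda>t. w t * u t)" if "x \<in> {0..1}" for x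
    using i that by (auto simp: ivp_def intro!: integral_unique[symmetric])
  have le: "\<forall>x\<in>{0..1}. cmod (u x) \<le> S * (1/2)^n * exp (K * x) \<and> cmod (v x) \<le> S * (1/2)^n * exp (K * x)" for n
  proof (induction n)
    case 0
    have "S * 1 \<le> S * exp (K * x)" if "x \<in> {0..1}" for x
      using K(1) S1(1) S2(1) that by (intro mult_left_mono) (auto simp: S_def)
    moreover have "cmod (u x) \<le> S" "cmod (v x) \<le> S" if "x \<in> {0..1}" for x
      using S1 S2(1) S1(2)[OF that] S2(2)[OF that] by (auto simp: S_def)
    ultimately show ?case by fastforce
  next
    case (Suc n)
    have "S * (1/2)^n \<ge> 0" using S1(1) S2(1) by (simp add: S_def)
    then show ?case
      using K(2)[OF c(1), of "S * (1/2)^n"] K(3)[OF c(2), of "S * (1/2)^n"] Suc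
      by (simp add: eq)
  qed
  have "(\<lambda>n. S * (1/2)^n * exp (K * x)) \<longlonglongrightarrow> S * 0 * exp (K * x)"
    by (intro tendsto_intros LIMSEQ_power_zero) auto
  then have z: "(\<lambda>n. S * (1/2)^n * exp (K * x)) \<longlonglongrightarrow> 0" by simp
  have "cmod (u x) \<le> 0" by (rule LIMSEQ_le_const[OF z]) (use le x in auto)
  moreover have "cmod (v x) \<le> 0" by (rule LIMSEQ_le_const[OF z]) (use le x in auto)
  ultimately show "u x = 0" "v x = 0" by auto
qed

lemma ivp_unique:
  assumes w: "w absolutely_integrable_on {0..1}" and i: "ivp w h u v" "ivp w h p r" "u 0 = p 0" "v 0 = r 0"
    and x: "x \<in> {0..1}"
  shows "u x = p x" "v x = r x"
proof -
  have "ivp w (\<lambda>t. 1 * h t + (-1) * h t) (\<lambda>t. 1 * u t + (-1) * p t) (\<lambda>t. 1 * v t + (-1) * r t)"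
    by (rule ivp_linear[OF i(1,2)])
  then have "ivp w (\<lambda>_. 0) (\<lambda>t. u t - p t) (\<lambda>t. v t - r t)" by simp
  from ivp_unique_zero[OF w this _ _ x] i show "u x = p x" "v x = r x" by auto
qed

text \<open>Picard iteration. Successive terms are halved in the weighted supremum, so their series converges
  uniformly; the geometric sum yields a bound for the solution in terms of the data, with a factor depending on \<open>w\<close> only.\<close>

lemma ivp_exists_bounded:
  assumes w: "w absolutely_integrable_on {0..1}" and hK: "halved_by w K"
    and h: "continuous_on {0..1} h" and hB: "\<And>t. t \<in> {0..1} \<Longrightarrow> cmod (h t) \<le> B"
    and a: "cmod a \<le> B" and b: "cmod b \<le> B"
  shows "\<exists>u v. ivp w h u v \<and> u 0 = a \<and> v 0 = b \<and> (\<forall>x\<in>{0..1}. cmod (u x) \<le> 4 * exp K * B \<and> cmod (v x) \<le> 4 * exp K * B)"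
proof -
  note K = halved_byD[OF hK]
  have B: "B \<ge> 0" using a norm_ge_zero[of a] by linarith
  define G where "G = (\<lambda>x. b + integral {0..x} h)"
  have hi: "h integrable_on {0..x}" if "x \<in> {0..1}" for x
    by (rule integrable_continuous_interval) (use continuous_on_subset[OF h] that in auto)
  have G: "continuous_on {0..1} G"
    unfolding G_def using hi[of 1] by (intro continuous_intros indefinite_integral_continuous_1) auto
  have Gb: "cmod (G x) \<le> 2 * B" if x: "x \<in> {0..1}" for x
  proof -
    have "cmod (integral {0..x} h) \<le> integral {0..x} (\<lambda>_. B)"
      using x hB hi by (intro integral_norm_bound_integral) auto
    also have "\<dots> \<le> 1 * B" using x B mult_right_mono[of x 1 B] by simp
    finally show ?thesis unfolding G_def using norm_triangle_ineq[of b "integral {0..x} h"] b by simp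
  qed
  \<comment> \<open>The constant \<open>a\<close> and the primitive \<open>G\<close> of \<open>h\<close> are the terms of the integrated system without \<open>u\<close> and \<open>v\<close>.\<close>
  define P where "P = rec_nat (\<lambda>_. a, G) (\<lambda>_ p. (\<lambda>x. integral {0..x} (snd p), \<lambda>x. integral {0..x} (\<lambda>t. w t * fst p t)))"
  define U where "U = (\<lambda>n. fst (P n))"
  define V where "V = (\<lambda>n. snd (P n))"
  have U0: "U 0 = (\<lambda>_. a)" and V0: "V 0 = G" by (simp_all add: U_def V_def P_def)
  have US: "U (Suc n) = (\<lambda>x. integral {0..x} (V n))"
    and VS: "V (Suc n) = (\<lambda>x. integral {0..x} (\<lambda>t. w t * U n t))" for n
    by (simp_all add: U_def V_def P_def)
  have cont: "continuous_on {0..1} (U n) \<and> continuous_on {0..1} (V n)" for n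
  proof (induction n)
    case (Suc n)
    have "(\<lambda>t. w t * U n t) integrable_on {0..1}"
      using absolutely_integrable_times_continuous[OF w] Suc by (auto simp: absolutely_integrable_on_def)
    moreover have "V n integrable_on {0..1}" using Suc integrable_continuous_real by auto
    ultimately show ?case unfolding US VS by (auto intro: indefinite_integral_continuous_1)
  qed (auto simp: U0 V0 G)
  have bound: "\<forall>x\<in>{0..1}. cmod (U n x) \<le> (2*B) * (1/2)^n * exp (K * x) \<and> cmod (V n x) \<le> (2*B) * (1/2)^n * exp (K * x)" for n
  proof (induction n)
    case 0
    have "2 * B * 1 \<le> 2 * B * exp (K * x)" if "x \<in> {0..1}" for x
      using K(1) B that by (intro mult_left_mono) auto
    then show ?case using Gb a B by (force simp: U0 V0)
  next
    case (Suc n)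
    have "(2*B) * (1/2)^n \<ge> 0" using B by simp
    then show ?case
      using K(2)[OF conjunct1[OF cont[of n]], of "(2*B) * (1/2)^n"]
        K(3)[OF conjunct2[OF cont[of n]], of "(2*B) * (1/2)^n"] Suc
      by (simp add: US VS)
  qed
  define c where "c = (\<lambda>n::nat. (2 * B * exp K) * (1/2)^n)"
  have cs: "c sums (4 * exp K * B)"
    unfolding c_def using sums_mult[OF geometric_sums[of "1/2::real"], of "2 * B * exp K"] by (simp add: mult_ac)
  have bc: "cmod (U n x) \<le> c n" "cmod (V n x) \<le> c n" if x: "x \<in> {0..1}" for n x
  proof -
    have "(2*B) * (1/2)^n * exp (K * x) \<le> (2*B) * (1/2)^n * exp K"
      using x K(1) B by (intro mult_left_mono) (auto simp: mult_left_le)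
    moreover have "c n = (2*B) * (1/2)^n * exp K" by (simp add: c_def)
    ultimately show "cmod (U n x) \<le> c n" "cmod (V n x) \<le> c n"
      using bspec[OF bound[of n] x] by linarith+
  qed
  have sm: "summable (\<lambda>n. U n x)" "summable (\<lambda>n. V n x)" if "x \<in> {0..1}" for x
    by (rule summable_comparison_test[OF _ sums_summable[OF cs]]; use bc that in blast)+
  let ?u = "\<lambda>x. \<Sum>n. U n x" and ?v = "\<lambda>x. \<Sum>n. V n x"
  have one: "(\<lambda>_. 1::complex) absolutely_integrable_on {0..1::real}"
    by (rule absolutely_integrable_continuous_real) auto
  have uc: "continuous_on {0..1} ?u" "continuous_on {0..1} ?v"
    using continuous_on_suminf[OF conjunct1[OF cont] bc(1) sums_summable[OF cs]]
      continuous_on_suminf[OF conjunct2[OF cont] bc(2) sums_summable[OF cs]] by auto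
  have u: "?u x = a + integral {0..x} ?v" if x: "x \<in> {0..1}" for x
  proof -
    have "(\<lambda>n. integral {0..x} (\<lambda>t. 1 * V n t)) sums integral {0..x} (\<lambda>t. 1 * ?v t)"
      by (rule integral_mult_suminf[OF one x conjunct2[OF cont] bc(2) sums_summable[OF cs]])
    then have "(\<lambda>n. U (Suc n) x) sums integral {0..x} ?v" by (simp add: US)
    then have "(\<lambda>n. U n x) sums (integral {0..x} ?v + U 0 x)" by (rule sums_Suc)
    then show ?thesis by (simp add: U0 sums_iff)
  qed
  have v: "?v x = G x + integral {0..x} (\<lambda>t. w t * ?u t)" if x: "x \<in> {0..1}" for x
  proof -
    have "(\<lambda>n. integral {0..x} (\<lambda>t. w t * U n t)) sums integral {0..x} (\<lambda>t. w t * ?u t)"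
      by (rule integral_mult_suminf[OF w x conjunct1[OF cont] bc(1) sums_summable[OF cs]])
    then have "(\<lambda>n. V (Suc n) x) sums integral {0..x} (\<lambda>t. w t * ?u t)" by (simp add: VS)
    then have "(\<lambda>n. V n x) sums (integral {0..x} (\<lambda>t. w t * ?u t) + V 0 x)" by (rule sums_Suc)
    then show ?thesis by (simp add: V0 sums_iff)
  qed
  have u0: "?u 0 = a" and v0: "?v 0 = b" using u[of 0] v[of 0] by (simp_all add: G_def)
  have "ivp w h ?u ?v"
    unfolding ivp_def
  proof (intro ballI conjI)
    fix x :: real assume x: "x \<in> {0..1}"
    have "?v integrable_on {0..x}"
      by (rule integrable_continuous_interval) (use continuous_on_subset[OF uc(2)] x in auto)
    then have "(?v has_integral integral {0..x} ?v) {0..x}" by blast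
    then show "(?v has_integral (?u x - ?u 0)) {0..x}" using u[OF x] u0 by simp
    have "(\<lambda>t. w t * ?u t) integrable_on {0..x}"
      by (rule absolutely_integrable_norm_integrable(1)[OF absolutely_integrable_times_continuous[OF w uc(1)] x])
    then have "((\<lambda>t. w t * ?u t + h t) has_integral (integral {0..x} (\<lambda>t. w t * ?u t) + integral {0..x} h)) {0..x}"
      using hi[OF x] by (intro has_integral_add) auto
    moreover have "integral {0..x} (\<lambda>t. w t * ?u t) + integral {0..x} h = ?v x - ?v 0"
      using v[OF x] v0 by (simp add: G_def)
    ultimately show "((\<lambda>t. w t * ?u t + h t) has_integral (?v x - ?v 0)) {0..x}" by simp
  qed
  moreover have "cmod (?u x) \<le> 4 * exp K * B \<and> cmod (?v x) \<le> 4 * exp K * B" if x: "x \<in> {0..1}" for x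
    using norm_suminf_le[of "\<lambda>n. U n x" c] norm_suminf_le[of "\<lambda>n. V n x" c] bc[OF x] cs by (auto simp: sums_iff)
  ultimately show ?thesis
    using u0 v0 by blast
qed

lemma ivp_exists:
  assumes w: "w absolutely_integrable_on {0..1}" and h: "continuous_on {0..1} h"
  obtains u v where "ivp w h u v" "u 0 = a" "v 0 = b"
proof -
  obtain K where hK: "halved_by w K" using ex_halved_by[OF w] by blast
  obtain S where S: "S \<ge> 0" "\<And>t. t \<in> {0..1} \<Longrightarrow> cmod (h t) \<le> S" using continuous_on_bounded_cmod[OF h] by blast
  have "cmod (h t) \<le> S + cmod a + cmod b" if "t \<in> {0..1}" for t
    using S(2)[OF that] norm_ge_zero[of a] norm_ge_zero[of b] by linarith
  with ivp_exists_bounded[OF w hK h, of "S + cmod a + cmod b" a b] S(1) that show ?thesis by auto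
qed

section \<open>Expansion of solutions in powers of the spectral parameter\<close>

text \<open>Formally \<open>\<Sum>k. z\<^sup>k u\<^sub>k\<close> solves the equation with \<open>w - z\<close> in place of \<open>w\<close> exactly if every \<open>u\<^sub>k\<close>
  solves the equation with inhomogeneity \<open>- u\<^sub>k\<^sub>-\<^sub>1\<close>. For \<open>w = q - \<mu>\<close> this is the equation that defines a chain of an
  eigenfunction and associated functions, whence the link between multiplicities and power series.\<close>

definition ivp_chain :: "(real \<Rightarrow> complex) \<Rightarrow> (nat \<Rightarrow> real \<Rightarrow> complex) \<Rightarrow> (nat \<Rightarrow> real \<Rightarrow> complex) \<Rightarrow> bool" where
  "ivp_chain w u v \<longleftrightarrow> ivp w (\<lambda>_. 0) (u 0) (v 0) \<and> (\<forall>k. ivp w (\<lambda>t. - u k t) (u (Suc k)) (v (Suc k)))"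

lemma ivp_chain_exists:
  assumes w: "w absolutely_integrable_on {0..1}"
  shows "\<exists>u v. ivp_chain w u v \<and> (\<forall>k. u k 0 = a k) \<and> (\<forall>k. v k 0 = b k)"
proof -
  let ?P = "\<lambda>n p. (\<exists>h. ivp w h (fst p) (snd p)) \<and> fst p 0 = a n \<and> snd p 0 = b n \<and> (n = 0 \<longrightarrow> ivp w (\<lambda>_. 0) (fst p) (snd p))"
  let ?Q = "\<lambda>n p p'. ivp w (\<lambda>t. - fst p t) (fst p') (snd p')"
  have "\<exists>f. \<forall>n. ?P n (f n) \<and> ?Q n (f n) (f (Suc n))"
  proof (rule dependent_nat_choice)
    obtain u v where "ivp w (\<lambda>_. 0) u v" "u 0 = a 0" "v 0 = b 0" by (rule ivp_exists[OF w continuous_on_const])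
    then show "\<exists>p. ?P 0 p" by (intro exI[of _ "(u, v)"]) auto
  next
    fix p n assume "?P n p"
    then have "continuous_on {0..1} (\<lambda>t. - fst p t)" by (auto intro!: continuous_intros dest: ivp_continuous)
    then obtain u v where "ivp w (\<lambda>t. - fst p t) u v" "u 0 = a (Suc n)" "v 0 = b (Suc n)" by (rule ivp_exists[OF w])
    then show "\<exists>p'. ?P (Suc n) p' \<and> ?Q n p p'" by (intro exI[of _ "(u, v)"]) auto
  qed
  then obtain f where f: "\<And>n. ?P n (f n)" "\<And>n. ?Q n (f n) (f (Suc n))" by blast
  show ?thesis
    by (rule exI[of _ "\<lambda>n. fst (f n)"], rule exI[of _ "\<lambda>n. snd (f n)"]) (use f in \<open>auto simp: ivp_chain_def\<close>)
qed

lemma ivp_chain_continuous: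
  assumes "ivp_chain w u v"
  shows "continuous_on {0..1} (u k)" "continuous_on {0..1} (v k)"
  using assms by (cases k; auto simp: ivp_chain_def dest: ivp_continuous)+

text \<open>Every step of the chain costs at most a constant factor, so geometric bounds on the initial data are inherited
  by the solutions. Together with the next lemma this turns the formal power series into a convergent one.\<close>

lemma ivp_chain_bound:
  assumes w: "w absolutely_integrable_on {0..1}" and ch: "ivp_chain w u v"
    and AL: "\<And>k. cmod (u k 0) \<le> A * L ^ k" "\<And>k. cmod (v k 0) \<le> A * L ^ k" "L \<ge> 0"
  shows "\<exists>C M. C \<ge> 0 \<and> M \<ge> 1 \<and> (\<forall>k. \<forall>x\<in>{0..1}. cmod (u k x) \<le> C * M ^ k \<and> cmod (v k x) \<le> C * M ^ k)"
proof -
  obtain K where hK: "halved_by w K" using ex_halved_by[OF w] by blast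
  define C where "C = 4 * exp K"
  have C: "C \<ge> 1" using halved_byD(1)[OF hK] one_le_exp_iff[of K] unfolding C_def by linarith
  have *: "cmod (u x) \<le> C * B" "cmod (v x) \<le> C * B"
    if "ivp w h u v" "continuous_on {0..1} h" "\<And>t. t \<in> {0..1} \<Longrightarrow> cmod (h t) \<le> B"
      "cmod (u 0) \<le> B" "cmod (v 0) \<le> B" "x \<in> {0..1}" for h u v B x
  proof -
    note prems = that
    obtain p r where p: "ivp w h p r" "p 0 = u 0" "r 0 = v 0"
      "\<forall>x\<in>{0..1}. cmod (p x) \<le> C * B \<and> cmod (r x) \<le> C * B"
      using ivp_exists_bounded[OF w hK prems(2,3,4,5)] unfolding C_def by auto
    then show "cmod (u x) \<le> C * B" "cmod (v x) \<le> C * B"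
      using ivp_unique[OF w that(1) p(1) _ _ that(6)] that(6) by auto
  qed
  have A: "A \<ge> 0" using AL(1)[of 0] norm_ge_zero[of "u 0 0"] by (simp del: norm_ge_zero)
  define M where "M = max L C"
  have M: "M \<ge> L" "M \<ge> C" "M \<ge> 1" using C by (auto simp: M_def)
  have le: "\<forall>x\<in>{0..1}. cmod (u k x) \<le> (C * A) * M ^ k \<and> cmod (v k x) \<le> (C * A) * M ^ k" for k
  proof (induction k)
    case 0
    show ?case
      using *[of "\<lambda>_. 0" "u 0" "v 0" A] ch AL(1)[of 0] AL(2)[of 0] A by (auto simp: ivp_chain_def)
  next
    case (Suc k)
    have AM: "A * L ^ Suc k \<le> A * M ^ Suc k"
      using A AL(3) M by (intro mult_left_mono power_mono) auto
    have CM: "C * A * M ^ k \<le> A * M ^ Suc k"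
      using A M C by (simp add: mult_ac mult_left_mono mult_right_mono)
    have "cmod (u (Suc k) x) \<le> C * (A * M ^ Suc k) \<and> cmod (v (Suc k) x) \<le> C * (A * M ^ Suc k)" if "x \<in> {0..1}" for x
    proof -
      have a: "ivp w (\<lambda>t. - u k t) (u (Suc k)) (v (Suc k))" using ch by (auto simp: ivp_chain_def)
      have b: "continuous_on {0..1} (\<lambda>t. - u k t)" by (intro continuous_intros ivp_chain_continuous[OF ch])
      have c: "cmod (- u k t) \<le> A * M ^ Suc k" if "t \<in> {0..1}" for t
        using Suc CM that by (auto intro: order_trans)
      show ?thesis using *[OF a b c _ _ that] AL(1,2)[of "Suc k"] AM by linarith
    qed
    then show ?case by (simp add: mult_ac)
  qed
  show ?thesis
    by (rule exI[of _ "C * A"], rule exI[of _ M]) (use le M C A in auto)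
qed

lemma ivp_chain_sums:
  assumes w: "w absolutely_integrable_on {0..1}" and ch: "ivp_chain w u v"
    and CM: "M \<ge> 1" "\<forall>k. \<forall>x\<in>{0..1}. cmod (u k x) \<le> C * M ^ k \<and> cmod (v k x) \<le> C * M ^ k"
    and z: "cmod z < 1 / M"
  shows "\<And>x. x \<in> {0..1} \<Longrightarrow> summable (\<lambda>k. z ^ k * u k x)" "\<And>x. x \<in> {0..1} \<Longrightarrow> summable (\<lambda>k. z ^ k * v k x)"
    "ivp (\<lambda>t. w t - z) (\<lambda>_. 0) (\<lambda>x. \<Sum>k. z ^ k * u k x) (\<lambda>x. \<Sum>k. z ^ k * v k x)"
proof -
  define c where "c = (\<lambda>k. C * (cmod z * M) ^ k)"
  have zM: "cmod z * M < 1" using z CM(1) by (simp add: field_simps)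
  have c: "summable c"
    unfolding c_def using zM CM(1) by (intro summable_mult summable_geometric) auto
  have bu: "cmod (z ^ k * u k x) \<le> c k" and bv: "cmod (z ^ k * v k x) \<le> c k" if x: "x \<in> {0..1}" for k x
    using bspec[OF spec[OF CM(2), of k] x]
    unfolding c_def norm_mult norm_power power_mult_distrib mult.left_commute[of C]
    by (intro mult_left_mono; simp)+
  show su: "summable (\<lambda>k. z ^ k * u k x)" and sv: "summable (\<lambda>k. z ^ k * v k x)" if "x \<in> {0..1}" for x
    by (rule summable_comparison_test[OF _ c]; use bu[OF that] bv[OF that] in blast)+
  have cu: "continuous_on {0..1} (\<lambda>t. z ^ k * u k t)" and cv: "continuous_on {0..1} (\<lambda>t. z ^ k * v k t)" for k
    by (intro continuous_intros ivp_chain_continuous[OF ch])+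
  let ?U = "\<lambda>x. \<Sum>k. z ^ k * u k x" and ?V = "\<lambda>x. \<Sum>k. z ^ k * v k x"
  have cU: "continuous_on {0..1} ?U" and cV: "continuous_on {0..1} ?V"
    using continuous_on_suminf[OF cu bu c] continuous_on_suminf[OF cv bv c] by auto
  have one: "(\<lambda>_. 1::complex) absolutely_integrable_on {0..1::real}"
    by (rule absolutely_integrable_continuous_real) auto
  show "ivp (\<lambda>t. w t - z) (\<lambda>_. 0) ?U ?V"
    unfolding ivp_def
  proof (intro ballI conjI)
    fix x :: real assume x: "x \<in> {0..1}"
    have 0: "0 \<in> {0..1::real}" by simp
    have Vi: "?V integrable_on {0..x}" and Ui: "?U integrable_on {0..x}"
      by (rule integrable_continuous_interval; use continuous_on_subset[OF cU] continuous_on_subset[OF cV] x in force)+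
    have wU: "(\<lambda>t. w t * ?U t) integrable_on {0..x}"
      by (rule absolutely_integrable_norm_integrable(1)[OF absolutely_integrable_times_continuous[OF w cU] x])
    have i1: "integral {0..x} (v k) = u k x - u k 0" for k
      using ch x by (cases k) (auto simp: ivp_chain_def ivp_def intro!: integral_unique)
    have ku: "u k integrable_on {0..x}" and wk: "(\<lambda>t. w t * u k t) integrable_on {0..x}" for k
      using absolutely_integrable_norm_integrable(1)[OF absolutely_integrable_times_continuous[OF w ivp_chain_continuous(1)[OF ch]] x]
        absolutely_integrable_norm_integrable(1)[OF absolutely_integrable_times_continuous[OF one ivp_chain_continuous(1)[OF ch]] x] by auto
    have i2: "integral {0..x} (\<lambda>t. w t * u 0 t) = v 0 x - v 0 0"
      using ch x by (auto simp: ivp_chain_def ivp_def intro!: integral_unique)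
    have i3: "integral {0..x} (\<lambda>t. w t * u (Suc k) t) - integral {0..x} (u k) = v (Suc k) x - v (Suc k) 0" for k
    proof -
      have "integral {0..x} (\<lambda>t. w t * u (Suc k) t - u k t) = v (Suc k) x - v (Suc k) 0"
        using ch x by (auto simp: ivp_chain_def ivp_def intro!: integral_unique)
      then show ?thesis by (simp add: integral_diff wk ku)
    qed
    have "(\<lambda>k. integral {0..x} (\<lambda>t. 1 * (z ^ k * v k t))) sums integral {0..x} (\<lambda>t. 1 * ?V t)"
      by (rule integral_mult_suminf[OF one x cv bv c])
    then have "(\<lambda>k. z ^ k * u k x - z ^ k * u k 0) sums integral {0..x} ?V"
      by (simp add: i1 right_diff_distrib)
    moreover have "(\<lambda>k. z ^ k * u k x - z ^ k * u k 0) sums (?U x - ?U 0)"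
      by (intro sums_diff summable_sums su x 0)
    ultimately have "integral {0..x} ?V = ?U x - ?U 0" by (rule sums_unique2)
    with Vi show "(?V has_integral (?U x - ?U 0)) {0..x}" by (metis integrable_integral)
    have s1: "(\<lambda>k. integral {0..x} (\<lambda>t. w t * (z ^ k * u k t))) sums integral {0..x} (\<lambda>t. w t * ?U t)"
      by (rule integral_mult_suminf[OF w x cu bu c])
    have e1: "integral {0..x} (\<lambda>t. w t * (z ^ k * u k t)) = z ^ k * integral {0..x} (\<lambda>t. w t * u k t)" for k
      by (subst integral_mult_right[symmetric]) (simp add: mult.left_commute)
    have "(\<lambda>k. integral {0..x} (\<lambda>t. 1 * (z ^ k * u k t))) sums integral {0..x} (\<lambda>t. 1 * ?U t)"
      by (rule integral_mult_suminf[OF one x cu bu c])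
    then have s2: "(\<lambda>k. z ^ k * integral {0..x} (u k)) sums integral {0..x} ?U" by simp
    have s1': "(\<lambda>k. z ^ k * integral {0..x} (\<lambda>t. w t * u k t)) sums integral {0..x} (\<lambda>t. w t * ?U t)"
      using s1 unfolding e1 .
    have "(\<lambda>k. z ^ Suc k * integral {0..x} (\<lambda>t. w t * u (Suc k) t)) sums
        (integral {0..x} (\<lambda>t. w t * ?U t) - z ^ 0 * integral {0..x} (\<lambda>t. w t * u 0 t))"
      using s1' by (subst sums_Suc_iff) simp
    moreover have "(\<lambda>k. z * (z ^ k * integral {0..x} (u k))) sums (z * integral {0..x} ?U)"
      by (rule sums_mult[OF s2])
    ultimately have "(\<lambda>k. z ^ Suc k * integral {0..x} (\<lambda>t. w t * u (Suc k) t) - z * (z ^ k * integral {0..x} (u k))) sums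
        (integral {0..x} (\<lambda>t. w t * ?U t) - z ^ 0 * integral {0..x} (\<lambda>t. w t * u 0 t) - z * integral {0..x} ?U)"
      by (rule sums_diff)
    also have "(\<lambda>k. z ^ Suc k * integral {0..x} (\<lambda>t. w t * u (Suc k) t) - z * (z ^ k * integral {0..x} (u k)))
        = (\<lambda>k. z ^ Suc k * (v (Suc k) x - v (Suc k) 0))"
      unfolding i3[symmetric] by (simp add: algebra_simps)
    finally have "(\<lambda>k. z ^ k * (v k x - v k 0)) sums
        (integral {0..x} (\<lambda>t. w t * ?U t) - z * integral {0..x} ?U)"
      by (subst (asm) sums_Suc_iff) (simp add: i2)
    moreover have "(\<lambda>k. z ^ k * v k x - z ^ k * v k 0) sums (?V x - ?V 0)"
      by (intro sums_diff summable_sums sv x 0)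
    ultimately have eq: "integral {0..x} (\<lambda>t. w t * ?U t) - z * integral {0..x} ?U = ?V x - ?V 0"
      by (simp add: right_diff_distrib sums_unique2)
    have "((\<lambda>t. w t * ?U t - z * ?U t) has_integral (integral {0..x} (\<lambda>t. w t * ?U t) - z * integral {0..x} ?U)) {0..x}"
      using wU Ui by (intro has_integral_diff has_integral_mult_right) auto
    then show "((\<lambda>t. (w t - z) * ?U t + 0) has_integral (?V x - ?V 0)) {0..x}"
      unfolding eq by (simp add: algebra_simps)
  qed
qed

section \<open>Variation of constants and asymptotics of solutions\<close>

text \<open>The derivative of \<open>v\<close> exists only almost everywhere, so no pointwise fundamental theorem applies to \<open>U v\<close>.
  Instead, let \<open>\<Phi>\<close> be the difference of both sides. Its increment over a short interval is at most \<open>\<epsilon>\<close> times the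
  increment of the fixed monotone function \<open>G\<close>, by uniform continuity of \<open>U\<close> and \<open>v\<close>; a Bolzano argument adds up these
  increments, and \<open>\<Phi>\<close> is constant.\<close>

lemma integral_by_parts_primitive:
  fixes f v U U' :: "real \<Rightarrow> complex"
  assumes f: "f absolutely_integrable_on {0..1}"
    and v: "\<And>x. x \<in> {0..1} \<Longrightarrow> (f has_integral (v x - v 0)) {0..x}"
    and U: "\<And>x. x \<in> {0..1} \<Longrightarrow> (U has_vector_derivative U' x) (at x within {0..1})"
    and U': "continuous_on {0..1} U'" and x: "x \<in> {0..1}"
  shows "integral {0..x} (\<lambda>t. f t * U t) = U x * v x - U 0 * v 0 - integral {0..x} (\<lambda>t. U' t * v t)"
proof -
  have cU: "continuous_on {0..1} U" by (rule continuous_on_vector_derivative) (use U in auto)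
  have cv: "continuous_on {0..1} v" by (rule continuous_on_primitive[OF v])
  define \<Phi> where "\<Phi> = (\<lambda>x. integral {0..x} (\<lambda>t. f t * U t) - U x * v x + integral {0..x} (\<lambda>t. U' t * v t))"
  obtain M where M: "M \<ge> 0" "\<And>t. t \<in> {0..1} \<Longrightarrow> cmod (U' t) \<le> M" using continuous_on_bounded_cmod[OF U'] by blast
  define G where "G = (\<lambda>x. integral {0..x} (\<lambda>t. cmod (f t)) + M * x)"
  have fi: "f integrable_on {a..b}" "(\<lambda>t. cmod (f t)) integrable_on {a..b}"
    if "0 \<le> a" "b \<le> 1" for a b
    using absolutely_integrable_on_subinterval[OF f, of a b] that by (auto simp: absolutely_integrable_on_def)
  have fU: "(\<lambda>t. f t * h t) integrable_on {a..b}" if "0 \<le> a" "b \<le> 1" "continuous_on {0..1} h" for a b h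
    using absolutely_integrable_on_subinterval[OF absolutely_integrable_times_continuous[OF f that(3)], of a b] that
    by (auto simp: absolutely_integrable_on_def)
  have ci: "h integrable_on {a..b}" if "0 \<le> a" "b \<le> 1" "continuous_on {0..1} h" for a b and h :: "real \<Rightarrow> complex"
    by (rule integrable_continuous_interval) (use continuous_on_subset[OF that(3)] that in auto)
  have incr: "\<Phi> b - \<Phi> a = integral {a..b} (\<lambda>t. f t * (U t - U b)) + integral {a..b} (\<lambda>t. U' t * (v t - v a))"
    if ab: "0 \<le> a" "a \<le> b" "b \<le> 1" for a b
  proof -
    have 1: "integral {0..b} (\<lambda>t. f t * U t) = integral {0..a} (\<lambda>t. f t * U t) + integral {a..b} (\<lambda>t. f t * U t)"
      using ab by (intro Henstock_Kurzweil_Integration.integral_combine[symmetric] fU cU) auto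
    have 2: "integral {0..b} (\<lambda>t. U' t * v t) = integral {0..a} (\<lambda>t. U' t * v t) + integral {a..b} (\<lambda>t. U' t * v t)"
      using ab by (intro Henstock_Kurzweil_Integration.integral_combine[symmetric] ci continuous_intros cv U') auto
    have 3: "integral {a..b} f = v b - v a"
    proof -
      have "integral {0..b} f = integral {0..a} f + integral {a..b} f"
        using ab by (intro Henstock_Kurzweil_Integration.integral_combine[symmetric] fi) auto
      moreover have "integral {0..b} f = v b - v 0" "integral {0..a} f = v a - v 0"
        using ab by (auto intro!: integral_unique v)
      ultimately show ?thesis by (simp add: algebra_simps)
    qed
    have 4: "integral {a..b} U' = U b - U a"
      using ab by (intro integral_unique fundamental_theorem_of_calculus has_vector_derivative_within_subset[OF U]) auto
    have 5: "integral {a..b} (\<lambda>t. f t * (U t - U b)) = integral {a..b} (\<lambda>t. f t * U t) - (v b - v a) * U b"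
      unfolding right_diff_distrib using ab
      by (subst integral_diff) (auto simp: 3 intro!: fU cU)
    have 6: "integral {a..b} (\<lambda>t. U' t * (v t - v a)) = integral {a..b} (\<lambda>t. U' t * v t) - (U b - U a) * v a"
      unfolding right_diff_distrib using ab
      by (subst integral_diff) (auto simp: 4 intro!: ci continuous_intros cv U')
    show ?thesis unfolding \<Phi>_def 1 2 5 6 by (simp add: algebra_simps)
  qed
  have est: "cmod (\<Phi> b - \<Phi> a) \<le> e * (G b - G a)"
    if ab: "0 \<le> a" "a \<le> b" "b \<le> 1" and e: "e > 0" for a b e
  proof -
    have uc: "uniformly_continuous_on {0..1} U" "uniformly_continuous_on {0..1} v"
      by (intro compact_uniformly_continuous cU cv; simp)+
    obtain d1 where d1: "d1 > 0" "\<And>s t. s \<in> {0..1} \<Longrightarrow> t \<in> {0..1} \<Longrightarrow> dist t s < d1 \<Longrightarrow> dist (U t) (U s) < e"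
      using uc(1) e unfolding uniformly_continuous_on_def by blast
    obtain d2 where d2: "d2 > 0" "\<And>s t. s \<in> {0..1} \<Longrightarrow> t \<in> {0..1} \<Longrightarrow> dist t s < d2 \<Longrightarrow> dist (v t) (v s) < e"
      using uc(2) e unfolding uniformly_continuous_on_def by blast
    have loc: "cmod (\<Phi> y - \<Phi> x) \<le> e * (G y - G x)" if xy: "0 \<le> x" "x \<le> y" "y \<le> 1" "y - x < min d1 d2" for x y
    proof -
      have "cmod (integral {x..y} (\<lambda>t. f t * (U t - U y))) \<le> integral {x..y} (\<lambda>t. e * cmod (f t))"
      proof (rule integral_norm_bound_integral)
        fix t assume t: "t \<in> {x..y}"
        have "dist (U t) (U y) < e" by (rule d1(2)) (use t xy in \<open>auto simp: dist_real_def\<close>)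
        then show "norm (f t * (U t - U y)) \<le> e * cmod (f t)"
          using mult_left_mono[of "cmod (U t - U y)" e "cmod (f t)"] by (simp add: norm_mult dist_norm mult.commute)
      qed (use xy fi in \<open>auto intro!: fU continuous_intros cU integrable_on_mult_right\<close>)
      also have "\<dots> = e * (integral {0..y} (\<lambda>t. cmod (f t)) - integral {0..x} (\<lambda>t. cmod (f t)))"
        using Henstock_Kurzweil_Integration.integral_combine[of 0 x y "\<lambda>t. cmod (f t)"] xy fi by simp
      finally have 1: "cmod (integral {x..y} (\<lambda>t. f t * (U t - U y))) \<le> e * (integral {0..y} (\<lambda>t. cmod (f t)) - integral {0..x} (\<lambda>t. cmod (f t)))" .
      have "cmod (integral {x..y} (\<lambda>t. U' t * (v t - v x))) \<le> integral {x..y} (\<lambda>t. M * e)"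
      proof (rule integral_norm_bound_integral)
        fix t assume t: "t \<in> {x..y}"
        have "dist (v t) (v x) < e" by (rule d2(2)) (use t xy in \<open>auto simp: dist_real_def\<close>)
        then show "norm (U' t * (v t - v x)) \<le> M * e"
          unfolding norm_mult using M t xy by (intro mult_mono) (auto simp: dist_norm)
      qed (use xy in \<open>auto intro!: ci continuous_intros cv U'\<close>)
      also have "\<dots> = e * (M * (y - x))" using xy by simp
      finally have 2: "cmod (integral {x..y} (\<lambda>t. U' t * (v t - v x))) \<le> e * (M * (y - x))" .
      show ?thesis
        unfolding incr[OF xy(1,2,3)] using 1 2 norm_triangle_ineq[of "integral {x..y} (\<lambda>t. f t * (U t - U y))" "integral {x..y} (\<lambda>t. U' t * (v t - v x))"]
        by (simp add: G_def algebra_simps)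
    qed
    have "0 \<le> a \<longrightarrow> b \<le> 1 \<longrightarrow> cmod (\<Phi> b - \<Phi> a) \<le> e * (G b - G a)"
      using ab(2)
    proof (induction rule: Bolzano)
      case (trans a b c)
      show ?case
      proof (intro impI)
        assume "0 \<le> a" "c \<le> 1"
        then have "cmod (\<Phi> b - \<Phi> a) \<le> e * (G b - G a)" "cmod (\<Phi> c - \<Phi> b) \<le> e * (G c - G b)" using trans by auto
        moreover have "cmod (\<Phi> c - \<Phi> a) \<le> cmod (\<Phi> c - \<Phi> b) + cmod (\<Phi> b - \<Phi> a)"
          using norm_triangle_ineq[of "\<Phi> c - \<Phi> b" "\<Phi> b - \<Phi> a"] by simp
        ultimately show "cmod (\<Phi> c - \<Phi> a) \<le> e * (G c - G a)" by (simp add: algebra_simps)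
      qed
    next
      case (local x)
      show ?case
        by (rule exI[of _ "min d1 d2"]) (use d1 d2 loc in auto)
    qed
    then show ?thesis using ab by simp
  qed
  have "cmod (\<Phi> x - \<Phi> 0) \<le> 0"
  proof (rule field_le_epsilon)
    fix e :: real assume e: "e > 0"
    have GG: "G x - G 0 \<ge> 0"
      using x M fi by (auto simp: G_def intro!: add_nonneg_nonneg integral_nonneg)
    have "cmod (\<Phi> x - \<Phi> 0) \<le> e / (G x - G 0 + 1) * (G x - G 0)"
      using x e GG by (intro est) auto
    also have "\<dots> \<le> e * 1"
      unfolding times_divide_eq_left times_divide_eq_right[symmetric] using e GG by (intro mult_left_mono) auto
    finally show "cmod (\<Phi> x - \<Phi> 0) \<le> 0 + e" by simp
  qed
  then show ?thesis by (simp add: \<Phi>_def algebra_simps)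
qed

lemma norm_sin_cos_le_exp:
  fixes z :: complex
  shows "cmod (sin z) \<le> exp \<bar>Im z\<bar>" "cmod (cos z) \<le> exp \<bar>Im z\<bar>"
proof -
  have 1: "cmod (exp (\<i> * z)) \<le> exp \<bar>Im z\<bar>" "cmod (exp (- (\<i> * z))) \<le> exp \<bar>Im z\<bar>" by auto
  have "cmod (sin z) = cmod (exp (\<i> * z) - exp (- (\<i> * z))) / 2"
    by (simp add: sin_exp_eq norm_divide norm_mult)
  also have "\<dots> \<le> exp \<bar>Im z\<bar>" using 1 norm_triangle_ineq4[of "exp (\<i> * z)" "exp (- (\<i> * z))"] by linarith
  finally show "cmod (sin z) \<le> exp \<bar>Im z\<bar>" .
  have "cmod (cos z) = cmod (exp (\<i> * z) + exp (- (\<i> * z))) / 2"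
    by (simp add: cos_exp_eq norm_divide norm_mult)
  also have "\<dots> \<le> exp \<bar>Im z\<bar>" using 1 norm_triangle_ineq[of "exp (\<i> * z)" "exp (- (\<i> * z))"] by linarith
  finally show "cmod (cos z) \<le> exp \<bar>Im z\<bar>" .
qed

text \<open>Integrate \<open>v' = (q - \<rho>\<^sup>2) u\<close> and \<open>u' = v\<close> by parts against \<open>sin \<rho>(x - t)\<close> and \<open>cos \<rho>(x - t)\<close>; all terms
  with \<open>\<rho>\<^sup>2\<close> cancel.\<close>

lemma ivp_variation_of_constants:
  fixes q u v :: "real \<Rightarrow> complex" and \<rho> :: complex
  assumes q: "q absolutely_integrable_on {0..1}" and i: "ivp (\<lambda>t. q t - \<rho>\<^sup>2) (\<lambda>_. 0) u v"
    and \<rho>: "\<rho> \<noteq> 0" and x: "x \<in> {0..1}"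
  shows "u x = u 0 * cos (\<rho> * x) + v 0 / \<rho> * sin (\<rho> * x) + integral {0..x} (\<lambda>t. q t * (sin (\<rho> * (x - t)) * u t)) / \<rho>"
    and "v x = v 0 * cos (\<rho> * x) - u 0 * \<rho> * sin (\<rho> * x) + integral {0..x} (\<lambda>t. q t * (cos (\<rho> * (x - t)) * u t))"
proof -
  note cu = ivp_continuous[OF i]
  let ?S = "\<lambda>t. sin (\<rho> * (x - t))" and ?C = "\<lambda>t. cos (\<rho> * (x - t))"
  have dS: "(?S has_vector_derivative - \<rho> * ?C t) (at t within {0..1})" for t
  proof -
    have "((\<lambda>t. sin (\<rho> * (complex_of_real x - complex_of_real t))) has_vector_derivative - \<rho> * ?C t) (at t within {0..1})"
      by (rule has_vector_derivative_real_field) (auto intro!: derivative_eq_intros)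
    then show ?thesis by simp
  qed
  have dC: "(?C has_vector_derivative \<rho> * ?S t) (at t within {0..1})" for t
  proof -
    have "((\<lambda>t. cos (\<rho> * (complex_of_real x - complex_of_real t))) has_vector_derivative \<rho> * ?S t) (at t within {0..1})"
      by (rule has_vector_derivative_real_field) (auto intro!: derivative_eq_intros)
    then show ?thesis by simp
  qed
  have cS: "continuous_on {0..1} ?S" and cC: "continuous_on {0..1} ?C"
    by (intro continuous_intros)+
  have w: "(\<lambda>t. q t - \<rho>\<^sup>2) absolutely_integrable_on {0..1}"
    using q by (intro set_integral_diff) (auto intro: absolutely_integrable_continuous_real)
  have f: "(\<lambda>t. (q t - \<rho>\<^sup>2) * u t) absolutely_integrable_on {0..1}"
    by (rule absolutely_integrable_times_continuous[OF w cu(1)])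
  have v: "\<And>x. x \<in> {0..1} \<Longrightarrow> ((\<lambda>t. (q t - \<rho>\<^sup>2) * u t) has_integral (v x - v 0)) {0..x}"
    and u: "\<And>x. x \<in> {0..1} \<Longrightarrow> (v has_integral (u x - u 0)) {0..x}"
    using i by (auto simp: ivp_def)
  have vi: "v absolutely_integrable_on {0..1}" by (intro absolutely_integrable_continuous_real cu)
  have ci: "h integrable_on {0..x}" if "continuous_on {0..1} h" for h :: "real \<Rightarrow> complex"
    by (rule integrable_continuous_interval) (use continuous_on_subset[OF that] x in auto)
  have qi: "(\<lambda>t. q t * (h t * u t)) integrable_on {0..x}" if "continuous_on {0..1} h" for h
    by (intro absolutely_integrable_norm_integrable(1)[OF absolutely_integrable_times_continuous[OF q] x] continuous_intros that cu)
  have split: "integral {0..x} (\<lambda>t. (q t - \<rho>\<^sup>2) * u t * h t) =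
      integral {0..x} (\<lambda>t. q t * (h t * u t)) - \<rho>\<^sup>2 * integral {0..x} (\<lambda>t. h t * u t)"
    if h: "continuous_on {0..1} h" for h
  proof -
    have "integral {0..x} (\<lambda>t. (q t - \<rho>\<^sup>2) * u t * h t) = integral {0..x} (\<lambda>t. q t * (h t * u t) - \<rho>\<^sup>2 * (h t * u t))"
      by (simp add: algebra_simps)
    also have "\<dots> = integral {0..x} (\<lambda>t. q t * (h t * u t)) - integral {0..x} (\<lambda>t. \<rho>\<^sup>2 * (h t * u t))"
      by (intro integral_diff qi h integrable_on_mult_right ci continuous_intros cu)
    finally show ?thesis by simp
  qed
  have 1: "integral {0..x} (\<lambda>t. q t * (?S t * u t)) - \<rho>\<^sup>2 * integral {0..x} (\<lambda>t. ?S t * u t) =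
      - sin (\<rho> * x) * v 0 + \<rho> * integral {0..x} (\<lambda>t. ?C t * v t)"
    unfolding split[OF cS, symmetric]
    using integral_by_parts_primitive[OF f v dS _ x] cC by (simp add: continuous_intros mult.assoc)
  have 2: "integral {0..x} (\<lambda>t. ?C t * v t) = u x - cos (\<rho> * x) * u 0 - \<rho> * integral {0..x} (\<lambda>t. ?S t * u t)"
    using integral_by_parts_primitive[OF vi u dC _ x] cS by (simp add: continuous_intros mult.assoc mult.commute[of "v _"])
  have 3: "integral {0..x} (\<lambda>t. q t * (?C t * u t)) - \<rho>\<^sup>2 * integral {0..x} (\<lambda>t. ?C t * u t) =
      v x - cos (\<rho> * x) * v 0 - \<rho> * integral {0..x} (\<lambda>t. ?S t * v t)"
    unfolding split[OF cC, symmetric]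
    using integral_by_parts_primitive[OF f v dC _ x] cS by (simp add: continuous_intros mult.assoc)
  have 4: "integral {0..x} (\<lambda>t. ?S t * v t) = - sin (\<rho> * x) * u 0 + \<rho> * integral {0..x} (\<lambda>t. ?C t * u t)"
    using integral_by_parts_primitive[OF vi u dS _ x] cC by (simp add: continuous_intros mult.assoc mult.commute[of "v _"])
  have "integral {0..x} (\<lambda>t. q t * (?S t * u t)) = - sin (\<rho> * x) * v 0 + \<rho> * (u x - cos (\<rho> * x) * u 0)"
    using 1 unfolding 2 by (simp add: algebra_simps power2_eq_square)
  then show "u x = u 0 * cos (\<rho> * x) + v 0 / \<rho> * sin (\<rho> * x) + integral {0..x} (\<lambda>t. q t * (?S t * u t)) / \<rho>"
    using \<rho> by (simp only:) (simp add: field_simps)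
  have "integral {0..x} (\<lambda>t. q t * (?C t * u t)) = v x - cos (\<rho> * x) * v 0 + \<rho> * sin (\<rho> * x) * u 0"
    using 3 unfolding 4 by (simp add: algebra_simps power2_eq_square)
  then show "v x = v 0 * cos (\<rho> * x) - u 0 * \<rho> * sin (\<rho> * x) + integral {0..x} (\<lambda>t. q t * (?C t * u t))"
    by (simp add: algebra_simps)
qed

text \<open>The integral equation bounds the weighted maximum \<open>m\<close> of \<open>\<bar>u x\<bar> exp (- \<bar>Im \<rho>\<bar> x)\<close> by
  \<open>A + Q m / \<bar>\<rho>\<bar>\<close>, hence by \<open>2 A\<close> as soon as \<open>\<bar>\<rho>\<bar> \<ge> 2 Q\<close>. Inserting this bound once into the integral equation
  gives the first order formulas, inserting these again the second order ones.\<close>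

lemma ivp_asymptotics:
  fixes q u v :: "real \<Rightarrow> complex" and \<rho> :: complex
  assumes q: "q absolutely_integrable_on {0..1}" and i: "ivp (\<lambda>t. q t - \<rho>\<^sup>2) (\<lambda>_. 0) u v"
    and Q: "Q = integral {0..1} (\<lambda>t. cmod (q t))" and \<rho>: "\<rho> \<noteq> 0" "2 * Q \<le> cmod \<rho>"
    and A: "A = cmod (u 0) + cmod (v 0 / \<rho>)" and x: "x \<in> {0..1}"
  shows "cmod (u x) \<le> 2 * A * exp (\<bar>Im \<rho>\<bar> * x)"
    and "cmod (u x - (u 0 * cos (\<rho> * x) + v 0 / \<rho> * sin (\<rho> * x))) \<le> 2 * Q * A * exp (\<bar>Im \<rho>\<bar> * x) / cmod \<rho>"
    and "cmod (v x - (v 0 * cos (\<rho> * x) - u 0 * \<rho> * sin (\<rho> * x))) \<le> 2 * Q * A * exp (\<bar>Im \<rho>\<bar> * x)"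
    and "cmod (u x - (u 0 * cos (\<rho> * x) + v 0 / \<rho> * sin (\<rho> * x) +
       integral {0..x} (\<lambda>t. q t * (sin (\<rho> * (x - t)) * (u 0 * cos (\<rho> * t) + v 0 / \<rho> * sin (\<rho> * t)))) / \<rho>))
       \<le> 2 * Q\<^sup>2 * A * exp (\<bar>Im \<rho>\<bar> * x) / (cmod \<rho>)\<^sup>2"
    and "cmod (v x - (v 0 * cos (\<rho> * x) - u 0 * \<rho> * sin (\<rho> * x) +
       integral {0..x} (\<lambda>t. q t * (cos (\<rho> * (x - t)) * (u 0 * cos (\<rho> * t) + v 0 / \<rho> * sin (\<rho> * t))))))
       \<le> 2 * Q\<^sup>2 * A * exp (\<bar>Im \<rho>\<bar> * x) / cmod \<rho>"
proof -
  note cu = ivp_continuous(1)[OF i] and vc = ivp_variation_of_constants[OF q i \<rho>(1)]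
  let ?Y = "\<bar>Im \<rho>\<bar>" and ?p = "\<lambda>x. u 0 * cos (\<rho> * x) + v 0 / \<rho> * sin (\<rho> * complex_of_real x)"
  have Q0: "Q \<ge> 0" unfolding Q using absolutely_integrable_norm_integrable(2)[OF q, of 1] by (intro integral_nonneg) auto
  have A0: "A \<ge> 0" by (simp add: A)
  have r0: "cmod \<rho> > 0" using \<rho> by simp
  have trig: "cmod (sin (\<rho> * of_real s)) \<le> exp (?Y * s)" "cmod (cos (\<rho> * of_real s)) \<le> exp (?Y * s)" if "s \<ge> 0" for s :: real
    using norm_sin_cos_le_exp[of "\<rho> * of_real s"] that by (auto simp: abs_mult)
  have p: "cmod (?p x) \<le> A * exp (?Y * x)" if "x \<in> {0..1}" for x
  proof -
    have "cmod (?p x) \<le> cmod (u 0) * exp (?Y * x) + cmod (v 0 / \<rho>) * exp (?Y * x)"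
      by (rule norm_triangle_le, unfold norm_mult, intro add_mono mult_left_mono trig) (use that in auto)
    then show ?thesis by (simp add: A algebra_simps)
  qed
  have kern: "cmod (integral {0..x} (\<lambda>t. q t * (k (\<rho> * (x - t)) * g t))) \<le> Q * (B * exp (?Y * x))"
    if k: "k = sin \<or> k = cos" and g: "continuous_on {0..1} g" and x: "x \<in> {0..1}"
      and B: "\<And>t. t \<in> {0..1} \<Longrightarrow> cmod (g t) \<le> B * exp (?Y * t)" for k g x B
    unfolding Q
  proof (rule norm_integral_mult_le[OF q _ x])
    show "continuous_on {0..1} (\<lambda>t. k (\<rho> * complex_of_real (x - t)) * g t)"
      using k g by (elim disjE) (auto intro!: continuous_intros)
    fix t assume t: "t \<in> {0..x}"
    have "cmod (k (\<rho> * of_real (x - t))) \<le> exp (?Y * (x - t))" using trig[of "x - t"] t k by auto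
    then have "cmod (k (\<rho> * of_real (x - t)) * g t) \<le> exp (?Y * (x - t)) * (B * exp (?Y * t))"
      unfolding norm_mult using B[of t] t x by (intro mult_mono) auto
    also have "\<dots> = B * exp (?Y * x)"
      by (simp add: algebra_simps flip: exp_add)
    finally show "cmod (k (\<rho> * complex_of_real (x - t)) * g t) \<le> B * exp (?Y * x)" by simp
  qed
  have "\<exists>x0\<in>{0..1}. \<forall>y\<in>{0..1}. cmod (u y) * exp (- ?Y * y) \<le> cmod (u x0) * exp (- ?Y * x0)"
    by (intro continuous_attains_sup continuous_intros cu) auto
  then obtain x0 where x0: "x0 \<in> {0..1}" "\<And>y. y \<in> {0..1} \<Longrightarrow> cmod (u y) * exp (- ?Y * y) \<le> cmod (u x0) * exp (- ?Y * x0)" by blast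
  define m where "m = cmod (u x0) * exp (- ?Y * x0)"
  have m: "cmod (u y) \<le> m * exp (?Y * y)" if "y \<in> {0..1}" for y
  proof -
    have "cmod (u y) * exp (- ?Y * y) * exp (?Y * y) \<le> m * exp (?Y * y)"
      unfolding m_def by (intro mult_right_mono x0 that) auto
    then show ?thesis by (simp add: mult.assoc flip: exp_add)
  qed
  have m0: "m \<ge> 0" by (simp add: m_def)
  have "cmod (u x0) \<le> A * exp (?Y * x0) + Q * (m * exp (?Y * x0)) / cmod \<rho>"
    unfolding vc(1)[OF x0(1)]
    by (rule norm_triangle_le, rule add_mono[OF p[OF x0(1)]])
       (use kern[of sin u x0 m, OF _ cu x0(1) m] r0 in \<open>simp add: norm_divide divide_right_mono\<close>)
  also have "\<dots> \<le> A * exp (?Y * x0) + (m / 2) * exp (?Y * x0)"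
    using \<rho>(2) r0 m0 mult_right_mono[of "2 * Q" "cmod \<rho>" "m * exp (?Y * x0)"] by (simp add: field_simps)
  finally have "cmod (u x0) * exp (- ?Y * x0) \<le> (A + m / 2) * exp (?Y * x0) * exp (- ?Y * x0)"
    by (intro mult_right_mono) (auto simp: algebra_simps)
  then have "m \<le> A + m / 2" unfolding m_def[symmetric] by (simp add: mult.assoc flip: exp_add)
  then have "m \<le> 2 * A" by simp
  then have uA: "cmod (u y) \<le> 2 * A * exp (?Y * y)" if "y \<in> {0..1}" for y
    by (intro order_trans[OF m[OF that]] mult_right_mono \<open>m \<le> 2 * A\<close>) auto
  show "cmod (u x) \<le> 2 * A * exp (?Y * x)" by (rule uA[OF x])
  have up: "cmod (u x - ?p x) \<le> 2 * Q * A * exp (?Y * x) / cmod \<rho>" if x: "x \<in> {0..1}" for x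
  proof -
    have e: "u x - ?p x = integral {0..x} (\<lambda>t. q t * (sin (\<rho> * (x - t)) * u t)) / \<rho>" using vc(1)[OF x] by simp
    show ?thesis
      unfolding e norm_divide using kern[of sin u x "2 * A", OF _ cu x uA] r0
      by (intro divide_right_mono) (auto simp: mult_ac)
  qed
  show "cmod (u x - ?p x) \<le> 2 * Q * A * exp (?Y * x) / cmod \<rho>" by (rule up[OF x])
  show "cmod (v x - (v 0 * cos (\<rho> * x) - u 0 * \<rho> * sin (\<rho> * x))) \<le> 2 * Q * A * exp (?Y * x)"
    using vc(2)[OF x] kern[of cos u x "2 * A", OF _ cu x uA] by (simp add: mult_ac)
  have cp: "continuous_on {0..1} ?p" by (intro continuous_intros)
  have up': "cmod (u t - ?p t) \<le> (2 * Q * A / cmod \<rho>) * exp (?Y * t)" if "t \<in> {0..1}" for t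
    using up[OF that] by simp
  have cd: "continuous_on {0..1} (\<lambda>t. u t - ?p t)" by (intro continuous_intros cu cp)
  have qi: "(\<lambda>t. q t * h t) integrable_on {0..x}" if "continuous_on {0..1} h" for h
    by (intro absolutely_integrable_norm_integrable(1)[OF absolutely_integrable_times_continuous[OF q] x] continuous_intros that)
  have d: "integral {0..x} (\<lambda>t. q t * (k t * u t)) - integral {0..x} (\<lambda>t. q t * (k t * ?p t))
     = integral {0..x} (\<lambda>t. q t * (k t * (u t - ?p t)))" if k: "continuous_on {0..1} k" for k
    unfolding right_diff_distrib
    by (intro integral_diff[symmetric] qi continuous_on_mult k cu cp)
  have dS: "integral {0..x} (\<lambda>t. q t * (sin (\<rho> * (x - t)) * u t)) - integral {0..x} (\<lambda>t. q t * (sin (\<rho> * (x - t)) * ?p t))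
     = integral {0..x} (\<lambda>t. q t * (sin (\<rho> * (x - t)) * (u t - ?p t)))"
    by (rule d) (intro continuous_intros)
  have dC: "integral {0..x} (\<lambda>t. q t * (cos (\<rho> * (x - t)) * u t)) - integral {0..x} (\<lambda>t. q t * (cos (\<rho> * (x - t)) * ?p t))
     = integral {0..x} (\<lambda>t. q t * (cos (\<rho> * (x - t)) * (u t - ?p t)))"
    by (rule d) (intro continuous_intros)
  have "u x - (?p x + integral {0..x} (\<lambda>t. q t * (sin (\<rho> * (x - t)) * ?p t)) / \<rho>)
      = integral {0..x} (\<lambda>t. q t * (sin (\<rho> * (x - t)) * (u t - ?p t))) / \<rho>"
    unfolding dS[symmetric] using vc(1)[OF x] by (simp add: diff_divide_distrib)
  moreover have "cmod (integral {0..x} (\<lambda>t. q t * (sin (\<rho> * (x - t)) * (u t - ?p t)))) / cmod \<rho>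
      \<le> Q * ((2 * Q * A / cmod \<rho>) * exp (?Y * x)) / cmod \<rho>"
    by (intro divide_right_mono kern cd x up') auto
  moreover have "Q * ((2 * Q * A / cmod \<rho>) * exp (?Y * x)) / cmod \<rho> = 2 * Q\<^sup>2 * A * exp (?Y * x) / (cmod \<rho>)\<^sup>2"
    by (simp add: power2_eq_square)
  ultimately show "cmod (u x - (?p x + integral {0..x} (\<lambda>t. q t * (sin (\<rho> * (x - t)) * ?p t)) / \<rho>))
       \<le> 2 * Q\<^sup>2 * A * exp (?Y * x) / (cmod \<rho>)\<^sup>2"
    by (simp only: norm_divide)
  have "v x - (v 0 * cos (\<rho> * x) - u 0 * \<rho> * sin (\<rho> * x) + integral {0..x} (\<lambda>t. q t * (cos (\<rho> * (x - t)) * ?p t)))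
      = integral {0..x} (\<lambda>t. q t * (cos (\<rho> * (x - t)) * (u t - ?p t)))"
    unfolding dC[symmetric] using vc(2)[OF x] by simp
  moreover have "cmod (integral {0..x} (\<lambda>t. q t * (cos (\<rho> * (x - t)) * (u t - ?p t))))
      \<le> Q * ((2 * Q * A / cmod \<rho>) * exp (?Y * x))"
    by (intro kern cd x up') auto
  moreover have "Q * ((2 * Q * A / cmod \<rho>) * exp (?Y * x)) = 2 * Q\<^sup>2 * A * exp (?Y * x) / cmod \<rho>"
    by (simp add: power2_eq_square)
  ultimately show "cmod (v x - (v 0 * cos (\<rho> * x) - u 0 * \<rho> * sin (\<rho> * x) + integral {0..x} (\<lambda>t. q t * (cos (\<rho> * (x - t)) * ?p t))))
       \<le> 2 * Q\<^sup>2 * A * exp (?Y * x) / cmod \<rho>"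
    by (simp only:)
qed

section \<open>The operator and its characteristic function\<close>

lemma L2_continuous:
  assumes "continuous_on {0..1} f"
  shows "L2 f"
  unfolding L2_def using assms
  by (auto intro!: continuous_imp_measurable_on_sets_lebesgue integrable_continuous_interval continuous_intros)

lemma L2_eq_negligible:
  assumes "L2_eq f g"
  obtains N where "negligible N" "\<And>x. x \<in> {0..1} - N \<Longrightarrow> f x = g x"
proof -
  have "AE x in lebesgue. x \<in> {0..1} \<longrightarrow> f x = g x"
    using assms unfolding L2_eq_def by (subst (asm) AE_restrict_space_iff) auto
  then obtain N where "{x. \<not> (x \<in> {0..1} \<longrightarrow> f x = g x)} \<subseteq> N" "N \<in> null_sets lebesgue"
    by (auto simp: eventually_ae_filter)
  then show ?thesis by (intro that[of N]) (auto simp: negligible_iff_null_sets)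
qed

lemma L2_eq_on_interval: "(\<And>x. x \<in> {0..1} \<Longrightarrow> f x = g x) \<Longrightarrow> L2_eq f g"
  unfolding L2_eq_def by (rule AE_I2) auto

lemma ivp_has_vector_derivative:
  assumes "ivp w h u v" "x \<in> {0..1}"
  shows "(u has_vector_derivative v x) (at x within {0..1})"
proof -
  have "((\<lambda>x. u 0 + integral {0..x} v) has_vector_derivative (0 + v x)) (at x within {0..1})"
    by (intro derivative_intros integral_has_vector_derivative ivp_continuous(2)[OF assms(1)] assms(2))
  then have "((\<lambda>x. u 0 + integral {0..x} v) has_vector_derivative v x) (at x within {0..1})" by simp
  then show ?thesis
  proof (rule has_vector_derivative_transform[OF assms(2), rotated])
    fix y :: real assume "y \<in> {0..1}"
    then show "u y = u 0 + integral {0..y} v"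
      using integral_unique[of v "u y - u 0" "{0..y}"] assms(1) by (simp add: ivp_def)
  qed
qed

text \<open>The almost everywhere identities in the definition of the operator become the integrated system, in which
  exceptional null sets have disappeared.\<close>

lemma T3_iff_ivp:
  assumes q: "q absolutely_integrable_on {0..1}" and g: "continuous_on {0..1} g"
  shows "T3 q \<alpha> y (\<lambda>x. \<mu> * y x + g x) \<longleftrightarrow>
    (\<forall>x. x \<notin> {0..1} \<longrightarrow> y x = 0) \<and>
    (\<exists>v. ivp (\<lambda>t. q t - \<mu>) (\<lambda>t. - g t) y v \<and> v 0 - v 1 = 0 \<and> y 0 + \<alpha> * y 1 = 0)"
    (is "?L \<longleftrightarrow> ?R")
proof
  assume ?L
  then obtain y1 y2 where z: "\<forall>x. x \<notin> {0..1} \<longrightarrow> y x = 0"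
    and d: "\<And>x. x \<in> {0..1} \<Longrightarrow> (y has_vector_derivative y1 x) (at x within {0..1})"
    and y2: "\<And>x. x \<in> {0..1} \<Longrightarrow> (y2 has_integral (y1 x - y1 0)) {0..x}"
    and eq: "L2_eq (\<lambda>x. \<mu> * y x + g x) (\<lambda>x. - y2 x + q x * y x)"
    and bc: "y1 0 - y1 1 = 0" "y 0 + \<alpha> * y 1 = 0"
    unfolding T3_def by blast
  obtain N where N: "negligible N" "\<And>x. x \<in> {0..1} - N \<Longrightarrow> \<mu> * y x + g x = - y2 x + q x * y x"
    using L2_eq_negligible[OF eq] by blast
  have "ivp (\<lambda>t. q t - \<mu>) (\<lambda>t. - g t) y y1"
    unfolding ivp_def
  proof (intro ballI conjI)
    fix x :: real assume x: "x \<in> {0..1}"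
    show "(y1 has_integral (y x - y 0)) {0..x}"
      using x by (intro fundamental_theorem_of_calculus has_vector_derivative_within_subset[OF d]) auto
    show "((\<lambda>t. (q t - \<mu>) * y t + - g t) has_integral (y1 x - y1 0)) {0..x}"
    proof (rule has_integral_spike[OF N(1) _ y2[OF x]])
      fix t assume "t \<in> {0..x} - N"
      then have "\<mu> * y t + g t = - y2 t + q t * y t" using x by (intro N(2)) auto
      then show "(q t - \<mu>) * y t + - g t = y2 t" by (simp add: algebra_simps add_eq_0_iff)
    qed
  qed
  then show ?R using z bc by blast
next
  assume ?R
  then obtain v where z: "\<forall>x. x \<notin> {0..1} \<longrightarrow> y x = 0" and i: "ivp (\<lambda>t. q t - \<mu>) (\<lambda>t. - g t) y v"
    and bc: "v 0 - v 1 = 0" "y 0 + \<alpha> * y 1 = 0" by blast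
  note cy = ivp_continuous(1)[OF i]
  have w: "(\<lambda>t. q t - \<mu>) absolutely_integrable_on {0..1}"
    using q by (intro set_integral_diff) (auto intro: absolutely_integrable_continuous_real)
  have "(\<lambda>t. (q t - \<mu>) * y t + - g t) absolutely_integrable_on {0..1}"
    by (intro set_integral_add absolutely_integrable_times_continuous[OF w] absolutely_integrable_continuous_real
        continuous_intros cy g)
  moreover have "L2 (\<lambda>x. \<mu> * y x + g x)" by (intro L2_continuous continuous_intros cy g)
  moreover have "L2_eq (\<lambda>x. \<mu> * y x + g x) (\<lambda>x. - ((q x - \<mu>) * y x + - g x) + q x * y x)"
    by (rule L2_eq_on_interval) (simp add: algebra_simps)
  ultimately show ?L
    unfolding T3_def using z bc i ivp_has_vector_derivative[OF i]
    by (intro conjI exI[of _ v] exI[of _ "\<lambda>t. (q t - \<mu>) * y t + - g t"]) (auto simp: ivp_def)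
qed

definition fund :: "(real \<Rightarrow> complex) \<Rightarrow> complex \<Rightarrow> complex \<Rightarrow> complex \<Rightarrow> (real \<Rightarrow> complex) \<times> (real \<Rightarrow> complex)" where
  "fund q \<mu> a b = (SOME p. ivp (\<lambda>t. q t - \<mu>) (\<lambda>_. 0) (fst p) (snd p) \<and> fst p 0 = a \<and> snd p 0 = b)"

text \<open>A linear form in the four boundary values \<open>u 0\<close>, \<open>u 1\<close>, \<open>v 0\<close>, \<open>v 1\<close>. The two boundary conditions are treated
  as values of one type because their roles are exchanged in one case of the multiplicity argument.\<close>

definition boundary_form :: "complex \<times> complex \<times> complex \<times> complex \<Rightarrow> (real \<Rightarrow> complex) \<times> (real \<Rightarrow> complex) \<Rightarrow> complex" where
  "boundary_form = (\<lambda>(c0, c1, d0, d1) (u, v). c0 * u 0 + c1 * u 1 + d0 * v 0 + d1 * v 1)"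

text \<open>The zeros of this function are the eigenvalues: it is the determinant of the two boundary conditions on the
  solutions with initial data \<open>(1, 0)\<close> and \<open>(0, 1)\<close>, simplified by the Wronskian identity.\<close>

definition charfun :: "(real \<Rightarrow> complex) \<Rightarrow> complex \<Rightarrow> complex \<Rightarrow> complex" where
  "charfun q \<alpha> \<mu> = snd (fund q \<mu> 0 1) 1 - \<alpha> * fst (fund q \<mu> 1 0) 1 - (1 - \<alpha>)"

lemma absolutely_integrable_minus_const:
  fixes q :: "real \<Rightarrow> complex"
  shows "q absolutely_integrable_on {0..1} \<Longrightarrow> (\<lambda>t. q t - \<mu>) absolutely_integrable_on {0..1}"
  by (intro set_integral_diff) (auto intro: absolutely_integrable_continuous_real)

context
  fixes q :: "real \<Rightarrow> complex"
  assumes q: "q absolutely_integrable_on {0..1}"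
begin

lemma fund:
  "ivp (\<lambda>t. q t - \<mu>) (\<lambda>_. 0) (fst (fund q \<mu> a b)) (snd (fund q \<mu> a b))"
  "fst (fund q \<mu> a b) 0 = a" "snd (fund q \<mu> a b) 0 = b"
proof -
  obtain u v where "ivp (\<lambda>t. q t - \<mu>) (\<lambda>_. 0) u v" "u 0 = a" "v 0 = b"
    by (rule ivp_exists[OF absolutely_integrable_minus_const[OF q] continuous_on_const])
  then have "\<exists>p. ivp (\<lambda>t. q t - \<mu>) (\<lambda>_. 0) (fst p) (snd p) \<and> fst p 0 = a \<and> snd p 0 = b"
    by (intro exI[of _ "(u, v)"]) auto
  from someI_ex[OF this] show "ivp (\<lambda>t. q t - \<mu>) (\<lambda>_. 0) (fst (fund q \<mu> a b)) (snd (fund q \<mu> a b))"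
    "fst (fund q \<mu> a b) 0 = a" "snd (fund q \<mu> a b) 0 = b" by (auto simp: fund_def)
qed

lemma ivp_eq_fundamental:
  assumes "ivp (\<lambda>t. q t - \<mu>) (\<lambda>_. 0) u v" "x \<in> {0..1}"
  shows "u x = u 0 * fst (fund q \<mu> 1 0) x + v 0 * fst (fund q \<mu> 0 1) x"
    and "v x = u 0 * snd (fund q \<mu> 1 0) x + v 0 * snd (fund q \<mu> 0 1) x"
proof -
  have "ivp (\<lambda>t. q t - \<mu>) (\<lambda>t. u 0 * 0 + v 0 * 0)
     (\<lambda>x. u 0 * fst (fund q \<mu> 1 0) x + v 0 * fst (fund q \<mu> 0 1) x)
     (\<lambda>x. u 0 * snd (fund q \<mu> 1 0) x + v 0 * snd (fund q \<mu> 0 1) x)"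
    by (rule ivp_linear[OF fund(1) fund(1)])
  then have "ivp (\<lambda>t. q t - \<mu>) (\<lambda>_. 0)
     (\<lambda>x. u 0 * fst (fund q \<mu> 1 0) x + v 0 * fst (fund q \<mu> 0 1) x)
     (\<lambda>x. u 0 * snd (fund q \<mu> 1 0) x + v 0 * snd (fund q \<mu> 0 1) x)" by simp
  from ivp_unique[OF absolutely_integrable_minus_const[OF q] assms(1) this _ _ assms(2)]
  show "u x = u 0 * fst (fund q \<mu> 1 0) x + v 0 * fst (fund q \<mu> 0 1) x"
    "v x = u 0 * snd (fund q \<mu> 1 0) x + v 0 * snd (fund q \<mu> 0 1) x" by (auto simp: fund)
qed

lemma boundary_form_eq_fundamental:
  assumes "ivp (\<lambda>t. q t - \<mu>) (\<lambda>_. 0) u v"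
  shows "boundary_form V (u, v) = u 0 * boundary_form V (fund q \<mu> 1 0) + v 0 * boundary_form V (fund q \<mu> 0 1)"
proof -
  obtain c0 c1 d0 d1 where V: "V = (c0, c1, d0, d1)" by (cases V) auto
  show ?thesis
    unfolding V boundary_form_def
    using ivp_eq_fundamental[OF assms, of 1]
    by (simp add: split_beta fund algebra_simps)
qed

text \<open>Integrate both \<open>c s''\<close> and \<open>s c''\<close> by parts; the integrands agree since \<open>c\<close> and \<open>s\<close> solve the same equation.\<close>

lemma wronskian:
  "fst (fund q \<mu> 1 0) 1 * snd (fund q \<mu> 0 1) 1 - snd (fund q \<mu> 1 0) 1 * fst (fund q \<mu> 0 1) 1 = 1"
proof -
  note w = absolutely_integrable_minus_const[OF q, of \<mu>]
  let ?c = "fst (fund q \<mu> 1 0)" and ?c' = "snd (fund q \<mu> 1 0)" and ?s = "fst (fund q \<mu> 0 1)" and ?s' = "snd (fund q \<mu> 0 1)"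
  note ic = fund(1)[of \<mu> 1 0] and si = fund(1)[of \<mu> 0 1]
  have 1: "integral {0..1} (\<lambda>t. ((q t - \<mu>) * ?s t) * ?c t) = ?c 1 * ?s' 1 - ?c 0 * ?s' 0 - integral {0..1} (\<lambda>t. ?c' t * ?s' t)"
  proof (rule integral_by_parts_primitive[where f = "\<lambda>t. (q t - \<mu>) * ?s t" and U = ?c and U' = ?c' and v = ?s' and x = 1])
    show "(\<lambda>t. (q t - \<mu>) * ?s t) absolutely_integrable_on {0..1}"
      by (rule absolutely_integrable_times_continuous[OF w ivp_continuous(1)[OF si]])
    show "((\<lambda>t. (q t - \<mu>) * ?s t) has_integral (?s' x - ?s' 0)) {0..x}" if "x \<in> {0..1}" for x
      using si that by (simp add: ivp_def)
  qed (auto intro: ivp_has_vector_derivative[OF ic] ivp_continuous(2)[OF ic])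
  have 2: "integral {0..1} (\<lambda>t. ((q t - \<mu>) * ?c t) * ?s t) = ?s 1 * ?c' 1 - ?s 0 * ?c' 0 - integral {0..1} (\<lambda>t. ?s' t * ?c' t)"
  proof (rule integral_by_parts_primitive[where f = "\<lambda>t. (q t - \<mu>) * ?c t" and U = ?s and U' = ?s' and v = ?c' and x = 1])
    show "(\<lambda>t. (q t - \<mu>) * ?c t) absolutely_integrable_on {0..1}"
      by (rule absolutely_integrable_times_continuous[OF w ivp_continuous(1)[OF ic]])
    show "((\<lambda>t. (q t - \<mu>) * ?c t) has_integral (?c' x - ?c' 0)) {0..x}" if "x \<in> {0..1}" for x
      using ic that by (simp add: ivp_def)
  qed (auto intro: ivp_has_vector_derivative[OF si] ivp_continuous(2)[OF si])
  have 3: "integral {0..1} (\<lambda>t. ((q t - \<mu>) * ?s t) * ?c t) = integral {0..1} (\<lambda>t. ((q t - \<mu>) * ?c t) * ?s t)"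
    and 4: "integral {0..1} (\<lambda>t. ?c' t * ?s' t) = integral {0..1} (\<lambda>t. ?s' t * ?c' t)"
    by (simp_all add: mult_ac)
  have "?c 1 * ?s' 1 - ?c 0 * ?s' 0 = ?s 1 * ?c' 1 - ?s 0 * ?c' 0"
    using trans[OF 1[symmetric] trans[OF 3 2]] unfolding 4 by simp
  then show ?thesis by (simp add: fund algebra_simps)
qed

text \<open>The boundary values of the solution that a chain sums up to are power series in \<open>z\<close> whose coefficients are the
  boundary values of the chain. Since the initial data \<open>a z\<close>, \<open>b z\<close> may depend on \<open>z\<close>, one can follow a solution that
  satisfies one of the boundary conditions for all parameters.\<close>

lemma ivp_chain_fps:
  assumes ch: "ivp_chain (\<lambda>t. q t - \<mu>) u v"
    and AL: "\<And>k. cmod (u k 0) \<le> A * L ^ k" "\<And>k. cmod (v k 0) \<le> A * L ^ k" "L \<ge> 0"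
  shows "\<exists>C M a b. C \<ge> 0 \<and> M \<ge> 1 \<and> (\<forall>k. \<forall>x\<in>{0..1}. cmod (u k x) \<le> C * M ^ k \<and> cmod (v k x) \<le> C * M ^ k) \<and>
    a has_fps_expansion Abs_fps (\<lambda>k. u k 0) \<and> b has_fps_expansion Abs_fps (\<lambda>k. v k 0) \<and>
    (\<forall>V. (\<lambda>z. a z * boundary_form V (fund q (\<mu> + z) 1 0) + b z * boundary_form V (fund q (\<mu> + z) 0 1))
       has_fps_expansion Abs_fps (\<lambda>k. boundary_form V (u k, v k))) \<and>
    (\<forall>z a' b'. cmod z < 1 / M \<longrightarrow> (\<lambda>k. u k 0 * z ^ k) sums a' \<longrightarrow> (\<lambda>k. v k 0 * z ^ k) sums b' \<longrightarrow> a z = a' \<and> b z = b')"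
proof -
  note w = absolutely_integrable_minus_const[OF q, of \<mu>]
  obtain C M where CM: "C \<ge> 0" "M \<ge> 1"
    "\<forall>k. \<forall>x\<in>{0..1}. cmod (u k x) \<le> C * M ^ k \<and> cmod (v k x) \<le> C * M ^ k"
    using ivp_chain_bound[OF w ch AL] by blast
  define U where "U = (\<lambda>z x. \<Sum>k. z ^ k * u k x)"
  define W where "W = (\<lambda>z x. \<Sum>k. z ^ k * v k x)"
  note s = ivp_chain_sums[OF w ch CM(2,3)]
  have ev: "eventually (\<lambda>z. cmod z < 1 / M) (nhds 0)"
    using CM(2) by (intro order_tendstoD(2)[of cmod 0]) (auto intro!: tendsto_eq_intros filterlim_ident)
  have Us: "(\<lambda>k. u k x * z ^ k) sums U z x" and Ws: "(\<lambda>k. v k x * z ^ k) sums W z x"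
    if "cmod z < 1 / M" "x \<in> {0..1}" for z x
    using s(1,2)[OF that(1) that(2)] unfolding U_def W_def by (auto simp: mult.commute dest: summable_sums)
  have i: "ivp (\<lambda>t. q t - (\<mu> + z)) (\<lambda>_. 0) (U z) (W z)" if "cmod z < 1 / M" for z
    using s(3)[OF that] unfolding U_def W_def by (simp add: diff_diff_eq)
  show ?thesis
  proof (rule exI[of _ C], rule exI[of _ M], rule exI[of _ "\<lambda>z. U z 0"], rule exI[of _ "\<lambda>z. W z 0"], intro conjI)
    show "C \<ge> 0" "M \<ge> 1" "\<forall>k. \<forall>x\<in>{0..1}. cmod (u k x) \<le> C * M ^ k \<and> cmod (v k x) \<le> C * M ^ k"
      by (fact CM)+
    show "(\<lambda>z. U z 0) has_fps_expansion Abs_fps (\<lambda>k. u k 0)"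
      by (rule has_fps_expansionI, rule eventually_mono[OF ev]) (simp add: Us)
    show "(\<lambda>z. W z 0) has_fps_expansion Abs_fps (\<lambda>k. v k 0)"
      by (rule has_fps_expansionI, rule eventually_mono[OF ev]) (simp add: Ws)
    show "\<forall>z a' b'. cmod z < 1 / M \<longrightarrow> (\<lambda>k. u k 0 * z ^ k) sums a' \<longrightarrow> (\<lambda>k. v k 0 * z ^ k) sums b' \<longrightarrow> U z 0 = a' \<and> W z 0 = b'"
      using sums_unique2[OF Us] sums_unique2[OF Ws] by simp
    show "\<forall>V. (\<lambda>z. U z 0 * boundary_form V (fund q (\<mu> + z) 1 0) + W z 0 * boundary_form V (fund q (\<mu> + z) 0 1))
       has_fps_expansion Abs_fps (\<lambda>k. boundary_form V (u k, v k))"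
    proof
    fix V :: "complex \<times> complex \<times> complex \<times> complex"
    obtain c0 c1 d0 d1 where V: "V = (c0, c1, d0, d1)" by (cases V) auto
    show "(\<lambda>z. U z 0 * boundary_form V (fund q (\<mu> + z) 1 0) + W z 0 * boundary_form V (fund q (\<mu> + z) 0 1))
       has_fps_expansion Abs_fps (\<lambda>k. boundary_form V (u k, v k))"
    proof (rule has_fps_expansionI, rule eventually_mono[OF ev])
      fix z assume z: "cmod z < 1 / M"
      have "(\<lambda>k. c0 * (u k 0 * z ^ k) + c1 * (u k 1 * z ^ k) + d0 * (v k 0 * z ^ k) + d1 * (v k 1 * z ^ k))
          sums boundary_form V (U z, W z)"
        unfolding V boundary_form_def by (simp, intro sums_add sums_mult Us Ws z) auto
      then show "(\<lambda>k. fps_nth (Abs_fps (\<lambda>k. boundary_form V (u k, v k))) k * z ^ k) sums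
          (U z 0 * boundary_form V (fund q (\<mu> + z) 1 0) + W z 0 * boundary_form V (fund q (\<mu> + z) 0 1))"
        unfolding boundary_form_eq_fundamental[OF i[OF z]] by (simp add: V boundary_form_def algebra_simps)
    qed
    qed
  qed
qed

text \<open>The boundary values of the fundamental solutions are analytic in the spectral parameter. The geometric bounds on their
  Taylor coefficients allow these to serve as the initial data of a further chain.\<close>

lemma fundamental_fps:
  "\<exists>c c' s s' M. ivp_chain (\<lambda>t. q t - \<mu>) c c' \<and> ivp_chain (\<lambda>t. q t - \<mu>) s s' \<and>
    (\<forall>V. boundary_form V (c 0, c' 0) = boundary_form V (fund q \<mu> 1 0)) \<and> (\<forall>V. boundary_form V (s 0, s' 0) = boundary_form V (fund q \<mu> 0 1)) \<and>
    (\<forall>V. (\<lambda>z. boundary_form V (fund q (\<mu> + z) 1 0)) has_fps_expansion Abs_fps (\<lambda>k. boundary_form V (c k, c' k))) \<and>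
    (\<forall>V. (\<lambda>z. boundary_form V (fund q (\<mu> + z) 0 1)) has_fps_expansion Abs_fps (\<lambda>k. boundary_form V (s k, s' k))) \<and>
    M \<ge> (1::real) \<and> (\<forall>V. \<exists>B. \<forall>k. cmod (boundary_form V (c k, c' k)) \<le> B * M ^ k \<and> cmod (boundary_form V (s k, s' k)) \<le> B * M ^ k)"
proof -
  note w = absolutely_integrable_minus_const[OF q, of \<mu>]
  obtain c c' where c: "ivp_chain (\<lambda>t. q t - \<mu>) c c'" "\<And>k. c k 0 = (if k = 0 then 1 else 0)" "\<And>k. c' k 0 = 0"
    by (rule exE[OF ivp_chain_exists[OF w, of "\<lambda>k. if k = 0 then 1 else 0" "\<lambda>_. 0"]]) auto
  obtain s s' where s: "ivp_chain (\<lambda>t. q t - \<mu>) s s'" "\<And>k. s k 0 = 0" "\<And>k. s' k 0 = (if k = 0 then 1 else 0)"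
    by (rule exE[OF ivp_chain_exists[OF w, of "\<lambda>_. 0" "\<lambda>k. if k = 0 then 1 else 0"]]) auto
  have "cmod (c k 0) \<le> 1 * 1 ^ k" "cmod (c' k 0) \<le> 1 * 1 ^ k" for k by (auto simp: c)
  from ivp_chain_fps[OF c(1) this zero_le_one] obtain C1 M1 a1 b1 where
    1: "C1 \<ge> 0" "M1 \<ge> 1" "\<forall>k. \<forall>x\<in>{0..1}. cmod (c k x) \<le> C1 * M1 ^ k \<and> cmod (c' k x) \<le> C1 * M1 ^ k"
    and F1': "\<forall>V. (\<lambda>z. a1 z * boundary_form V (fund q (\<mu> + z) 1 0) + b1 z * boundary_form V (fund q (\<mu> + z) 0 1))
       has_fps_expansion Abs_fps (\<lambda>k. boundary_form V (c k, c' k))"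
    and U1': "\<forall>z a' b'. cmod z < 1 / M1 \<longrightarrow> (\<lambda>k. c k 0 * z ^ k) sums a' \<longrightarrow> (\<lambda>k. c' k 0 * z ^ k) sums b' \<longrightarrow> a1 z = a' \<and> b1 z = b'"
    by (elim exE conjE) (rule that)
  note f1 = F1'[rule_format] and u1 = U1'[rule_format]
  have "cmod (s k 0) \<le> 1 * 1 ^ k" "cmod (s' k 0) \<le> 1 * 1 ^ k" for k by (auto simp: s)
  from ivp_chain_fps[OF s(1) this zero_le_one] obtain C2 M2 a2 b2 where
    2: "C2 \<ge> 0" "M2 \<ge> 1" "\<forall>k. \<forall>x\<in>{0..1}. cmod (s k x) \<le> C2 * M2 ^ k \<and> cmod (s' k x) \<le> C2 * M2 ^ k"
    and F2': "\<forall>V. (\<lambda>z. a2 z * boundary_form V (fund q (\<mu> + z) 1 0) + b2 z * boundary_form V (fund q (\<mu> + z) 0 1))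
       has_fps_expansion Abs_fps (\<lambda>k. boundary_form V (s k, s' k))"
    and U2': "\<forall>z a' b'. cmod z < 1 / M2 \<longrightarrow> (\<lambda>k. s k 0 * z ^ k) sums a' \<longrightarrow> (\<lambda>k. s' k 0 * z ^ k) sums b' \<longrightarrow> a2 z = a' \<and> b2 z = b'"
    by (elim exE conjE) (rule that)
  note f2 = F2'[rule_format] and u2 = U2'[rule_format]
  have delta: "(\<lambda>k. (if k = 0 then 1 else 0) * z ^ k) sums 1" for z :: complex
    using powser_sums_zero_iff[of "\<lambda>k. if k = 0 then 1 else 0"] sums_If_finite_set[of "{0}" "\<lambda>k. z ^ k"]
    by (simp add: if_distrib[of "\<lambda>x. x * _"] cong: if_cong)
  have ab1: "a1 z = 1 \<and> b1 z = 0" if "cmod z < 1 / M1" for z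
    by (rule u1[OF that]) (use delta in \<open>auto simp: c\<close>)
  have ab2: "a2 z = 0 \<and> b2 z = 1" if "cmod z < 1 / M2" for z
    by (rule u2[OF that]) (use delta in \<open>auto simp: s\<close>)
  have ev: "eventually (\<lambda>z. cmod z < 1 / M) (nhds 0)" if "M \<ge> 1" for M
    using that by (intro order_tendstoD(2)[of cmod 0]) (auto intro!: tendsto_eq_intros filterlim_ident)
  have F1: "(\<lambda>z. boundary_form V (fund q (\<mu> + z) 1 0)) has_fps_expansion Abs_fps (\<lambda>k. boundary_form V (c k, c' k))" for V
  proof (rule iffD1[OF has_fps_expansion_cong[OF _ refl] f1])
    show "eventually (\<lambda>z. a1 z * boundary_form V (fund q (\<mu> + z) 1 0) + b1 z * boundary_form V (fund q (\<mu> + z) 0 1) = boundary_form V (fund q (\<mu> + z) 1 0)) (nhds 0)"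
      by (rule eventually_mono[OF ev[OF 1(2)]]) (simp add: ab1)
  qed
  have F2: "(\<lambda>z. boundary_form V (fund q (\<mu> + z) 0 1)) has_fps_expansion Abs_fps (\<lambda>k. boundary_form V (s k, s' k))" for V
  proof (rule iffD1[OF has_fps_expansion_cong[OF _ refl] f2])
    show "eventually (\<lambda>z. a2 z * boundary_form V (fund q (\<mu> + z) 1 0) + b2 z * boundary_form V (fund q (\<mu> + z) 0 1) = boundary_form V (fund q (\<mu> + z) 0 1)) (nhds 0)"
      by (rule eventually_mono[OF ev[OF 2(2)]]) (simp add: ab2)
  qed
  define M where "M = max M1 M2"
  have M: "M \<ge> 1" "M1 ^ k \<le> M ^ k" "M2 ^ k \<le> M ^ k" for k
    using 1(2) 2(2) by (auto simp: M_def intro!: power_mono)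
  have B: "\<exists>B. \<forall>k. cmod (boundary_form V (c k, c' k)) \<le> B * M ^ k \<and> cmod (boundary_form V (s k, s' k)) \<le> B * M ^ k" for V
  proof -
    obtain c0 c1 d0 d1 where V: "V = (c0, c1, d0, d1)" by (cases V) auto
    have *: "cmod (boundary_form V (u, v)) \<le> (cmod c0 + cmod c1 + cmod d0 + cmod d1) * D"
      if "\<And>x. x \<in> {0..1} \<Longrightarrow> cmod (u x) \<le> D" "\<And>x. x \<in> {0..1} \<Longrightarrow> cmod (v x) \<le> D" for u v D
    proof -
      have "cmod (boundary_form V (u, v)) \<le> cmod (c0 * u 0) + cmod (c1 * u 1) + cmod (d0 * v 0) + cmod (d1 * v 1)"
        unfolding V boundary_form_def by simp (intro norm_triangle_le add_mono order_refl)
      also have "\<dots> \<le> cmod c0 * D + cmod c1 * D + cmod d0 * D + cmod d1 * D"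
        unfolding norm_mult by (intro add_mono mult_left_mono that) auto
      finally show ?thesis by (simp add: algebra_simps)
    qed
    define S where "S = cmod c0 + cmod c1 + cmod d0 + cmod d1"
    have S: "S \<ge> 0" by (simp add: S_def)
    have le: "C1 * M1 ^ k \<le> (C1 + C2) * M ^ k" "C2 * M2 ^ k \<le> (C1 + C2) * M ^ k" for k
      using 1(1,2) 2(1,2) M by (auto intro!: mult_mono)
    have "cmod (boundary_form V (c k, c' k)) \<le> S * ((C1 + C2) * M ^ k) \<and> cmod (boundary_form V (s k, s' k)) \<le> S * ((C1 + C2) * M ^ k)" for k
      using *[of "c k" "C1 * M1 ^ k" "c' k"] *[of "s k" "C2 * M2 ^ k" "s' k"] 1(3) 2(3)
        mult_left_mono[OF le(1) S, of k] mult_left_mono[OF le(2) S, of k] unfolding S_def[symmetric] by force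
    then show ?thesis by (intro exI[of _ "S * (C1 + C2)"]) (simp add: mult.assoc)
  qed
  have z: "boundary_form V (c 0, c' 0) = boundary_form V (fund q \<mu> 1 0)" "boundary_form V (s 0, s' 0) = boundary_form V (fund q \<mu> 0 1)" for V
    using boundary_form_eq_fundamental[of \<mu> "c 0" "c' 0" V] boundary_form_eq_fundamental[of \<mu> "s 0" "s' 0" V] c s by (auto simp: ivp_chain_def)
  show ?thesis
    by (rule exI[of _ c], rule exI[of _ c'], rule exI[of _ s], rule exI[of _ s'], rule exI[of _ M])
       (intro conjI allI c(1) s(1) z F1 F2 M(1) B)
qed

lemma charfun_determinant:
  "charfun q \<alpha> \<mu> = boundary_form (1, \<alpha>, 0, 0) (fund q \<mu> 0 1) * boundary_form (0, 0, 1, -1) (fund q \<mu> 1 0)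
     - boundary_form (1, \<alpha>, 0, 0) (fund q \<mu> 1 0) * boundary_form (0, 0, 1, -1) (fund q \<mu> 0 1)"
proof -
  have "snd (fund q \<mu> 1 0) 1 * fst (fund q \<mu> 0 1) 1 = fst (fund q \<mu> 1 0) 1 * snd (fund q \<mu> 0 1) 1 - 1"
    using wronskian[of \<mu>] by (simp add: algebra_simps)
  then have "\<alpha> * (snd (fund q \<mu> 1 0) 1 * fst (fund q \<mu> 0 1) 1) = \<alpha> * (fst (fund q \<mu> 1 0) 1 * snd (fund q \<mu> 0 1) 1 - 1)" by simp
  then show ?thesis
    by (simp add: charfun_def boundary_form_def split_beta fund algebra_simps)
qed

lemma charfun_analytic: "charfun q \<alpha> analytic_on {\<mu>}"
proof -
  have "(\<lambda>z. boundary_form V (fund q (\<mu> + z) 1 0)) analytic_on {0}" "(\<lambda>z. boundary_form V (fund q (\<mu> + z) 0 1)) analytic_on {0}" for V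
    using fundamental_fps[of \<mu>] has_fps_expansion_imp_analytic_0 by blast+
  then have "(\<lambda>z. charfun q \<alpha> (\<mu> + z)) analytic_on {0}"
    unfolding charfun_determinant by (intro analytic_intros) auto
  then have "(\<lambda>z. charfun q \<alpha> (\<mu> + z)) \<circ> (\<lambda>w. w - \<mu>) analytic_on {\<mu>}"
    by (intro analytic_on_compose) (auto intro!: analytic_intros)
  then show ?thesis by (simp add: o_def)
qed

lemma charfun_holomorphic: "charfun q \<alpha> holomorphic_on A"
  using charfun_analytic by (intro analytic_imp_holomorphic) (auto simp: analytic_on_def)

end

section \<open>Algebraic multiplicity as order of a zero\<close>

lemma continuous_zero_if_integrals_zero:
  fixes f :: "real \<Rightarrow> complex"
  assumes f: "continuous_on {0..1} f" and z: "\<And>x. x \<in> {0..1} \<Longrightarrow> (f has_integral 0) {0..x}" and x: "x \<in> {0..1}"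
  shows "f x = 0"
proof -
  have "((\<lambda>x. integral {0..x} f) has_vector_derivative f x) (at x within {0..1})"
    by (rule integral_has_vector_derivative[OF f x])
  moreover have "((\<lambda>x. integral {0..x} f) has_vector_derivative 0) (at x within {0..1})"
    by (rule has_vector_derivative_transform[OF x _ has_vector_derivative_const[of 0]]) (use z in \<open>auto intro: integral_unique\<close>)
  ultimately show ?thesis
    using vector_derivative_unique_within_closed_interval[of 0 1 x] x by simp
qed

lemma sum_fun_apply: "(\<Sum>i\<in>I. f i) x = (\<Sum>i\<in>I. f i x)"
  by (induction I rule: infinite_finite_induct) auto

lemma boundary_form_sum: "boundary_form V (\<lambda>x. \<Sum>i\<in>I. t i * u i x, \<lambda>x. \<Sum>i\<in>I. t i * v i x) = (\<Sum>i\<in>I. t i * boundary_form V (u i, v i))"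
  by (cases V) (simp add: boundary_form_def sum_distrib_left sum.distrib algebra_simps)

lemma boundary_form_diff: "boundary_form V (\<lambda>x. u x - p x, \<lambda>x. v x - r x) = boundary_form V (u, v) - boundary_form V (p, r)"
  by (cases V) (simp add: boundary_form_def algebra_simps)

lemma boundary_form_cong: "(\<And>x. x \<in> {0..1} \<Longrightarrow> u x = p x) \<Longrightarrow> (\<And>x. x \<in> {0..1} \<Longrightarrow> v x = r x) \<Longrightarrow> boundary_form V (u, v) = boundary_form V (p, r)"
  by (cases V) (simp add: boundary_form_def)

definition unit_restrict :: "(real \<Rightarrow> complex) \<Rightarrow> real \<Rightarrow> complex" where
  "unit_restrict f x = (if x \<in> {0..1} then f x else 0)"

definition chain_comb :: "(nat \<Rightarrow> real \<Rightarrow> complex) \<Rightarrow> nat \<Rightarrow> (nat \<Rightarrow> complex) \<Rightarrow> real \<Rightarrow> complex" where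
  "chain_comb y n t = (\<lambda>x. \<Sum>i<n. t i * unit_restrict (y i) x)"

text \<open>The operator minus \<open>\<mu>\<close> shifts the coefficients of a combination of chain elements by one place.\<close>

lemma chain_comb_ivp:
  assumes ch: "ivp_chain w y y'"
  shows "ivp w (\<lambda>x. - chain_comb y n (\<lambda>i. t (Suc i)) x) (chain_comb y (Suc n) t) (\<lambda>x. \<Sum>i<Suc n. t i * y' i x)"
proof -
  let ?h = "\<lambda>i x. case i of 0 \<Rightarrow> 0 | Suc j \<Rightarrow> - y j x"
  have "ivp w (\<lambda>x. \<Sum>i<Suc n. t i * ?h i x) (\<lambda>x. \<Sum>i<Suc n. t i * y i x) (\<lambda>x. \<Sum>i<Suc n. t i * y' i x)"
  proof (rule ivp_sum)
    show "ivp w (?h i) (y i) (y' i)" for i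
      using ch by (cases i) (auto simp: ivp_chain_def)
  qed simp
  then show ?thesis
  proof (rule ivp_cong)
    fix x :: real assume x: "x \<in> {0..1}"
    show "chain_comb y (Suc n) t x = (\<Sum>i<Suc n. t i * y i x)" using x by (simp add: chain_comb_def unit_restrict_def)
    have "(\<Sum>i<Suc n. t i * ?h i x) = (\<Sum>i<n. t (Suc i) * - y i x)"
      by (subst sum.lessThan_Suc_shift) simp
    then show "w x * (\<Sum>i<Suc n. t i * y i x) + (\<Sum>i<Suc n. t i * ?h i x) =
      w x * chain_comb y (Suc n) t x + - chain_comb y n (\<lambda>i. t (Suc i)) x"
      using x by (simp add: chain_comb_def unit_restrict_def sum_negf del: sum.lessThan_Suc)
  qed simp
qed

lemma continuous_on_chain_comb:
  assumes "ivp_chain w y y'"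
  shows "continuous_on {0..1} (chain_comb y n t)"
proof -
  have "continuous_on {0..1} (\<lambda>x. \<Sum>i<n. t i * y i x)"
    by (intro continuous_intros ivp_chain_continuous[OF assms])
  then show ?thesis
    by (rule continuous_on_eq) (simp add: chain_comb_def unit_restrict_def)
qed

text \<open>Applying the operator to a vanishing combination shifts its coefficients by one place, so by induction all
  coefficients but the first vanish, and then the first one does because the initial element of the chain is not zero.\<close>

lemma chain_comb_independent:
  assumes ch: "ivp_chain w y y'" and nz: "y 0 0 \<noteq> 0 \<or> y' 0 0 \<noteq> 0"
    and "\<And>x. x \<in> {0..1} \<Longrightarrow> chain_comb y n t x = 0" "i < n"
  shows "t i = 0"
  using assms(3,4)
proof (induction n arbitrary: t i)
  case (Suc n)
  note i = chain_comb_ivp[OF ch, of n t]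
  have v: "(\<Sum>i<Suc n. t i * y' i x) = 0" if "x \<in> {0..1}" for x
  proof (rule continuous_zero_if_integrals_zero[OF ivp_continuous(2)[OF i] _ that])
    fix x :: real assume x: "x \<in> {0..1}"
    have "((\<lambda>x. \<Sum>i<Suc n. t i * y' i x) has_integral (chain_comb y (Suc n) t x - chain_comb y (Suc n) t 0)) {0..x}"
      using i x unfolding ivp_def by blast
    then show "((\<lambda>x. \<Sum>i<Suc n. t i * y' i x) has_integral 0) {0..x}" using Suc.prems(1) x by simp
  qed
  have "chain_comb y n (\<lambda>i. t (Suc i)) x = 0" if "x \<in> {0..1}" for x
  proof (rule continuous_zero_if_integrals_zero[OF continuous_on_chain_comb[OF ch] _ that])
    fix x :: real assume x: "x \<in> {0..1}"
    have "((\<lambda>s. w s * chain_comb y (Suc n) t s + - chain_comb y n (\<lambda>i. t (Suc i)) s) has_integral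
        ((\<Sum>i<Suc n. t i * y' i x) - (\<Sum>i<Suc n. t i * y' i 0))) {0..x}"
      using i x unfolding ivp_def by blast
    then have "((\<lambda>s. w s * chain_comb y (Suc n) t s + - chain_comb y n (\<lambda>i. t (Suc i)) s) has_integral 0) {0..x}"
      using v[OF x] v[of 0] by (simp del: sum.lessThan_Suc)
    then have "((\<lambda>s. - (w s * chain_comb y (Suc n) t s + - chain_comb y n (\<lambda>i. t (Suc i)) s)) has_integral 0) {0..x}"
      by (drule_tac has_integral_neg) (simp only: minus_zero)
    then show "(chain_comb y n (\<lambda>i. t (Suc i)) has_integral 0) {0..x}"
      by (rule has_integral_eq[rotated]) (use Suc.prems(1) x in auto)
  qed
  then have tS: "t (Suc j) = 0" if "j < n" for j using Suc.IH[of "\<lambda>i. t (Suc i)" j] that by blast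
  have "chain_comb y (Suc n) t 0 = t 0 * y 0 0" "(\<Sum>i<Suc n. t i * y' i 0) = t 0 * y' 0 0"
    unfolding chain_comb_def by (subst sum.lessThan_Suc_shift, simp add: tS unit_restrict_def)+
  then have "t 0 = 0" using Suc.prems(1)[of 0] v[of 0] nz by auto
  then show ?case using tS Suc.prems(2) by (cases i) auto
qed simp

text \<open>The elements of the chain satisfy the boundary condition \<open>V = 0\<close>, and \<open>W = 0\<close> holds up to index \<open>m - 1\<close> but not
  at \<open>m\<close>. So the first \<open>m\<close> elements are root functions. Conversely, a function that the operator minus \<open>\<mu>\<close> maps to a
  combination of them is, up to a multiple of the first element, the combination shifted by one place; its value under
  \<open>W\<close> is the coefficient at index \<open>m\<close> times a nonzero number, so this coefficient vanishes and nothing new arises.\<close>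

lemma root_space_of_chain:
  fixes \<alpha> :: complex
  assumes q: "q absolutely_integrable_on {0..1}"
    and ch: "ivp_chain (\<lambda>t. q t - \<mu>) y y'"
    and nz: "y 0 0 \<noteq> 0 \<or> y' 0 0 \<noteq> 0"
    and bc: "\<And>u v. v 0 - v 1 = 0 \<and> u 0 + \<alpha> * u 1 = 0 \<longleftrightarrow> boundary_form V (u, v) = 0 \<and> boundary_form W (u, v) = 0"
    and V: "\<And>k. boundary_form V (y k, y' k) = 0"
    and W: "\<And>k. k < m \<Longrightarrow> boundary_form W (y k, y' k) = 0" "boundary_form W (y m, y' m) \<noteq> 0"
    and sol: "\<And>u v. ivp (\<lambda>t. q t - \<mu>) (\<lambda>_. 0) u v \<Longrightarrow> boundary_form V (u, v) = 0 \<Longrightarrow>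
      \<exists>c. \<forall>x\<in>{0..1}. u x = c * y 0 x \<and> v x = c * y' 0 x"
  shows "T3_alg_mult q \<alpha> \<mu> = m \<and> T3_root_space q \<alpha> \<mu> = T3_kernel q \<alpha> \<mu> m"
proof
  let ?w = "\<lambda>t. q t - \<mu>"
  have in_ker: "chain_comb y n t \<in> T3_kernel q \<alpha> \<mu> n" if "n \<le> m" for n t
    using that
  proof (induction n arbitrary: t)
    case 0
    show ?case by (simp add: chain_comb_def fun_eq_iff)
  next
    case (Suc n)
    let ?g = "chain_comb y n (\<lambda>i. t (Suc i))"
    have "boundary_form V (chain_comb y (Suc n) t, \<lambda>x. \<Sum>i<Suc n. t i * y' i x) = (\<Sum>i<Suc n. t i * boundary_form V (y i, y' i))"
      unfolding boundary_form_sum[symmetric] by (rule boundary_form_cong) (auto simp: chain_comb_def unit_restrict_def)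
    moreover have "boundary_form W (chain_comb y (Suc n) t, \<lambda>x. \<Sum>i<Suc n. t i * y' i x) = (\<Sum>i<Suc n. t i * boundary_form W (y i, y' i))"
      unfolding boundary_form_sum[symmetric] by (rule boundary_form_cong) (auto simp: chain_comb_def unit_restrict_def)
    ultimately have "boundary_form V (chain_comb y (Suc n) t, \<lambda>x. \<Sum>i<Suc n. t i * y' i x) = 0 \<and>
        boundary_form W (chain_comb y (Suc n) t, \<lambda>x. \<Sum>i<Suc n. t i * y' i x) = 0"
      using V W(1) Suc.prems by (simp del: sum.lessThan_Suc)
    then have "T3 q \<alpha> (chain_comb y (Suc n) t) (\<lambda>x. \<mu> * chain_comb y (Suc n) t x + ?g x)"
      unfolding T3_iff_ivp[OF q continuous_on_chain_comb[OF ch]] bc[symmetric]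
      using chain_comb_ivp[OF ch, of n t]
      by (intro conjI exI[of _ "\<lambda>x. \<Sum>i<Suc n. t i * y' i x"]) (auto simp: chain_comb_def unit_restrict_def)
    then show ?case using Suc by auto
  qed
  have ker: "\<exists>t. z = chain_comb y m t" if "z \<in> T3_kernel q \<alpha> \<mu> k" for k z
    using that
  proof (induction k arbitrary: z)
    case 0
    then show ?case by (intro exI[of _ "\<lambda>_. 0"]) (simp add: chain_comb_def fun_eq_iff)
  next
    case (Suc k)
    then obtain t where T: "T3 q \<alpha> z (\<lambda>x. \<mu> * z x + chain_comb y m t x)" by fastforce
    obtain v where z0: "\<And>x. x \<notin> {0..1} \<Longrightarrow> z x = 0" and i: "ivp ?w (\<lambda>x. - chain_comb y m t x) z v"
      and zbc: "boundary_form V (z, v) = 0" "boundary_form W (z, v) = 0"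
      using T unfolding T3_iff_ivp[OF q continuous_on_chain_comb[OF ch]] bc by blast
    \<comment> \<open>The shifted combination solves the same inhomogeneous equation as \<open>z\<close>, so the difference is a multiple of \<open>y 0\<close>.\<close>
    define r where "r = (\<lambda>i. case i of 0 \<Rightarrow> 0 | Suc j \<Rightarrow> t j)"
    have rS: "(\<lambda>i. r (Suc i)) = t" by (simp add: r_def)
    let ?c = "chain_comb y (Suc m) r" and ?c' = "\<lambda>x. \<Sum>i<Suc m. r i * y' i x"
    have ic: "ivp ?w (\<lambda>x. - chain_comb y m t x) ?c ?c'"
      using chain_comb_ivp[OF ch, of m r] unfolding rS .
    have "ivp ?w (\<lambda>x. 1 * - chain_comb y m t x + (-1) * - chain_comb y m t x) (\<lambda>x. 1 * z x + (-1) * ?c x) (\<lambda>x. 1 * v x + (-1) * ?c' x)"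
      by (rule ivp_linear[OF i ic])
    then have id: "ivp ?w (\<lambda>_. 0) (\<lambda>x. z x - ?c x) (\<lambda>x. v x - ?c' x)" by (simp del: sum.lessThan_Suc)
    have bV: "boundary_form X (?c, ?c') = (\<Sum>i<Suc m. r i * boundary_form X (y i, y' i))" for X
      unfolding boundary_form_sum[symmetric] by (rule boundary_form_cong) (auto simp: chain_comb_def unit_restrict_def)
    have "boundary_form V (\<lambda>x. z x - ?c x, \<lambda>x. v x - ?c' x) = 0"
      unfolding boundary_form_diff bV using zbc(1) V by simp
    from sol[OF id this] obtain c where d: "\<forall>x\<in>{0..1}. z x - ?c x = c * y 0 x \<and> v x - ?c' x = c * y' 0 x" by blast
    have c: "z x = ?c x + c * y 0 x" "v x = ?c' x + c * y' 0 x" if "x \<in> {0..1}" for x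
      using bspec[OF d that] by (simp_all only: diff_eq_eq add.commute)
    define s where "s = r(0 := c)"
    have s: "?c x + c * y 0 x = (\<Sum>i<Suc m. s i * y i x)" "?c' x + c * y' 0 x = (\<Sum>i<Suc m. s i * y' i x)"
      if "x \<in> {0..1}" for x
      using that by (simp_all only: chain_comb_def unit_restrict_def sum.lessThan_Suc_shift)
         (simp_all add: s_def r_def)
    have "boundary_form W (z, v) = boundary_form W (\<lambda>x. \<Sum>i<Suc m. s i * y i x, \<lambda>x. \<Sum>i<Suc m. s i * y' i x)"
      by (rule boundary_form_cong) (simp_all only: c s)
    also have "\<dots> = (\<Sum>i<Suc m. s i * boundary_form W (y i, y' i))" by (rule boundary_form_sum)
    also have "\<dots> = s m * boundary_form W (y m, y' m)" using W(1) by simp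
    finally have sm: "s m = 0" using zbc(2) W(2) by simp
    have "z = chain_comb y m s"
    proof
      fix x show "z x = chain_comb y m s x"
        using c(1)[of x] s(1)[of x] sm z0[of x] by (cases "x \<in> {0..1}") (auto simp: chain_comb_def unit_restrict_def)
    qed
    then show ?case by blast
  qed
  have root: "T3_root_space q \<alpha> \<mu> = range (chain_comb y m)"
    unfolding T3_root_space_def using ker in_ker[OF order_refl] by blast
  show "T3_root_space q \<alpha> \<mu> = T3_kernel q \<alpha> \<mu> m"
    unfolding root using ker in_ker[OF order_refl] by blast
  let ?f = "\<lambda>i. unit_restrict (y i)"
  have comb: "chain_comb y m t = (\<Sum>i<m. (\<lambda>x. t i * ?f i x))" for t
    by (simp add: fun_eq_iff sum_fun_apply chain_comb_def)
  have indep: "t i = 0" if "\<And>x. (\<Sum>i<m. t i * ?f i x) = 0" "i < m" for t i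
    using chain_comb_independent[OF ch nz, of m t i] that by (simp add: chain_comb_def)
  have inj: "inj_on ?f {..<m}"
  proof (rule inj_onI)
    fix i j assume ij: "i \<in> {..<m}" "j \<in> {..<m}" "?f i = ?f j"
    show "i = j"
    proof (rule ccontr)
      assume ne: "i \<noteq> j"
      let ?t = "\<lambda>k. (if k = i then 1 else 0) - (if k = j then 1 else 0) :: complex"
      have "(\<Sum>k<m. ?t k * ?f k x) = 0" for x
        using ij by (simp add: left_diff_distrib sum_subtractf if_distrib[of "\<lambda>c. c * _"] cong: if_cong)
      from indep[of ?t, OF this, of i] ij ne show False by simp
    qed
  qed
  have "cfun.independent (?f ` {..<m})"
  proof
    assume "cfun.dependent (?f ` {..<m})"
    then obtain u i where u: "i < m" "u (?f i) \<noteq> 0" "(\<Sum>v\<in>?f ` {..<m}. (\<lambda>x. u v * v x)) = 0"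
      unfolding cfun.dependent_finite[OF finite_imageI[OF finite_lessThan]] by auto
    have "(\<Sum>i<m. u (?f i) * ?f i x) = 0" for x
      using fun_cong[OF u(3), of x] unfolding sum_fun_apply by (simp add: sum.reindex[OF inj])
    from indep[of "\<lambda>i. u (?f i)", OF this u(1)] u(2) show False by simp
  qed
  moreover have "?f ` {..<m} \<subseteq> T3_root_space q \<alpha> \<mu>"
  proof
    fix z assume "z \<in> ?f ` {..<m}"
    then obtain i where i: "i < m" "z = ?f i" by auto
    then have "z = chain_comb y m (\<lambda>k. if k = i then 1 else 0)"
      by (simp add: chain_comb_def fun_eq_iff if_distrib[of "\<lambda>c. c * _"] cong: if_cong)
    then show "z \<in> T3_root_space q \<alpha> \<mu>" unfolding root by blast
  qed
  moreover have "T3_root_space q \<alpha> \<mu> \<subseteq> cfun.span (?f ` {..<m})"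
    unfolding root comb by (rule image_subsetI, rule cfun.span_sum, rule cfun.span_scale, rule cfun.span_base) auto
  moreover have "card (?f ` {..<m}) = m" using inj by (simp add: card_image)
  ultimately show "T3_alg_mult q \<alpha> \<mu> = m"
    unfolding T3_alg_mult_def cfun_dim_def[symmetric] by (intro cfun.dim_unique)
qed

text \<open>Take as initial data the values of one boundary form \<open>V\<close> on the fundamental solutions, so that the resulting
  solution satisfies \<open>V = 0\<close> for every parameter and its value under the other form is \<open>\<plusminus> charfun\<close>. The chain of its
  Taylor coefficients then fits the previous lemma with \<open>m\<close> the order of the zero. The first element of the chain must not
  vanish, that is, \<open>V\<close> must not be zero on all solutions: if \<open>y'(0) - y'(1)\<close> is, then the Wronskian gives \<open>c(1) = 1\<close>, and
  \<open>y(0) + \<alpha> y(1)\<close> takes the value \<open>1 + \<alpha> \<noteq> 0\<close> at \<open>c\<close>.\<close>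

lemma alg_mult_eq_order:
  fixes \<alpha> :: complex
  assumes q: "q absolutely_integrable_on {0..1}" and \<alpha>: "\<alpha> \<noteq> -1"
    and nz: "\<not> eventually (\<lambda>z. charfun q \<alpha> z = 0) (nhds \<mu>)"
  shows "T3_alg_mult q \<alpha> \<mu> = nat (zorder (charfun q \<alpha>) \<mu>)"
    and "T3_root_space q \<alpha> \<mu> = T3_kernel q \<alpha> \<mu> (T3_alg_mult q \<alpha> \<mu>)"
proof -
  let ?w = "\<lambda>t. q t - \<mu>"
  let ?U1 = "(0, 0, 1, -1) :: complex \<times> complex \<times> complex \<times> complex" and ?U2 = "(1, \<alpha>, 0, 0)"
  let ?c = "fund q \<mu> 1 0" and ?s = "fund q \<mu> 0 1"
  obtain c c' s s' and M :: real where
    c: "ivp_chain ?w c c'" and s: "ivp_chain ?w s s'" and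
    c0: "\<forall>V. boundary_form V (c 0, c' 0) = boundary_form V ?c" and s0: "\<forall>V. boundary_form V (s 0, s' 0) = boundary_form V ?s" and
    Fc: "\<forall>V. (\<lambda>z. boundary_form V (fund q (\<mu> + z) 1 0)) has_fps_expansion Abs_fps (\<lambda>k. boundary_form V (c k, c' k))" and
    Fs: "\<forall>V. (\<lambda>z. boundary_form V (fund q (\<mu> + z) 0 1)) has_fps_expansion Abs_fps (\<lambda>k. boundary_form V (s k, s' k))" and
    M: "M \<ge> 1" and B: "\<forall>V. \<exists>B. \<forall>k. cmod (boundary_form V (c k, c' k)) \<le> B * M ^ k \<and> cmod (boundary_form V (s k, s' k)) \<le> B * M ^ k"
    using fundamental_fps[OF q, of \<mu>] by (elim exE conjE) (rule that)
  \<comment> \<open>The boundary form \<open>V\<close> is chosen so that it does not vanish on all solutions; \<open>\<sigma>\<close> is the sign of the determinant.\<close>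
  obtain V W and \<sigma> :: complex where VW: "(V, W, \<sigma>) = (?U1, ?U2, -1) \<or> (V, W, \<sigma>) = (?U2, ?U1, 1)"
    and V0: "boundary_form V ?c \<noteq> 0 \<or> boundary_form V ?s \<noteq> 0"
  proof (cases "boundary_form ?U1 ?c \<noteq> 0 \<or> boundary_form ?U1 ?s \<noteq> 0")
    case False
    then have "snd ?c 1 = 0" "snd ?s 1 = 1" by (auto simp: boundary_form_def split_beta fund[OF q])
    with wronskian[OF q, of \<mu>] have "fst ?c 1 = 1" by simp
    then have "boundary_form ?U2 ?c \<noteq> 0" using \<alpha> by (simp add: boundary_form_def split_beta fund[OF q] add_eq_0_iff)
    then show ?thesis using that[of ?U2 ?U1 1] by blast
  qed (use that in blast)
  have \<sigma>: "\<sigma> = 1 \<or> \<sigma> = -1" using VW by auto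
  have det: "boundary_form V (fund q z 0 1) * boundary_form W (fund q z 1 0) - boundary_form V (fund q z 1 0) * boundary_form W (fund q z 0 1) = \<sigma> * charfun q \<alpha> z" for z
    using VW unfolding charfun_determinant[OF q] by (auto simp: algebra_simps)
  obtain D where D: "\<And>k. cmod (boundary_form V (c k, c' k)) \<le> D * M ^ k" "\<And>k. cmod (boundary_form V (s k, s' k)) \<le> D * M ^ k"
    using B by blast
  obtain y y' where y: "ivp_chain ?w y y'" "\<And>k. y k 0 = boundary_form V (s k, s' k)" "\<And>k. y' k 0 = - boundary_form V (c k, c' k)"
    using ivp_chain_exists[OF absolutely_integrable_minus_const[OF q, of \<mu>], of "\<lambda>k. boundary_form V (s k, s' k)" "\<lambda>k. - boundary_form V (c k, c' k)"] by blast
  have "cmod (y k 0) \<le> D * M ^ k" "cmod (y' k 0) \<le> D * M ^ k" for k using D by (auto simp: y)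
  from ivp_chain_fps[OF q y(1) this] M obtain a b where
    a: "a has_fps_expansion Abs_fps (\<lambda>k. y k 0)" and b: "b has_fps_expansion Abs_fps (\<lambda>k. y' k 0)" and
    Y: "\<forall>X. (\<lambda>z. a z * boundary_form X (fund q (\<mu> + z) 1 0) + b z * boundary_form X (fund q (\<mu> + z) 0 1))
       has_fps_expansion Abs_fps (\<lambda>k. boundary_form X (y k, y' k))"
    by fastforce
  have a': "(\<lambda>z. boundary_form V (fund q (\<mu> + z) 0 1)) has_fps_expansion Abs_fps (\<lambda>k. y k 0)"
    using spec[OF Fs, of V] by (simp add: y)
  have b': "(\<lambda>z. - boundary_form V (fund q (\<mu> + z) 1 0)) has_fps_expansion Abs_fps (\<lambda>k. y' k 0)"
  proof -
    have "- Abs_fps (\<lambda>k. boundary_form V (c k, c' k)) = Abs_fps (\<lambda>k. y' k 0)" by (simp add: fps_eq_iff y)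
    then show ?thesis using has_fps_expansion_minus[OF spec[OF Fc, of V]] by simp
  qed
  have eq: "eventually (\<lambda>z. f z = g z) (nhds 0)" if "f has_fps_expansion F" "g has_fps_expansion F" for f g :: "complex \<Rightarrow> complex" and F
  proof -
    have "(\<lambda>z. f z - g z) has_fps_expansion F - F" by (rule has_fps_expansion_diff[OF that])
    then show ?thesis by (auto simp: has_fps_expansion_def)
  qed
  have ev: "eventually (\<lambda>z. a z = boundary_form V (fund q (\<mu> + z) 0 1) \<and> b z = - boundary_form V (fund q (\<mu> + z) 1 0)) (nhds 0)"
    using eq[OF a a'] eq[OF b b'] by (rule eventually_conj)
  have "(\<lambda>_. 0) has_fps_expansion Abs_fps (\<lambda>k. boundary_form V (y k, y' k))"
    by (rule iffD1[OF has_fps_expansion_cong[OF _ refl] spec[OF Y, of V]])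
       (rule eventually_mono[OF ev], simp)
  from fps_expansion_unique_complex[OF this has_fps_expansion_0] have yV: "boundary_form V (y k, y' k) = 0" for k
    by (simp add: fps_eq_iff)
  define F where "F = Abs_fps (\<lambda>k. boundary_form W (y k, y' k))"
  have F: "(\<lambda>z. \<sigma> * charfun q \<alpha> (\<mu> + z)) has_fps_expansion F"
    unfolding F_def
    by (rule iffD1[OF has_fps_expansion_cong[OF _ refl] spec[OF Y, of W]])
       (rule eventually_mono[OF ev], simp add: det[symmetric])
  have "(\<lambda>z. \<sigma> * (\<sigma> * charfun q \<alpha> (\<mu> + z))) has_fps_expansion fps_const \<sigma> * F"
    by (rule has_fps_expansion_cmult_left[OF F])
  then have G: "(\<lambda>z. charfun q \<alpha> (\<mu> + z)) has_fps_expansion fps_const \<sigma> * F"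
    using \<sigma> by (auto simp: mult.assoc[symmetric])
  have F0: "fps_const \<sigma> * F \<noteq> 0"
  proof
    assume "fps_const \<sigma> * F = 0"
    then have "(\<lambda>_. 0) has_fps_expansion fps_const \<sigma> * F" by (simp only: has_fps_expansion_0)
    then have "eventually (\<lambda>z. charfun q \<alpha> (\<mu> + z) = 0) (nhds 0)" by (rule eq[OF G])
    then have "eventually (\<lambda>z. charfun q \<alpha> z = 0) (nhds \<mu>)"
      using eventually_filtermap[of _ "\<lambda>z. \<mu> + z" "nhds 0"] by (simp add: nhds_to_0[of \<mu>] eventually_filtermap add.commute)
    with nz show False by contradiction
  qed
  define m where "m = subdegree (fps_const \<sigma> * F)"
  have \<sigma>0: "\<sigma> \<noteq> 0" using \<sigma> by auto
  have zo: "zorder (charfun q \<alpha>) \<mu> = int m"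
    unfolding m_def by (rule has_fps_expansion_zorder[OF G F0])
  have nth: "fps_nth (fps_const \<sigma> * F) k = \<sigma> * boundary_form W (y k, y' k)" for k by (simp add: F_def)
  have W1: "boundary_form W (y k, y' k) = 0" if "k < m" for k
    using nth_less_subdegree_zero[of k "fps_const \<sigma> * F"] that \<sigma>0 unfolding m_def[symmetric] nth by simp
  have W2: "boundary_form W (y m, y' m) \<noteq> 0"
    using nth_subdegree_nonzero[OF F0] unfolding m_def[symmetric] nth by auto
  have y0: "y 0 0 = boundary_form V ?s" "y' 0 0 = - boundary_form V ?c" using spec[OF c0, of V] spec[OF s0, of V] by (auto simp: y)
  have iy: "ivp ?w (\<lambda>_. 0) (y 0) (y' 0)" using y(1) by (simp add: ivp_chain_def)
  have root: "T3_alg_mult q \<alpha> \<mu> = m \<and> T3_root_space q \<alpha> \<mu> = T3_kernel q \<alpha> \<mu> m"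
  proof (rule root_space_of_chain[OF q y(1), where V = V and W = W])
    show "y 0 0 \<noteq> 0 \<or> y' 0 0 \<noteq> 0" using V0 y0 by auto
    show "v 0 - v 1 = 0 \<and> u 0 + \<alpha> * u 1 = 0 \<longleftrightarrow> boundary_form V (u, v) = 0 \<and> boundary_form W (u, v) = 0" for u v
      using VW by (auto simp: boundary_form_def)
    fix u v assume iu: "ivp ?w (\<lambda>_. 0) u v" and Vu: "boundary_form V (u, v) = 0"
    have lin: "u 0 * boundary_form V ?c + v 0 * boundary_form V ?s = 0" using boundary_form_eq_fundamental[OF q iu, of V] Vu by simp
    have "\<exists>d. u 0 = d * y 0 0 \<and> v 0 = d * y' 0 0"
    proof (cases "boundary_form V ?s = 0")
      case True
      then show ?thesis using lin V0 y0 by (intro exI[of _ "- v 0 / boundary_form V ?c"]) auto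
    next
      case False
      then have "v 0 = - (u 0 * boundary_form V ?c) / boundary_form V ?s" using lin by (simp add: field_simps add_eq_0_iff)
      with False show ?thesis by (intro exI[of _ "u 0 / boundary_form V ?s"]) (simp add: y0)
    qed
    then obtain d where d: "u 0 = d * y 0 0" "v 0 = d * y' 0 0" by blast
    have "ivp ?w (\<lambda>_. 0) (\<lambda>x. d * y 0 x) (\<lambda>x. d * y' 0 x)" using ivp_scale[OF iy, of d] by simp
    from ivp_unique[OF absolutely_integrable_minus_const[OF q] iu this] d
    show "\<exists>c. \<forall>x\<in>{0..1}. u x = c * y 0 x \<and> v x = c * y' 0 x" by (intro exI[of _ d]) auto
  qed (use yV W1 W2 in auto)
  show "T3_alg_mult q \<alpha> \<mu> = nat (zorder (charfun q \<alpha>) \<mu>)" using root zo by simp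
  show "T3_root_space q \<alpha> \<mu> = T3_kernel q \<alpha> \<mu> (T3_alg_mult q \<alpha> \<mu>)" using root by simp
qed

section \<open>Zeros in a disc and the operator with zero potential\<close>

text \<open>Up to constants the sine has the size of its distance to the zeros times \<open>exp \<bar>Im z\<bar>\<close>. Away from the real axis one
  exponential dominates; near it, \<open>\<bar>sin (x + i y)\<bar>\<^sup>2 = sin\<^sup>2 x + sinh\<^sup>2 y\<close> after reduction to \<open>\<bar>x\<bar> \<le> \<pi>/2\<close>.\<close>

lemma norm_sin_lower_bound:
  fixes z :: complex
  obtains k :: int where "cmod (sin z) \<ge> min 1 (cmod (z - of_int k * pi)) * exp \<bar>Im z\<bar> / 6"
proof (cases "\<bar>Im z\<bar> \<ge> 1")
  case True
  define y where "y = \<bar>Im z\<bar>"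
  have y: "y \<ge> 1" using True by (simp add: y_def)
  have "cmod (exp (\<i> * z)) = exp (- Im z)" "cmod (exp (- (\<i> * z))) = exp (Im z)" by simp_all
  then have "\<bar>exp (Im z) - exp (- Im z)\<bar> \<le> cmod (exp (\<i> * z) - exp (- (\<i> * z)))"
    using norm_triangle_ineq3[of "exp (\<i> * z)" "exp (- (\<i> * z))"] by (simp add: abs_minus_commute)
  moreover have "\<bar>exp (Im z) - exp (- Im z)\<bar> = exp y - exp (- y)"
    by (auto simp: y_def abs_if)
  moreover have "cmod (sin z) = cmod (exp (\<i> * z) - exp (- (\<i> * z))) / 2"
    by (simp add: sin_exp_eq norm_divide norm_mult)
  moreover have "exp (- y) \<le> exp y / 2"
  proof -
    have "exp (- y) \<le> 1" using y by simp
    moreover have "exp y \<ge> 2" using y exp_ge_add_one_self[of y] by linarith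
    ultimately show ?thesis by linarith
  qed
  ultimately have le: "cmod (sin z) \<ge> exp y / 4" by simp
  have "min 1 (cmod (z - of_int 0 * pi)) * exp y / 6 \<le> 1 * exp y / 6"
    by (intro divide_right_mono mult_right_mono) auto
  also have "\<dots> \<le> exp y / 4" by simp
  finally show ?thesis using that[of 0] le unfolding y_def by linarith
next
  case False
  define k where "k = round (Re z / pi)"
  define w where "w = z - of_int k * pi"
  define x where "x = Re w"
  define y where "y = Im w"
  have yz: "y = Im z" by (simp add: y_def w_def)
  have "\<bar>of_int k - Re z / pi\<bar> \<le> 1 / 2" unfolding k_def by (rule of_int_round_abs_le)
  then have "\<bar>of_int k - Re z / pi\<bar> * pi \<le> 1 / 2 * pi" by (intro mult_right_mono) auto
  then have "\<bar>(of_int k - Re z / pi) * pi\<bar> \<le> pi / 2" by (simp add: abs_mult)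
  then have x: "\<bar>x\<bar> \<le> pi / 2" by (simp add: x_def w_def algebra_simps abs_minus_commute)
  have sz: "cmod (sin z) = cmod (sin w)"
  proof -
    have "sin z = sin (w + of_int k * pi)" by (simp add: w_def)
    also have "\<dots> = sin w * cos (of_int k * complex_of_real pi)"
    proof -
      have "sin (of_int k * complex_of_real pi) = 0"
        unfolding sin_eq_0 by (rule exI[of _ k]) simp
      then show ?thesis unfolding sin_add by simp
    qed
    finally have eq: "sin z = sin w * cos (of_int k * complex_of_real pi)" .
    have "of_int k * complex_of_real pi = complex_of_real (pi * of_int k)" by simp
    then have "cos (of_int k * complex_of_real pi) = complex_of_real (cos (pi * of_int k))" by (simp only: cos_of_real)
    then have "cmod (cos (of_int k * complex_of_real pi)) = 1" by (simp add: cos_npi_int)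
    then show ?thesis unfolding eq norm_mult by simp
  qed
  have sx: "\<bar>sin x\<bar> \<ge> \<bar>x\<bar> / 2"
  proof -
    have "\<bar>sin x - (\<Sum>m<3. sin_coeff m * x ^ m)\<bar> \<le> inverse (fact 3) * \<bar>x\<bar> ^ 3" by (rule Maclaurin_sin_bound)
    moreover have "(\<Sum>m<3. sin_coeff m * x ^ m) = x" by (simp add: eval_nat_numeral sin_coeff_def)
    ultimately have "\<bar>sin x - x\<bar> \<le> \<bar>x\<bar> ^ 3 / 6" by (simp add: fact_numeral)
    moreover have "\<bar>x\<bar> ^ 3 / 6 \<le> \<bar>x\<bar> / 2"
    proof -
      have "\<bar>x\<bar> \<le> 1.7" using x pi_approx by simp
      then have "\<bar>x\<bar> ^ 2 \<le> 1.7 ^ 2" by (intro power_mono) auto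
      then have "\<bar>x\<bar> * \<bar>x\<bar> ^ 2 \<le> \<bar>x\<bar> * 3" by (intro mult_left_mono) (auto simp: power2_eq_square)
      then show ?thesis by (simp add: power3_eq_cube power2_eq_square)
    qed
    ultimately show ?thesis by linarith
  qed
  have sh: "((exp y - exp (- y)) / 2)\<^sup>2 \<ge> y\<^sup>2"
  proof -
    have *: "(exp t - exp (- t)) / 2 \<ge> t" if "t \<ge> 0" for t :: real
    proof -
      have "(\<lambda>s. (exp s - exp (- s)) / 2 - s) 0 \<le> (\<lambda>s. (exp s - exp (- s)) / 2 - s) t"
      proof (rule DERIV_nonneg_imp_nondecreasing[OF that])
        fix s :: real
        have "((\<lambda>s. (exp s - exp (- s)) / 2 - s) has_real_derivative (exp s + exp (- s)) / 2 - 1) (at s)"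
          by (auto intro!: derivative_eq_intros)
        moreover have "(a + b) / 2 - 1 \<ge> 0" if "1 + s \<le> a" "1 + - s \<le> b" for a b
          using that by simp
        from this[OF exp_ge_add_one_self exp_ge_add_one_self] have "(exp s + exp (- s)) / 2 - 1 \<ge> 0" .
        ultimately show "\<exists>d. ((\<lambda>s. (exp s - exp (- s)) / 2 - s) has_real_derivative d) (at s) \<and> d \<ge> 0" by blast
      qed
      then show ?thesis by simp
    qed
    have "\<bar>y\<bar> \<le> \<bar>(exp y - exp (- y)) / 2\<bar>"
      using *[of y] *[of "- y"] by (cases "y \<ge> 0") auto
    then show ?thesis by (rule abs_le_square_iff[THEN iffD1])
  qed
  have "(cmod (sin w))\<^sup>2 = (sin x)\<^sup>2 + ((exp y - exp (- y)) / 2)\<^sup>2"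
  proof -
    have e: "exp y * exp (- y) = 1" by (simp flip: exp_add)
    define a where "a = exp y" define b where "b = exp (- y)"
    have ab: "a * b = 1" using e by (simp add: a_def b_def)
    have "(cmod (sin w))\<^sup>2 = (sin x * (a + b) / 2)\<^sup>2 + (cos x * (a - b) / 2)\<^sup>2"
      by (simp add: cmod_power2 Re_sin Im_sin x_def y_def a_def b_def)
    also have "\<dots> = (sin x)\<^sup>2 * (((a - b) / 2)\<^sup>2 + a * b) + (cos x)\<^sup>2 * ((a - b) / 2)\<^sup>2"
      by (simp add: power2_eq_square field_simps)
    also have "\<dots> = (sin x)\<^sup>2 + ((sin x)\<^sup>2 + (cos x)\<^sup>2) * ((a - b) / 2)\<^sup>2"
    proof -
      have "s * (p + 1) + c * p = s + (s + c) * p" for s c p :: real by (simp add: algebra_simps)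
      then show ?thesis unfolding ab .
    qed
    finally show ?thesis by (simp add: a_def b_def)
  qed
  moreover have "(sin x)\<^sup>2 \<ge> (x / 2)\<^sup>2" using sx by (intro abs_le_square_iff[THEN iffD1]) auto
  ultimately have "(cmod (sin w))\<^sup>2 \<ge> (x / 2)\<^sup>2 + y\<^sup>2" using sh by linarith
  moreover have "(x / 2)\<^sup>2 + y\<^sup>2 \<ge> (cmod w / 2)\<^sup>2"
    by (simp add: power_divide cmod_power2 x_def y_def)
  ultimately have "(cmod w / 2)\<^sup>2 \<le> (cmod (sin w))\<^sup>2" by linarith
  then have sw: "cmod w / 2 \<le> cmod (sin w)" by (rule power2_le_imp_le) auto
  have "exp \<bar>Im z\<bar> \<le> exp 1" using False by simp
  also have "\<dots> \<le> (3::real)" by (rule exp_le)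
  finally have "min 1 (cmod w) * exp \<bar>Im z\<bar> / 6 \<le> cmod w * 3 / 6"
    by (intro divide_right_mono mult_mono) auto
  then have "min 1 (cmod w) * exp \<bar>Im z\<bar> / 6 \<le> cmod (sin z)" using sw sz by linarith
  then show ?thesis unfolding w_def by (rule that)
qed

text \<open>Rouche's theorem for entire functions on a circle, as equality of the total orders of the zeros inside.\<close>

lemma rouche_circle:
  fixes f g :: "complex \<Rightarrow> complex"
  assumes f: "f holomorphic_on UNIV" and g: "g holomorphic_on UNIV" and r: "r > 0"
    and less: "\<And>z. z \<in> sphere z0 r \<Longrightarrow> cmod (f z - g z) < cmod (g z)"
  shows "(\<Sum>p\<in>{p\<in>ball z0 r. f p = 0}. zorder f p) = (\<Sum>p\<in>{p\<in>ball z0 r. g p = 0}. zorder g p)"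
    and "finite {p\<in>ball z0 r. f p = 0}"
proof -
  have z1: "z0 + of_real r \<in> sphere z0 r" using r by (simp add: dist_norm)
  have nz: "f z \<noteq> 0" "g z \<noteq> 0" if "z \<in> sphere z0 r" for z
    using less[OF that] by auto
  let ?s = "ball z0 (r + 1)"
  have fin: "finite {p\<in>?s. h p = 0}" if h: "h holomorphic_on UNIV" and hnz: "\<And>z. z \<in> sphere z0 r \<Longrightarrow> h z \<noteq> 0" for h :: "complex \<Rightarrow> complex"
  proof (cases "h constant_on UNIV")
    case True
    then have "h p \<noteq> 0" for p using hnz[OF z1] by (auto simp: constant_on_def)
    then show ?thesis by simp
  next
    case False
    have "finite {p\<in>cball z0 (r + 1). h p = 0}"
      by (rule holomorphic_compact_finite_zeros[OF h _ _ _ _ False]) auto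
    then show ?thesis by (rule finite_subset[rotated]) auto
  qed
  have ff: "finite {p\<in>?s. f p = 0}" and fg: "finite {p\<in>?s. g p = 0}" using fin f g nz by auto
  have wn: "winding_number (circlepath z0 r) p = (if p \<in> ball z0 r then 1 else 0)" if "h p = 0"
    "\<And>z. z \<in> sphere z0 r \<Longrightarrow> h z \<noteq> 0" for h :: "complex \<Rightarrow> complex" and p
  proof (cases "p \<in> ball z0 r")
    case True
    then show ?thesis by (simp add: winding_number_circlepath dist_norm norm_minus_commute)
  next
    case False
    then have "p \<notin> cball z0 r" using that by (auto simp: less_le)
    then have "winding_number (circlepath z0 r) p = 0"
      by (intro winding_number_zero_outside[of _ "cball z0 r"]) (use r in auto)
    then show ?thesis using False by simp
  qed
  have sums: "(\<Sum>p\<in>{p\<in>?s. h p = 0}. winding_number (circlepath z0 r) p * zorder h p) = of_int (\<Sum>p\<in>{p\<in>ball z0 r. h p = 0}. zorder h p)"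
    if "finite {p\<in>?s. h p = 0}" "\<And>z. z \<in> sphere z0 r \<Longrightarrow> h z \<noteq> 0" for h :: "complex \<Rightarrow> complex"
  proof -
    have w: "winding_number (circlepath z0 r) p = (if p \<in> ball z0 r then 1 else 0)" if "h p = 0" for p
      by (rule wn[of h, OF that]) (rule \<open>\<And>z. z \<in> sphere z0 r \<Longrightarrow> h z \<noteq> 0\<close>)
    have "(\<Sum>p\<in>{p\<in>?s. h p = 0}. winding_number (circlepath z0 r) p * zorder h p) =
        (\<Sum>p\<in>{p\<in>ball z0 r. h p = 0}. of_int (zorder h p))"
      by (rule sum.mono_neutral_cong_right[OF that(1)]) (auto simp: w split: if_splits)
    then show ?thesis by simp
  qed
  have "(\<Sum>p\<in>{p\<in>?s. g p + (f p - g p) = 0}. winding_number (circlepath z0 r) p * zorder (\<lambda>p. g p + (f p - g p)) p) =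
      (\<Sum>p\<in>{p\<in>?s. g p = 0}. winding_number (circlepath z0 r) p * zorder g p)"
  proof (rule Rouche_theorem)
    show "\<forall>z. z \<notin> ?s \<longrightarrow> winding_number (circlepath z0 r) z = 0"
    proof (intro allI impI)
      fix z assume "z \<notin> ?s"
      then show "winding_number (circlepath z0 r) z = 0"
        by (intro winding_number_zero_outside[of _ "cball z0 r"]) (use r in auto)
    qed
    show "g holomorphic_on ?s" "(\<lambda>p. f p - g p) holomorphic_on ?s"
      using f g by (auto intro!: holomorphic_intros intro: holomorphic_on_subset)
  qed (use ff fg less r in auto)
  then have "(\<Sum>p\<in>{p\<in>?s. f p = 0}. winding_number (circlepath z0 r) p * zorder f p) =
      (\<Sum>p\<in>{p\<in>?s. g p = 0}. winding_number (circlepath z0 r) p * zorder g p)" by simp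
  then show "(\<Sum>p\<in>{p\<in>ball z0 r. f p = 0}. zorder f p) = (\<Sum>p\<in>{p\<in>ball z0 r. g p = 0}. zorder g p)"
    by (simp only: sums[OF ff nz(1)] sums[OF fg nz(2)] of_int_eq_iff)
  show "finite {p\<in>ball z0 r. f p = 0}" by (rule finite_subset[OF _ ff]) auto
qed

abbreviation free_eigenvalue :: "nat \<Rightarrow> complex" where
  "free_eigenvalue n \<equiv> complex_of_real ((2 * pi * real n)\<^sup>2)"

lemma charfun_zero_potential: "charfun (\<lambda>_. 0) \<alpha> (\<rho>\<^sup>2) = (1 - \<alpha>) * (cos \<rho> - 1)"
proof -
  have q: "(\<lambda>_. 0::complex) absolutely_integrable_on {0..1::real}" by simp
  show ?thesis
  proof (cases "\<rho> = 0")
    case True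
    have i: "ivp (\<lambda>t. 0 - 0) (\<lambda>_. 0) (\<lambda>_. 1) (\<lambda>_. 0)" by (simp add: ivp_def)
    have "ivp (\<lambda>t. 0 - 0) (\<lambda>_. 0) (\<lambda>x. x) (\<lambda>_. 1)"
      unfolding ivp_def by (auto intro!: has_integral_eq_rhs[OF has_integral_const_real] simp: scaleR_conv_of_real)
    from ivp_eq_fundamental(2)[OF q this, of 1] ivp_eq_fundamental(1)[OF q i, of 1] show ?thesis
      using True by (simp add: charfun_def)
  next
    case False
    show ?thesis
      using ivp_variation_of_constants(2)[OF q fund(1)[OF q, of "\<rho>\<^sup>2" 0 1] False, of 1]
        ivp_variation_of_constants(1)[OF q fund(1)[OF q, of "\<rho>\<^sup>2" 1 0] False, of 1]
      by (simp add: charfun_def fund[OF q] algebra_simps)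
  qed
qed

lemma zeros_zero_potential:
  assumes "\<alpha> \<noteq> 1"
  shows "charfun (\<lambda>_. 0) \<alpha> \<mu> = 0 \<longleftrightarrow> (\<exists>n::nat. \<mu> = free_eigenvalue n)"
proof -
  define \<rho> where "\<rho> = csqrt \<mu>"
  have \<mu>: "\<mu> = \<rho>\<^sup>2" by (simp add: \<rho>_def)
  have "charfun (\<lambda>_. 0) \<alpha> \<mu> = 0 \<longleftrightarrow> (\<exists>n::int. \<rho> = complex_of_real (2 * real_of_int n * pi))"
    unfolding \<mu> charfun_zero_potential using assms by (simp add: cos_eq_1)
  also have "\<dots> \<longleftrightarrow> (\<exists>n::nat. \<mu> = free_eigenvalue n)"
  proof
    assume "\<exists>n::int. \<rho> = complex_of_real (2 * real_of_int n * pi)"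
    then obtain n :: int where n: "\<rho> = complex_of_real (2 * real_of_int n * pi)" by blast
    have "(2 * real_of_int n * pi)\<^sup>2 = (2 * pi * real (nat \<bar>n\<bar>))\<^sup>2" by (simp add: power_mult_distrib)
    then show "\<exists>n::nat. \<mu> = free_eigenvalue n" unfolding \<mu> n of_real_power[symmetric] by metis
  next
    assume "\<exists>n::nat. \<mu> = free_eigenvalue n"
    then obtain n :: nat where "\<rho>\<^sup>2 = (complex_of_real (2 * pi * real n))\<^sup>2" unfolding \<mu> by auto
    then have "\<rho> = complex_of_real (2 * real_of_int (int n) * pi) \<or> \<rho> = complex_of_real (2 * real_of_int (- int n) * pi)"
      unfolding power2_eq_iff by auto
    then show "\<exists>n::int. \<rho> = complex_of_real (2 * real_of_int n * pi)" by blast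
  qed
  finally show ?thesis .
qed

text \<open>Differentiate \<open>g(z\<^sup>2) = (1 - \<alpha>)(cos z - 1)\<close> twice. At \<open>z = 0\<close> the factor \<open>2 z\<close> of the chain rule halves the
  order, which is why the eigenvalue zero is simple although all others are double.\<close>

lemma zorder_zero_potential:
  assumes "\<alpha> \<noteq> 1"
  shows "zorder (charfun (\<lambda>_. 0) \<alpha>) (free_eigenvalue n) = (if n = 0 then 1 else 2)"
proof -
  have q: "(\<lambda>_. 0::complex) absolutely_integrable_on {0..1::real}" by simp
  let ?g = "charfun (\<lambda>_. 0) \<alpha>"
  define \<rho> where "\<rho> = complex_of_real (2 * pi * real n)"
  have hol: "?g holomorphic_on UNIV" by (rule charfun_holomorphic[OF q])
  have hol': "deriv ?g holomorphic_on UNIV" by (rule holomorphic_deriv[OF hol]) simp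
  have d1: "(?g has_field_derivative deriv ?g z) (at z)" for z by (rule holomorphic_derivI[OF hol]) auto
  have d2: "(deriv ?g has_field_derivative deriv (deriv ?g) z) (at z)" for z by (rule holomorphic_derivI[OF hol']) auto
  have 1: "2 * z * deriv ?g (z\<^sup>2) = - (1 - \<alpha>) * sin z" for z
  proof (rule DERIV_unique)
    show "((\<lambda>z. ?g (z\<^sup>2)) has_field_derivative 2 * z * deriv ?g (z\<^sup>2)) (at z)"
      by (rule DERIV_cong[OF DERIV_chain2[OF d1]]) (auto intro!: derivative_eq_intros)
    show "((\<lambda>z. ?g (z\<^sup>2)) has_field_derivative - (1 - \<alpha>) * sin z) (at z)"
      unfolding charfun_zero_potential by (auto intro!: derivative_eq_intros simp: algebra_simps)
  qed
  have 2: "2 * deriv ?g (z\<^sup>2) + 4 * z\<^sup>2 * deriv (deriv ?g) (z\<^sup>2) = - (1 - \<alpha>) * cos z" for z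
  proof (rule DERIV_unique)
    have "((\<lambda>z. 2 * z * deriv ?g (z\<^sup>2)) has_field_derivative 2 * deriv ?g (z\<^sup>2) + 4 * z\<^sup>2 * deriv (deriv ?g) (z\<^sup>2)) (at z)"
      by (rule derivative_eq_intros DERIV_chain2[OF d2] refl)+ (simp add: power2_eq_square)
    then show "((\<lambda>z. - (1 - \<alpha>) * sin z) has_field_derivative 2 * deriv ?g (z\<^sup>2) + 4 * z\<^sup>2 * deriv (deriv ?g) (z\<^sup>2)) (at z)"
      unfolding 1 .
    show "((\<lambda>z. - (1 - \<alpha>) * sin z) has_field_derivative - (1 - \<alpha>) * cos z) (at z)"
      by (auto intro!: derivative_eq_intros)
  qed
  have g0: "?g (\<rho>\<^sup>2) = 0"
    using zeros_zero_potential[OF assms, of "\<rho>\<^sup>2"] by (auto simp: \<rho>_def)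
  then have cs: "cos \<rho> = 1" using assms unfolding charfun_zero_potential by simp
  then have sn: "sin \<rho> = 0" using sin_cos_squared_add[of \<rho>] by simp
  have "zorder ?g (\<rho>\<^sup>2) = (if n = 0 then 1 else 2)"
  proof (cases "n = 0")
    case True
    then have "deriv ?g (\<rho>\<^sup>2) \<noteq> 0" using 2[of \<rho>] assms by (auto simp: \<rho>_def)
    then have "zorder ?g (\<rho>\<^sup>2) = 1" using g0 by (intro zorder_zero_eqI[OF hol]) auto
    then show ?thesis using True by simp
  next
    case False
    then have \<rho>0: "\<rho> \<noteq> 0" by (simp add: \<rho>_def)
    have g1: "deriv ?g (\<rho>\<^sup>2) = 0" using 1[of \<rho>] sn \<rho>0 by simp
    have g2: "deriv (deriv ?g) (\<rho>\<^sup>2) \<noteq> 0" using 2[of \<rho>] g1 cs assms by auto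
    have "(deriv ^^ i) ?g (\<rho>\<^sup>2) = 0" if "i < nat 2" for i
    proof -
      have "i = 0 \<or> i = 1" using that by auto
      then show ?thesis using g0 g1 by auto
    qed
    moreover have "(deriv ^^ nat 2) ?g (\<rho>\<^sup>2) \<noteq> 0" using g2 by (simp add: eval_nat_numeral)
    ultimately have "zorder ?g (\<rho>\<^sup>2) = 2" by (intro zorder_zero_eqI[OF hol]) auto
    then show ?thesis using False by simp
  qed
  then show ?thesis by (simp add: \<rho>_def)
qed

section \<open>Localisation and counting of all zeros\<close>

lemma cos_minus_one_half_angle: "cos z - 1 = - 2 * (sin (z / 2))\<^sup>2" for z :: complex
  using cos_double_sin[of "z / 2"] by simp

text \<open>Large zeros \<open>\<rho>\<^sup>2\<close> of the characteristic function satisfy \<open>dist(\<rho>/2, \<pi>\<int>)\<^sup>2 \<le> const/\<bar>\<rho>\<bar>\<close> with this constant. The number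
  36 is the square of the denominator in the lower bound for the sine.\<close>

definition localisation_const :: "(real \<Rightarrow> complex) \<Rightarrow> complex \<Rightarrow> real" where
  "localisation_const q \<alpha> = 36 * integral {0..1} (\<lambda>t. cmod (q t)) * (1 + cmod \<alpha>) / cmod (1 - \<alpha>)"

context
  fixes q :: "real \<Rightarrow> complex" and \<alpha> :: complex and Q :: real
  assumes q: "q absolutely_integrable_on {0..1}" and \<alpha>: "\<alpha> \<noteq> 1"
  defines "Q \<equiv> integral {0..1} (\<lambda>t. cmod (q t))"
begin

lemma potential_norm_nonneg: "Q \<ge> 0"
  unfolding Q_def using absolutely_integrable_norm_integrable(2)[OF q, of 1] by (intro integral_nonneg) auto

text \<open>First order asymptotics at \<open>x = 1\<close>; here \<open>(1 - \<alpha>)(cos \<rho> - 1)\<close> is the characteristic function for \<open>q = 0\<close>.\<close>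

lemma charfun_minus_free:
  assumes \<rho>: "\<rho> \<noteq> 0" "2 * Q \<le> cmod \<rho>"
  shows "cmod (charfun q \<alpha> (\<rho>\<^sup>2) - (1 - \<alpha>) * (cos \<rho> - 1)) \<le> 2 * Q * (1 + cmod \<alpha>) * exp \<bar>Im \<rho>\<bar> / cmod \<rho>"
proof -
  let ?E = "2 * Q * exp \<bar>Im \<rho>\<bar> / cmod \<rho>"
  have c: "cmod (fst (fund q (\<rho>\<^sup>2) 1 0) 1 - cos \<rho>) \<le> ?E"
    using ivp_asymptotics(2)[OF q fund(1)[OF q, of "\<rho>\<^sup>2" 1 0] meta_eq_to_obj_eq[OF Q_def] \<rho> refl, of 1] by (simp add: fund[OF q])
  have s: "cmod (snd (fund q (\<rho>\<^sup>2) 0 1) 1 - cos \<rho>) \<le> ?E"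
    using ivp_asymptotics(3)[OF q fund(1)[OF q, of "\<rho>\<^sup>2" 0 1] meta_eq_to_obj_eq[OF Q_def] \<rho> refl, of 1] by (simp add: fund[OF q] norm_divide)
  have "charfun q \<alpha> (\<rho>\<^sup>2) - (1 - \<alpha>) * (cos \<rho> - 1) =
      (snd (fund q (\<rho>\<^sup>2) 0 1) 1 - cos \<rho>) - \<alpha> * (fst (fund q (\<rho>\<^sup>2) 1 0) 1 - cos \<rho>)"
    by (simp add: charfun_def algebra_simps)
  also have "cmod \<dots> \<le> ?E + cmod \<alpha> * ?E"
    by (rule norm_triangle_le_diff, unfold norm_mult, intro add_mono mult_left_mono c s) auto
  finally show ?thesis by (simp add: algebra_simps add_divide_distrib)
qed

lemma localisation_const_eq: "localisation_const q \<alpha> = 36 * Q * (1 + cmod \<alpha>) / cmod (1 - \<alpha>)"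
  by (simp add: localisation_const_def Q_def)

lemma localisation_const_nonneg: "localisation_const q \<alpha> \<ge> 0"
  unfolding localisation_const_eq using potential_norm_nonneg by (intro divide_nonneg_nonneg mult_nonneg_nonneg) auto

text \<open>At a zero, \<open>2 \<bar>1 - \<alpha>\<bar> \<bar>sin(\<rho>/2)\<bar>\<^sup>2\<close> is at most the perturbation \<open>O(exp \<bar>Im \<rho>\<bar> / \<bar>\<rho>\<bar>)\<close>. By the lower bound for the
  sine, \<open>\<rho>\<close> is within \<open>O(n\<^sup>-\<^sup>1\<^sup>/\<^sup>2)\<close> of some \<open>2\<pi>n\<close>, so \<open>\<rho>\<^sup>2\<close> is within \<open>O(n\<^sup>1\<^sup>/\<^sup>2)\<close> of \<open>(2\<pi>n)\<^sup>2\<close>.\<close>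

lemma charfun_zero_localised:
  assumes z: "charfun q \<alpha> \<mu> = 0" and big: "cmod (csqrt \<mu>) \<ge> max (2 * Q) (max (localisation_const q \<alpha> + 1) 10)"
  shows "\<exists>n\<ge>1. cmod (csqrt \<mu> - of_real (2 * pi * real n)) < 2 \<and>
      cmod (\<mu> - free_eigenvalue n) \<le> 16 * sqrt (localisation_const q \<alpha>) * sqrt (real n)"
proof -
  define \<rho> where "\<rho> = csqrt \<mu>"
  have \<mu>: "\<mu> = \<rho>\<^sup>2" by (simp add: \<rho>_def)
  have \<rho>: "cmod \<rho> \<ge> 2 * Q" "cmod \<rho> > localisation_const q \<alpha>" "cmod \<rho> \<ge> 10" "\<rho> \<noteq> 0" using big by (auto simp: \<rho>_def[symmetric])
  have Re: "Re \<rho> \<ge> 0" unfolding \<rho>_def by (rule Re_csqrt)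
  obtain k :: int where k: "cmod (sin (\<rho> / 2)) \<ge> min 1 (cmod (\<rho> / 2 - of_int k * pi)) * exp \<bar>Im (\<rho> / 2)\<bar> / 6"
    by (rule norm_sin_lower_bound)
  define d where "d = cmod (\<rho> / 2 - of_int k * pi)"
  have d0: "d \<ge> 0" by (simp add: d_def)
  have e2: "exp \<bar>Im (\<rho> / 2)\<bar> ^ 2 = exp \<bar>Im \<rho>\<bar>" by (simp flip: exp_double)
  have "(min 1 d * exp \<bar>Im (\<rho> / 2)\<bar> / 6)\<^sup>2 \<le> (cmod (sin (\<rho> / 2)))\<^sup>2"
    using k d0 by (intro power_mono) (auto simp: d_def)
  then have "(min 1 d)\<^sup>2 * exp \<bar>Im \<rho>\<bar> / 36 \<le> (cmod (sin (\<rho> / 2)))\<^sup>2"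
    using e2 by (simp add: power_mult_distrib power_divide)
  then have "cmod (1 - \<alpha>) * (2 * ((min 1 d)\<^sup>2 * exp \<bar>Im \<rho>\<bar> / 36)) \<le> cmod (1 - \<alpha>) * (2 * (cmod (sin (\<rho> / 2)))\<^sup>2)"
    by (intro mult_left_mono) auto
  also have "\<dots> = cmod ((1 - \<alpha>) * (cos \<rho> - 1))"
    unfolding cos_minus_one_half_angle by (simp add: norm_mult norm_power)
  also have "\<dots> \<le> 2 * Q * (1 + cmod \<alpha>) * exp \<bar>Im \<rho>\<bar> / cmod \<rho>"
    using charfun_minus_free[OF \<rho>(4,1)] z unfolding \<mu> by (simp add: norm_mult)
  finally have "cmod (1 - \<alpha>) * (2 * ((min 1 d)\<^sup>2 / 36)) * exp \<bar>Im \<rho>\<bar> \<le> 2 * Q * (1 + cmod \<alpha>) / cmod \<rho> * exp \<bar>Im \<rho>\<bar>"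
    by (simp add: mult_ac)
  then have "cmod (1 - \<alpha>) * (2 * ((min 1 d)\<^sup>2 / 36)) \<le> 2 * Q * (1 + cmod \<alpha>) / cmod \<rho>"
    by (rule mult_right_le_imp_le) auto
  then have md: "(min 1 d)\<^sup>2 \<le> localisation_const q \<alpha> / cmod \<rho>"
    using \<alpha> \<rho>(4) by (simp add: localisation_const_eq field_simps)
  also have "\<dots> < 1" using \<rho> by simp
  finally have "d < 1" by (cases "d < 1") auto
  then have dd: "d\<^sup>2 \<le> localisation_const q \<alpha> / cmod \<rho>" using md by simp
  define c where "c = 2 * pi * real_of_int k"
  have \<rho>c: "cmod (\<rho> - of_real c) = 2 * d"
  proof -
    have "\<rho> - of_real c = 2 * (\<rho> / 2 - of_int k * pi)" by (simp add: c_def)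
    then show ?thesis by (simp only: norm_mult d_def) simp
  qed
  have "\<bar>c\<bar> \<ge> cmod \<rho> - cmod (\<rho> - of_real c)"
    using norm_triangle_ineq2[of \<rho> "\<rho> - of_real c"] by simp
  then have c8: "\<bar>c\<bar> > 8" using \<rho>c \<open>d < 1\<close> \<rho>(3) by simp
  have "c \<ge> - 2"
    using abs_Re_le_cmod[of "\<rho> - of_real c"] \<rho>c \<open>d < 1\<close> Re by simp
  then have c8: "c > 8" using c8 by simp
  have k1: "k \<ge> 1"
  proof (rule ccontr)
    assume "\<not> k \<ge> 1"
    then have "real_of_int k \<le> 0" by simp
    then have "c \<le> 0" unfolding c_def by (simp add: mult_nonneg_nonpos)
    then show False using c8 by simp
  qed
  define n where "n = nat k"
  have n: "n \<ge> 1" "real n = real_of_int k" using k1 by (auto simp: n_def)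
  have cn: "c = 2 * pi * real n" by (simp add: c_def n)
  have rho_ge: "cmod \<rho> \<ge> 4 * real n"
  proof -
    have "cmod \<rho> \<ge> c - 2" using norm_triangle_ineq2[of "of_real c" "of_real c - \<rho>"] \<rho>c \<open>d < 1\<close> c8 by (simp add: norm_minus_commute)
    moreover have "c \<ge> 6 * real n" unfolding cn using pi_gt3 by (simp add: mult_right_mono)
    ultimately show ?thesis using n(1) by linarith
  qed
  have dn: "d \<le> sqrt (localisation_const q \<alpha>) / (2 * sqrt (real n))"
  proof -
    have "localisation_const q \<alpha> / cmod \<rho> \<le> localisation_const q \<alpha> / (4 * real n)"
      using rho_ge n(1) \<rho>(3) localisation_const_nonneg by (intro divide_left_mono mult_pos_pos) auto
    then have "d\<^sup>2 \<le> localisation_const q \<alpha> / (4 * real n)" using dd by simp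
    then have "sqrt (d\<^sup>2) \<le> sqrt (localisation_const q \<alpha> / (4 * real n))" by (rule real_sqrt_le_mono)
    then show ?thesis using d0 by (simp add: real_sqrt_divide real_sqrt_mult)
  qed
  have "\<mu> - of_real (c\<^sup>2) = (\<rho> - of_real c) * (\<rho> + of_real c)" unfolding \<mu> by (simp add: algebra_simps power2_eq_square)
  then have "cmod (\<mu> - of_real (c\<^sup>2)) = 2 * d * cmod (\<rho> + of_real c)" by (simp only: norm_mult \<rho>c)
  also have "cmod (\<rho> + of_real c) \<le> 16 * real n"
  proof -
    have "cmod (\<rho> + of_real c) \<le> cmod (\<rho> - of_real c) + cmod (2 * of_real c)"
      using norm_triangle_ineq[of "\<rho> - of_real c" "2 * of_real c"] by (simp add: add.commute)
    also have "\<dots> \<le> 2 + 2 * c" using \<rho>c \<open>d < 1\<close> c8 by (simp add: norm_mult)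
    also have "2 * c \<le> 2 * (6.4 * real n)" unfolding cn using pi_approx by (intro mult_left_mono mult_right_mono) auto
    finally show ?thesis using n(1) by linarith
  qed
  also have "2 * d * (16 * real n) \<le> 2 * (sqrt (localisation_const q \<alpha>) / (2 * sqrt (real n))) * (16 * real n)"
    using dn by (intro mult_right_mono mult_left_mono) auto
  also have "\<dots> = 16 * sqrt (localisation_const q \<alpha>) * sqrt (real n)"
    using n(1) real_sqrt_mult_self[of "real n"] by (simp add: field_simps)
  finally have "cmod (\<mu> - of_real (c\<^sup>2)) \<le> 16 * sqrt (localisation_const q \<alpha>) * sqrt (real n)" using d0 by (simp add: mult_left_mono)
  moreover have "cmod (\<rho> - of_real c) < 2" using \<rho>c \<open>d < 1\<close> by simp
  ultimately show ?thesis using n(1) unfolding \<rho>_def cn by blast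
qed

text \<open>On this circle \<open>\<bar>\<rho>/2\<bar> = \<pi>(N + 1/2)\<close> keeps at least the distance \<open>\<pi>/2 > 1\<close> from all zeros of the sine.\<close>

lemma free_dominates_on_circle:
  assumes N: "2 * pi * (real N + 1/2) \<ge> max (2 * Q) (localisation_const q \<alpha> + 1)" and \<mu>: "cmod \<mu> = (2 * pi * (real N + 1/2))\<^sup>2"
  shows "cmod (charfun q \<alpha> \<mu> - charfun (\<lambda>_. 0) \<alpha> \<mu>) < cmod (charfun (\<lambda>_. 0) \<alpha> \<mu>)"
proof -
  define \<rho> where "\<rho> = csqrt \<mu>"
  have \<mu>\<rho>: "\<mu> = \<rho>\<^sup>2" by (simp add: \<rho>_def)
  have "cmod \<rho> = sqrt (cmod \<mu>)" by (simp add: \<mu>\<rho> norm_power)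
  then have n\<rho>: "cmod \<rho> = 2 * pi * (real N + 1/2)" unfolding \<mu> by (simp add: abs_mult)
  have pos: "cmod \<rho> > 0" unfolding n\<rho> by (intro mult_pos_pos) auto
  obtain k :: int where k: "cmod (sin (\<rho> / 2)) \<ge> min 1 (cmod (\<rho> / 2 - of_int k * pi)) * exp \<bar>Im (\<rho> / 2)\<bar> / 6"
    by (rule norm_sin_lower_bound)
  have "cmod (\<rho> / 2 - of_int k * pi) \<ge> 1"
  proof -
    have "\<bar>cmod (\<rho> / 2) - cmod (of_int k * pi)\<bar> \<le> cmod (\<rho> / 2 - of_int k * pi)" by (rule norm_triangle_ineq3)
    moreover have "cmod (\<rho> / 2) = pi * (real N + 1/2)" using n\<rho> by (simp add: norm_divide)
    moreover have "cmod (of_int k * pi) = pi * real_of_int \<bar>k\<bar>" by (simp add: norm_mult)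
    moreover have "\<bar>pi * (real N + 1/2) - pi * real_of_int \<bar>k\<bar>\<bar> = pi * \<bar>real N + 1/2 - real_of_int \<bar>k\<bar>\<bar>"
      by (simp add: abs_mult flip: right_diff_distrib)
    moreover have "pi * \<bar>real N + 1/2 - real_of_int \<bar>k\<bar>\<bar> \<ge> pi * (1/2)"
    proof (intro mult_left_mono)
      have "\<bar>2 * int N + 1 - 2 * \<bar>k\<bar>\<bar> \<ge> 1" by presburger
      then have "\<bar>real_of_int (2 * int N + 1 - 2 * \<bar>k\<bar>)\<bar> \<ge> 1" by linarith
      then show "1/2 \<le> \<bar>real N + 1/2 - real_of_int \<bar>k\<bar>\<bar>" by (simp add: abs_if split: if_splits)
    qed simp
    ultimately show ?thesis using pi_gt3 by linarith
  qed
  then have "exp \<bar>Im (\<rho> / 2)\<bar> / 6 \<le> cmod (sin (\<rho> / 2))" using k by simp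
  then have "(exp \<bar>Im (\<rho> / 2)\<bar> / 6)\<^sup>2 \<le> (cmod (sin (\<rho> / 2)))\<^sup>2" by (intro power_mono) auto
  moreover have e2: "exp \<bar>Im (\<rho> / 2)\<bar> ^ 2 = exp \<bar>Im \<rho>\<bar>" by (simp flip: exp_double)
  ultimately have s: "exp \<bar>Im \<rho>\<bar> / 36 \<le> (cmod (sin (\<rho> / 2)))\<^sup>2" by (simp add: power_divide)
  have "2 * Q * (1 + cmod \<alpha>) = cmod (1 - \<alpha>) * localisation_const q \<alpha> / 18" using \<alpha> by (simp add: localisation_const_eq)
  then have "2 * Q * (1 + cmod \<alpha>) * exp \<bar>Im \<rho>\<bar> / cmod \<rho> = (cmod (1 - \<alpha>) * exp \<bar>Im \<rho>\<bar> / 18) * (localisation_const q \<alpha> / cmod \<rho>)"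
    by (simp only:) simp
  also have "\<dots> < (cmod (1 - \<alpha>) * exp \<bar>Im \<rho>\<bar> / 18) * 1"
    using pos N \<alpha> unfolding n\<rho>[symmetric] by (intro mult_strict_left_mono) auto
  also have "\<dots> = cmod (1 - \<alpha>) * (2 * (exp \<bar>Im \<rho>\<bar> / 36))" by simp
  also have "\<dots> \<le> cmod (1 - \<alpha>) * (2 * (cmod (sin (\<rho> / 2)))\<^sup>2)" using s by (intro mult_left_mono) auto
  also have "\<dots> = cmod (charfun (\<lambda>_. 0) \<alpha> \<mu>)"
    unfolding \<mu>\<rho> charfun_zero_potential cos_minus_one_half_angle by (simp add: norm_mult norm_power)
  finally show ?thesis
    using charfun_minus_free[of \<rho>] pos N unfolding n\<rho>[symmetric] \<mu>\<rho> charfun_zero_potential by simp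
qed

text \<open>By Rouche's theorem the total order is the one for \<open>q = 0\<close>, where the zeros in the disc are \<open>0\<close>, simple, and
  \<open>(2\<pi>n)\<^sup>2\<close> for \<open>1 \<le> n \<le> N\<close>, double.\<close>

lemma charfun_zeros_in_disc:
  assumes N: "2 * pi * (real N + 1/2) \<ge> max (2 * Q) (localisation_const q \<alpha> + 1)"
  defines "Z \<equiv> {\<mu>\<in>ball 0 ((2 * pi * (real N + 1/2))\<^sup>2). charfun q \<alpha> \<mu> = 0}"
  shows "finite Z" "(\<Sum>\<mu>\<in>Z. zorder (charfun q \<alpha>) \<mu>) = 2 * int N + 1"
proof -
  let ?r = "(2 * pi * (real N + 1/2))\<^sup>2" and ?g = "charfun (\<lambda>_. 0) \<alpha>"
  have r: "?r > 0" using pi_gt_zero by (simp add: add_nonneg_eq_0_iff)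
  have q0: "(\<lambda>_. 0::complex) absolutely_integrable_on {0..1::real}" by simp
  note R = rouche_circle[OF charfun_holomorphic[OF q, of \<alpha>] charfun_holomorphic[OF q0, of \<alpha>] r, of 0]
  have less: "cmod (charfun q \<alpha> z - ?g z) < cmod (?g z)" if "z \<in> sphere 0 ?r" for z
    using free_dominates_on_circle[OF N, of z] that by simp
  show "finite Z" unfolding Z_def by (rule R(2)[OF less])
  have zs: "{p\<in>ball 0 ?r. ?g p = 0} = (\<lambda>n::nat. free_eigenvalue n) ` {..N}" (is "?L = ?R")
  proof -
    have in_ball: "free_eigenvalue n \<in> ball 0 ?r \<longleftrightarrow> n \<le> N" for n
    proof -
      have "free_eigenvalue n \<in> ball 0 ?r \<longleftrightarrow> (2 * pi * real n)\<^sup>2 < ?r"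
        by (simp only: mem_ball dist_0_norm norm_of_real) simp
      also have "\<dots> \<longleftrightarrow> 2 * pi * real n < 2 * pi * (real N + 1/2)"
        by (intro iffI power_strict_mono) (auto dest: power_less_imp_less_base)
      also have "\<dots> \<longleftrightarrow> real n < real N + 1/2" using mult_less_cancel_left_pos[of "2 * pi"] pi_gt_zero by simp
      also have "\<dots> \<longleftrightarrow> n \<le> N" by linarith
      finally show ?thesis .
    qed
    show ?thesis using zeros_zero_potential[OF \<alpha>] in_ball by (auto simp del: of_real_power)
  qed
  have inj: "inj_on (\<lambda>n::nat. free_eigenvalue n) {..N}"
  proof (rule inj_onI)
    fix m n :: nat assume "complex_of_real ((2 * pi * real m)\<^sup>2) = free_eigenvalue n"
    then have "(2 * pi * real m)\<^sup>2 = (2 * pi * real n)\<^sup>2" by (simp only: of_real_eq_iff)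
    then have "2 * pi * real m = 2 * pi * real n" by (rule power2_eq_imp_eq) auto
    then show "m = n" by simp
  qed
  have "(\<Sum>\<mu>\<in>Z. zorder (charfun q \<alpha>) \<mu>) = (\<Sum>p\<in>?R. zorder ?g p)"
    unfolding Z_def zs[symmetric] by (rule R(1)[OF less])
  also have "\<dots> = (\<Sum>n\<le>N. if n = 0 then 1 else 2)"
    by (subst sum.reindex[OF inj]) (simp only: o_def zorder_zero_potential[OF \<alpha>])
  also have "\<dots> = 2 * int N + 1" by (induction N) auto
  finally show "(\<Sum>\<mu>\<in>Z. zorder (charfun q \<alpha>) \<mu>) = 2 * int N + 1" .
qed

end

section \<open>The characteristic function near a free eigenvalue\<close>

lemma sin_lipschitz_strip:
  fixes w w' :: complex
  assumes "\<bar>Im w\<bar> \<le> 1" "\<bar>Im w'\<bar> \<le> 1"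
  shows "cmod (sin w - sin w') \<le> 3 * cmod (w - w')"
proof (rule field_differentiable_bound[where S = "{z. Im z \<le> 1} \<inter> {z. Im z \<ge> -1}" and f' = cos])
  show "convex ({z. Im z \<le> 1} \<inter> {z. Im z \<ge> -1})"
    by (intro convex_Int convex_halfspace_Im_le convex_halfspace_Im_ge)
  fix z assume "z \<in> {z. Im z \<le> 1} \<inter> {z. Im z \<ge> -1}"
  then have "exp \<bar>Im z\<bar> \<le> exp 1" by auto
  then show "cmod (cos z) \<le> 3" using norm_sin_cos_le_exp(2)[of z] exp_le by linarith
qed (use assms in \<open>auto intro!: derivative_eq_intros\<close>)

text \<open>The leading term of \<open>(\<mu> - (2\<pi>n)\<^sup>2)\<^sup>2\<close> for the two zeros \<open>\<mu>\<close> near \<open>(2\<pi>n)\<^sup>2\<close>.\<close>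

definition splitting_square :: "(real \<Rightarrow> complex) \<Rightarrow> complex \<Rightarrow> nat \<Rightarrow> complex" where
  "splitting_square q \<alpha> n = gamma3 \<alpha> / 2 * of_nat n * sine_coeff q (2 * n)"

text \<open>Both square roots have nonnegative real part, so the factor \<open>\<surd>\<mu> + 2\<pi>n\<close> of \<open>\<mu> - (2\<pi>n)\<^sup>2\<close> has modulus at least
  \<open>2\<pi>n\<close>.\<close>

lemma csqrt_near_free_eigenvalue:
  assumes n: "n \<ge> 1" and \<mu>: "cmod (\<mu> - free_eigenvalue n) \<le> R * sqrt (real n)" and R: "R\<^sup>2 \<le> real n"
  defines "\<delta> \<equiv> csqrt \<mu> - of_real (2 * pi * real n)"
  shows "\<mu> - free_eigenvalue n = \<delta> * (of_real (4 * pi * real n) + \<delta>)"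
    and "cmod \<delta> \<le> cmod (\<mu> - free_eigenvalue n) / (6 * real n)"
    and "cmod \<delta> \<le> 1/6" "cmod \<delta> * sqrt (real n) \<le> R" "cmod (csqrt \<mu>) \<ge> real n"
proof -
  define a where "a = 2 * pi * real n"
  have a: "a \<ge> 6 * real n" unfolding a_def using pi_gt3 by (intro mult_right_mono) auto
  have \<rho>: "csqrt \<mu> = of_real a + \<delta>" by (simp add: \<delta>_def a_def)
  have \<mu>': "\<mu> = (of_real a + \<delta>)\<^sup>2" by (simp flip: \<rho>)
  have eq: "\<mu> - of_real (a\<^sup>2) = \<delta> * (of_real (2 * a) + \<delta>)"
    unfolding \<mu>' by (simp add: power2_eq_square algebra_simps)
  then show "\<mu> - free_eigenvalue n = \<delta> * (of_real (4 * pi * real n) + \<delta>)" by (simp add: a_def)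
  have "Re (csqrt \<mu>) \<ge> 0" by (rule Re_csqrt)
  then have "Re (of_real (2 * a) + \<delta>) \<ge> a" by (simp add: \<rho>)
  then have "cmod (of_real (2 * a) + \<delta>) \<ge> 6 * real n"
    using complex_Re_le_cmod[of "of_real (2 * a) + \<delta>"] a by linarith
  then have "cmod \<delta> * (6 * real n) \<le> cmod (\<mu> - of_real (a\<^sup>2))"
    unfolding eq norm_mult by (intro mult_left_mono) auto
  then show d: "cmod \<delta> \<le> cmod (\<mu> - free_eigenvalue n) / (6 * real n)"
    using n by (simp add: a_def field_simps)
  have sn: "sqrt (real n) > 0" "sqrt (real n) * sqrt (real n) = real n" using n by auto
  have "cmod \<delta> \<le> R * sqrt (real n) / (6 * real n)"
    by (rule order_trans[OF d]) (use \<mu> in \<open>simp add: divide_right_mono\<close>)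
  also have "R * sqrt (real n) / (6 * real n) = R / (6 * sqrt (real n))"
    using sn by (simp add: field_simps)
  finally have dR: "cmod \<delta> \<le> R / (6 * sqrt (real n))" .
  have "0 \<le> R * sqrt (real n)" using \<mu> norm_ge_zero order_trans by blast
  then have R0: "R \<ge> 0" using sn by (simp add: zero_le_mult_iff)
  show dd: "cmod \<delta> * sqrt (real n) \<le> R" using dR sn R0 by (simp add: field_simps)
  have "R \<le> sqrt (real n)" using R R0 by (intro real_le_rsqrt) auto
  then have "R / (6 * sqrt (real n)) \<le> 1 / 6" using sn by (simp add: field_simps)
  then show d16: "cmod \<delta> \<le> 1/6" using dR by simp
  show "cmod (csqrt \<mu>) \<ge> real n"
    unfolding \<rho> using norm_triangle_ineq2[of "of_real a" "- \<delta>"] a d16 n by simp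
qed

context
  fixes q :: "real \<Rightarrow> complex" and \<alpha> :: complex and Q :: real
  assumes q: "q absolutely_integrable_on {0..1}" and q0: "integral {0..1} q = 0" and \<alpha>: "\<alpha> \<noteq> 1"
  defines "Q \<equiv> integral {0..1} (\<lambda>t. cmod (q t))"
begin

text \<open>The products of sines and cosines in the second order asymptotics are halves of \<open>sin \<rho> \<plusminus> sin \<rho>(1 - 2t)\<close>. The terms
  with \<open>sin \<rho>\<close> drop out because \<open>q\<close> has mean value zero.\<close>

lemma charfun_second_order:
  assumes \<rho>: "\<rho> \<noteq> 0" "2 * Q \<le> cmod \<rho>"
  shows "cmod (charfun q \<alpha> (\<rho>\<^sup>2) - ((1 - \<alpha>) * (cos \<rho> - 1)
      - (1 + \<alpha>) / (2 * \<rho>) * integral {0..1} (\<lambda>t. q t * sin (\<rho> * of_real (1 - 2 * t)))))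
    \<le> 2 * Q\<^sup>2 * (1 + cmod \<alpha>) * exp \<bar>Im \<rho>\<bar> / (cmod \<rho>)\<^sup>2"
proof -
  let ?J = "integral {0..1} (\<lambda>t. q t * sin (\<rho> * of_real (1 - 2 * t)))"
  let ?E = "2 * Q\<^sup>2 * exp \<bar>Im \<rho>\<bar> / (cmod \<rho>)\<^sup>2"
  have int: "(\<lambda>t. q t * h t) integrable_on {0..1}" if "continuous_on {0..1} h" for h
    using absolutely_integrable_norm_integrable(1)[OF absolutely_integrable_times_continuous[OF q that], of 1] by simp
  have qi: "q integrable_on {0..1}" using absolutely_integrable_norm_integrable(1)[OF q, of 1] by simp
  have cS: "continuous_on {0..1} (\<lambda>t. sin (\<rho> * complex_of_real (1 - 2 * t)))" by (intro continuous_intros)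
  have trig1: "sin (\<rho> * of_real (1 - t)) * cos (\<rho> * of_real t) = (sin \<rho> + sin (\<rho> * of_real (1 - 2 * t))) / 2"
    and trig2: "cos (\<rho> * of_real (1 - t)) * sin (\<rho> * of_real t) = (sin \<rho> - sin (\<rho> * of_real (1 - 2 * t))) / 2" for t :: real
  proof -
    have a: "\<rho> * of_real (1 - t) + \<rho> * of_real t = \<rho>" "\<rho> * of_real (1 - t) - \<rho> * of_real t = \<rho> * of_real (1 - 2 * t)"
      by (simp_all add: algebra_simps)
    show "sin (\<rho> * of_real (1 - t)) * cos (\<rho> * of_real t) = (sin \<rho> + sin (\<rho> * of_real (1 - 2 * t))) / 2"
      by (simp only: sin_times_cos a)
    show "cos (\<rho> * of_real (1 - t)) * sin (\<rho> * of_real t) = (sin \<rho> - sin (\<rho> * of_real (1 - 2 * t))) / 2"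
      by (simp only: cos_times_sin a)
  qed
  have half: "integral {0..1} (\<lambda>t. q t * ((sin \<rho> + \<sigma> * sin (\<rho> * of_real (1 - 2 * t))) / 2)) = \<sigma> * ?J / 2" for \<sigma>
  proof -
    have "integral {0..1} (\<lambda>t. q t * ((sin \<rho> + \<sigma> * sin (\<rho> * of_real (1 - 2 * t))) / 2)) =
        integral {0..1} (\<lambda>t. (sin \<rho> / 2) * q t + (\<sigma> / 2) * (q t * sin (\<rho> * of_real (1 - 2 * t))))"
      by (rule arg_cong[of _ _ "integral {0..1}"]) (simp add: fun_eq_iff field_simps)
    also have "\<dots> = integral {0..1} (\<lambda>t. (sin \<rho> / 2) * q t) + integral {0..1} (\<lambda>t. (\<sigma> / 2) * (q t * sin (\<rho> * of_real (1 - 2 * t))))"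
      by (intro integral_add integrable_on_mult_right qi int cS)
    finally show ?thesis using q0 by simp
  qed
  have "cmod (fst (fund q (\<rho>\<^sup>2) 1 0) 1 - (cos \<rho> + ?J / 2 / \<rho>)) \<le> ?E"
    using ivp_asymptotics(4)[OF q fund(1)[OF q, of "\<rho>\<^sup>2" 1 0] meta_eq_to_obj_eq[OF Q_def] \<rho> refl, of 1]
      half[of 1] by (simp only: fund[OF q] trig1 mult_1_left mult_zero_left add_0_right div_by_1 divide_eq_0_iff
        norm_zero norm_one zero_le_one order_refl atLeastAtMost_iff simp_thms of_real_1 mult_1_right diff_zero div_0 add.right_neutral)
  moreover have "cmod (snd (fund q (\<rho>\<^sup>2) 0 1) 1 - (cos \<rho> - ?J / 2 / \<rho>)) \<le> ?E"
  proof -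
    have "integral {0..1} (\<lambda>t. q t * (cos (\<rho> * of_real (1 - t)) * (0 * cos (\<rho> * of_real t) + 1 / \<rho> * sin (\<rho> * of_real t)))) =
        integral {0..1} (\<lambda>t. (1 / \<rho>) * (q t * ((sin \<rho> + (-1) * sin (\<rho> * of_real (1 - 2 * t))) / 2)))"
    proof -
      have t: "(sin \<rho> + (-1) * sin (\<rho> * of_real (1 - 2 * t))) / 2 = cos (\<rho> * of_real (1 - t)) * sin (\<rho> * of_real t)" for t :: real
        unfolding trig2 by simp
      show ?thesis unfolding t by (simp add: mult_ac del: of_real_diff)
    qed
    also have "\<dots> = - ?J / 2 / \<rho>" unfolding integral_mult_right half by simp
    finally have I: "integral {0..1} (\<lambda>t. q t * (cos (\<rho> * of_real (1 - t)) * (0 * cos (\<rho> * of_real t) + 1 / \<rho> * sin (\<rho> * of_real t)))) = - ?J / 2 / \<rho>" .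
    show ?thesis
      using ivp_asymptotics(5)[OF q fund(1)[OF q, of "\<rho>\<^sup>2" 0 1] meta_eq_to_obj_eq[OF Q_def] \<rho> refl, of 1]
      unfolding fund[OF q] I by (simp add: norm_divide power2_eq_square)
  qed
  moreover have "charfun q \<alpha> (\<rho>\<^sup>2) - ((1 - \<alpha>) * (cos \<rho> - 1) - (1 + \<alpha>) / (2 * \<rho>) * ?J) =
     (snd (fund q (\<rho>\<^sup>2) 0 1) 1 - (cos \<rho> - ?J / 2 / \<rho>)) - \<alpha> * (fst (fund q (\<rho>\<^sup>2) 1 0) 1 - (cos \<rho> + ?J / 2 / \<rho>))"
    using \<rho>(1) by (simp add: charfun_def field_simps)
  ultimately have "cmod (charfun q \<alpha> (\<rho>\<^sup>2) - ((1 - \<alpha>) * (cos \<rho> - 1) - (1 + \<alpha>) / (2 * \<rho>) * ?J)) \<le> ?E + cmod \<alpha> * ?E"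
    by (simp only:) (rule norm_triangle_le_diff, unfold norm_mult, intro add_mono mult_left_mono, auto)
  then show ?thesis by (simp add: algebra_simps add_divide_distrib)
qed

text \<open>Put \<open>\<rho> = 2\<pi>n + \<delta>\<close>, so that \<open>\<bar>\<delta>\<bar> = O(n\<^sup>-\<^sup>1\<^sup>/\<^sup>2)\<close>. Then \<open>cos \<rho> - 1 = - \<delta>\<^sup>2/2 + O(\<delta>\<^sup>4)\<close>, where
  \<open>16\<pi>\<^sup>2n\<^sup>2\<delta>\<^sup>2\<close> is \<open>(\<mu> - (2\<pi>n)\<^sup>2)\<^sup>2\<close> up to \<open>O(1)\<close>, and the integral against \<open>sin \<rho>(1 - 2t)\<close> is \<open>- s\<^sub>2\<^sub>n + O(\<delta>)\<close> since
  \<open>sin 2\<pi>n(1 - 2t) = - sin 4\<pi>n t\<close>. The remainder \<open>O(\<rho>\<^sup>-\<^sup>2)\<close> of the second order formula is \<open>O(1)\<close> after multiplication by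
  \<open>n\<^sup>2\<close>.\<close>

lemma charfun_near_free_eigenvalue:
  assumes R: "R \<ge> 0"
  shows "\<exists>C\<ge>0. \<exists>N. \<forall>n\<ge>N. \<forall>\<mu>. cmod (\<mu> - free_eigenvalue n) \<le> R * sqrt (real n) \<longrightarrow>
    cmod (- 32 * of_real pi ^ 2 * of_nat n ^ 2 / (1 - \<alpha>) * charfun q \<alpha> \<mu>
      - ((\<mu> - free_eigenvalue n)\<^sup>2 - splitting_square q \<alpha> n)) \<le> C * (1 + cmod (\<mu> - free_eigenvalue n))"
proof -
  define N where "N = nat \<lceil>max 1 (max (R\<^sup>2) (2 * Q))\<rceil>"
  define b where "b = cmod ((1 + \<alpha>) / (1 - \<alpha>))"
  define C1 where "C1 = 32 * pi\<^sup>2 / cmod (1 - \<alpha>) * (6 * Q\<^sup>2 * (1 + cmod \<alpha>))"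
  define C where "C = C1 + 8 * pi * b * (3 * Q) + 8 * pi * b * (3 * Q) + 16 * pi\<^sup>2 * R ^ 4 + 8 * pi * R ^ 3 + R ^ 4"
  have Q0: "Q \<ge> 0" unfolding Q_def using absolutely_integrable_norm_integrable(2)[OF q, of 1] by (intro integral_nonneg) auto
  have b0: "b \<ge> 0" by (simp add: b_def)
  have C10: "C1 \<ge> 0" unfolding C1_def using Q0 by (intro mult_nonneg_nonneg divide_nonneg_nonneg) auto
  have C0: "C \<ge> 0" unfolding C_def using C10 b0 Q0 R by (intro add_nonneg_nonneg mult_nonneg_nonneg) auto
  show ?thesis
  proof (rule exI[of _ C], rule conjI[OF C0], rule exI[of _ N], intro allI impI)
    fix n \<mu> assume n: "n \<ge> N" and \<mu>: "cmod (\<mu> - free_eigenvalue n) \<le> R * sqrt (real n)"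
    have nb: "real n \<ge> max 1 (max (R\<^sup>2) (2 * Q))"
      using n unfolding N_def by linarith
    then have n1: "n \<ge> 1" and nR: "R\<^sup>2 \<le> real n" and nQ: "2 * Q \<le> real n" by auto
    define z where "z = \<mu> - free_eigenvalue n"
    define a where "a = 2 * pi * real n"
    define \<rho> where "\<rho> = csqrt \<mu>"
    define \<delta> where "\<delta> = \<rho> - of_real a"
    note near = csqrt_near_free_eigenvalue[OF n1 \<mu> nR, folded \<rho>_def a_def z_def, folded \<delta>_def]
    have z: "z = \<delta> * (of_real (2 * a) + \<delta>)" using near(1) by (simp add: a_def)
    have d: "cmod \<delta> \<le> cmod z / (6 * real n)" "cmod \<delta> \<le> 1/6" "cmod \<delta> * sqrt (real n) \<le> R" "cmod \<rho> \<ge> real n"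
      using near by (auto simp: a_def z_def)
    have \<rho>0: "\<rho> \<noteq> 0" using d(4) n1 by auto
    have \<rho>a: "\<rho> = of_real a + \<delta>" by (simp add: \<delta>_def)
    have Im: "\<bar>Im \<rho>\<bar> \<le> 1" using abs_Im_le_cmod[of \<delta>] d(2) by (simp add: \<rho>a)
    have e3: "exp \<bar>Im \<rho>\<bar> \<le> 3" using exp_le Im by (meson exp_le_cancel_iff order_trans)
    have \<mu>\<rho>: "\<mu> = \<rho>\<^sup>2" by (simp add: \<rho>_def)
    let ?J = "integral {0..1} (\<lambda>t. q t * sin (\<rho> * of_real (1 - 2 * t)))" and ?s = "sine_coeff q (2 * n)"
    define err where "err = charfun q \<alpha> \<mu> - ((1 - \<alpha>) * (cos \<rho> - 1) - (1 + \<alpha>) / (2 * \<rho>) * ?J)"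
    have err: "cmod err \<le> 6 * Q\<^sup>2 * (1 + cmod \<alpha>) / (real n)\<^sup>2"
    proof -
      have "cmod err \<le> 2 * Q\<^sup>2 * (1 + cmod \<alpha>) * exp \<bar>Im \<rho>\<bar> / (cmod \<rho>)\<^sup>2"
        unfolding err_def \<mu>\<rho> using nQ d(4) by (intro charfun_second_order \<rho>0) auto
      also have "\<dots> \<le> 2 * Q\<^sup>2 * (1 + cmod \<alpha>) * 3 / (real n)\<^sup>2"
        using d(4) n1 e3 by (intro frac_le mult_left_mono power_mono mult_nonneg_nonneg) auto
      finally show ?thesis by simp
    qed
    note sinbound = sin_lipschitz_strip
    have Js: "cmod (?J + ?s) \<le> 3 * Q * cmod \<delta>" and J: "cmod ?J \<le> 3 * Q"
    proof -
      have int: "(\<lambda>t. q t * h t) integrable_on {0..1}" if "continuous_on {0..1} h" for h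
        using absolutely_integrable_norm_integrable(1)[OF absolutely_integrable_times_continuous[OF q that], of 1] by simp
      have c1: "continuous_on {0..1} (\<lambda>t. sin (\<rho> * complex_of_real (1 - 2 * t)))"
        and c2: "continuous_on {0..1} (\<lambda>t. complex_of_real (sin (2 * pi * real (2 * n) * t)))" by (intro continuous_intros)+
      have "?J + ?s = integral {0..1} (\<lambda>t. q t * (sin (\<rho> * of_real (1 - 2 * t)) + of_real (sin (2 * pi * real (2 * n) * t))))"
        unfolding sine_coeff_def distrib_left by (rule integral_add[symmetric]) (intro int c1 c2)+
      also have "cmod \<dots> \<le> Q * (3 * cmod \<delta>)"
        unfolding Q_def
      proof (rule norm_integral_mult_le[OF q _ ])
        fix t :: real assume t: "t \<in> {0..1}"
        have "of_real (sin (2 * pi * real (2 * n) * t)) = - sin (of_real a * of_real (1 - 2 * t) :: complex)"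
        proof -
          have "sin (a * (1 - 2 * t)) = sin (2 * pi * real n - 2 * pi * real (2 * n) * t)" by (simp add: a_def algebra_simps)
          also have "\<dots> = - sin (2 * pi * real (2 * n) * t)"
            unfolding sin_diff using sin_npi2[of "2 * n"] cos_npi2[of "2 * n"] by (simp add: mult_ac)
          finally have "sin (2 * pi * real (2 * n) * t) = - sin (a * (1 - 2 * t))" by simp
          then show ?thesis by (simp only: of_real_minus of_real_mult[symmetric] sin_of_real)
        qed
        then have "cmod (sin (\<rho> * of_real (1 - 2 * t)) + of_real (sin (2 * pi * real (2 * n) * t)))
            = cmod (sin (\<rho> * of_real (1 - 2 * t)) - sin (of_real a * of_real (1 - 2 * t)))" by simp
        also have "\<dots> \<le> 3 * cmod (\<rho> * of_real (1 - 2 * t) - of_real a * of_real (1 - 2 * t))"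
        proof (rule sinbound)
          have "\<bar>Im \<rho>\<bar> * \<bar>1 - 2 * t\<bar> \<le> 1 * 1" using Im t by (intro mult_mono) auto
          then show "\<bar>Im (\<rho> * of_real (1 - 2 * t))\<bar> \<le> 1" by (simp add: abs_mult)
        qed simp
        also have "\<dots> = 3 * (cmod \<delta> * \<bar>1 - 2 * t\<bar>)"
          by (simp only: left_diff_distrib[symmetric] \<delta>_def[symmetric] norm_mult norm_of_real)
        also have "\<dots> \<le> 3 * (cmod \<delta> * 1)" using t by (intro mult_left_mono) auto
        finally show "cmod (sin (\<rho> * of_real (1 - 2 * t)) + of_real (sin (2 * pi * real (2 * n) * t))) \<le> 3 * cmod \<delta>" by simp
      qed (use c1 c2 in \<open>auto intro: continuous_on_add\<close>)
      finally show "cmod (?J + ?s) \<le> 3 * Q * cmod \<delta>" by (simp add: mult_ac)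
      have "cmod ?J \<le> Q * 3"
        unfolding Q_def
      proof (rule norm_integral_mult_le[OF q c1])
        fix t :: real assume t: "t \<in> {0..1}"
        have "\<bar>Im \<rho>\<bar> * \<bar>1 - 2 * t\<bar> \<le> 1 * 1" using Im t by (intro mult_mono) auto
        then have "exp \<bar>Im (\<rho> * of_real (1 - 2 * t))\<bar> \<le> exp 1" by (simp add: abs_mult)
        then show "cmod (sin (\<rho> * of_real (1 - 2 * t))) \<le> 3"
          using norm_sin_cos_le_exp(1)[of "\<rho> * of_real (1 - 2 * t)"] exp_le by linarith
      qed simp
      then show "cmod ?J \<le> 3 * Q" by simp
    qed
    have cosd: "cmod (cos \<rho> - 1 + \<delta>\<^sup>2 / 2) \<le> cmod \<delta> ^ 4 / 2"
    proof -
      have "cos \<rho> = cos \<delta>"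
      proof -
        have "cos \<rho> = cos (of_real a) * cos \<delta> - sin (of_real a) * sin \<delta>" by (simp add: \<rho>a cos_add)
        moreover have "cos a = 1" "sin a = 0" using sin_npi2[of "2 * n"] cos_npi2[of "2 * n"] by (simp_all add: a_def mult_ac)
        ultimately show ?thesis by (simp add: cos_of_real sin_of_real)
      qed
      then have eq: "cos \<rho> - 1 + \<delta>\<^sup>2 / 2 = cos \<delta> - (1 - \<delta>\<^sup>2 / 2)" by simp
      have sum: "(\<Sum>k\<le>3. complex_of_real (cos_coeff k) * \<delta> ^ k) = 1 - \<delta>\<^sup>2 / 2"
        unfolding numeral_3_eq_3 by (simp add: cos_coeff_def power2_eq_square)
      have "cmod (cos \<delta> - (1 - \<delta>\<^sup>2 / 2)) \<le> exp \<bar>Im \<delta>\<bar> * cmod \<delta> ^ 4 / 6"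
        using Taylor_cos[of \<delta> 3] unfolding sum by (simp add: fact_numeral)
      also have "\<dots> \<le> 3 * cmod \<delta> ^ 4 / 6"
        using e3 by (intro divide_right_mono mult_right_mono) (auto simp: \<rho>a)
      finally show ?thesis unfolding eq by simp
    qed
    define P :: complex where "P = 32 * of_real pi ^ 2 * of_nat n ^ 2"
    have P: "P = 8 * of_real a ^ 2" by (simp add: P_def a_def power_mult_distrib)
    have a0: "a \<noteq> 0" using n1 by (simp add: a_def)
    have Es: "splitting_square q \<alpha> n = 8 * of_real pi * of_nat n * ((1 + \<alpha>) / (1 - \<alpha>)) * ?s"
    proof -
      have "gamma3 \<alpha> / 2 = 8 * of_real pi * ((1 + \<alpha>) / (1 - \<alpha>))"
        using \<alpha> by (simp add: gamma3_def field_simps)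
      then show ?thesis unfolding splitting_square_def by (simp only: mult_ac)
    qed
    define T1 where "T1 = - P / (1 - \<alpha>) * err"
    define T2 where "T2 = - 8 * of_real pi * of_nat n * ((1 + \<alpha>) / (1 - \<alpha>)) * (\<delta> / \<rho>) * ?J"
    define T3 where "T3 = 8 * of_real pi * of_nat n * ((1 + \<alpha>) / (1 - \<alpha>)) * (?J + ?s)"
    define T4 where "T4 = - P * (cos \<rho> - 1 + \<delta>\<^sup>2 / 2)"
    define T5 where "T5 = - (8 * of_real pi * of_nat n * \<delta> ^ 3 + \<delta> ^ 4)"
    \<comment> \<open>\<open>T1\<close> is the remainder of the second order formula, \<open>T2\<close> comes from replacing \<open>1/\<rho>\<close> by \<open>1/(2\<pi>n)\<close>, \<open>T3\<close> from the
      integral, \<open>T4\<close> from the cosine and \<open>T5\<close> from \<open>(\<rho> + 2\<pi>n)\<^sup>2\<close> instead of \<open>(4\<pi>n)\<^sup>2\<close>.\<close>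
    have decomp: "- P / (1 - \<alpha>) * charfun q \<alpha> \<mu> - (z\<^sup>2 - splitting_square q \<alpha> n) = T1 + T2 + T3 + T4 + T5"
    proof -
      have \<alpha>1: "1 - \<alpha> \<noteq> 0" using \<alpha> by simp
      define \<beta> where "\<beta> = (1 + \<alpha>) / (1 - \<alpha>)"
      have ch: "charfun q \<alpha> \<mu> = err + (1 - \<alpha>) * (cos \<rho> - 1) - (1 + \<alpha>) / (2 * \<rho>) * ?J" by (simp add: err_def)
      have 1: "- P / (1 - \<alpha>) * charfun q \<alpha> \<mu> = T1 - P * (cos \<rho> - 1) + P * \<beta> / (2 * \<rho>) * ?J"
      proof -
        have "- P / u * (e + u * X - y / r * J) = - P / u * e - P * X + P * (y / u) / r * J"
          if "u \<noteq> 0" "r \<noteq> 0" for u e X y r J :: complex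
          using that by (simp add: field_simps)
        from this[OF \<alpha>1, of "2 * \<rho>"] show ?thesis unfolding ch T1_def \<beta>_def using \<rho>0 by simp
      qed
      have 2: "P * \<beta> / (2 * \<rho>) * ?J = 8 * of_real pi * of_nat n * \<beta> * ?J + T2"
      proof -
        have an: "of_real a = 2 * of_real pi * (of_nat n :: complex)" by (simp add: a_def)
        have "P / (2 * \<rho>) = 4 * of_real a * (of_real a / \<rho>)" by (simp add: P power2_eq_square)
        also have "of_real a / \<rho> = 1 - \<delta> / \<rho>" using \<rho>0 by (simp add: \<delta>_def diff_divide_distrib)
        finally have "P / (2 * \<rho>) = 8 * of_real pi * of_nat n * (1 - \<delta> / \<rho>)" unfolding an by simp
        moreover have "P * \<beta> / (2 * \<rho>) * ?J = (P / (2 * \<rho>)) * \<beta> * ?J" by simp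
        ultimately have "P * \<beta> / (2 * \<rho>) * ?J = 8 * of_real pi * of_nat n * (1 - \<delta> / \<rho>) * \<beta> * ?J" by (simp only:)
        then show ?thesis by (simp add: T2_def \<beta>_def[symmetric] algebra_simps)
      qed
      have 3: "z\<^sup>2 = P * \<delta>\<^sup>2 / 2 - T5"
        unfolding z T5_def P by (simp add: a_def power2_eq_square power3_eq_cube algebra_simps eval_nat_numeral)
      show ?thesis unfolding 1 2 3 Es T3_def T4_def \<beta>_def[symmetric] by (simp add: algebra_simps)
    qed
    have nP: "cmod P = 32 * pi\<^sup>2 * (real n)\<^sup>2" by (simp add: P_def norm_mult norm_power)
    have T1: "cmod T1 \<le> C1"
    proof -
      have "cmod T1 = 32 * pi\<^sup>2 * (real n)\<^sup>2 / cmod (1 - \<alpha>) * cmod err" by (simp add: T1_def norm_mult norm_divide nP)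
      also have "\<dots> \<le> 32 * pi\<^sup>2 * (real n)\<^sup>2 / cmod (1 - \<alpha>) * (6 * Q\<^sup>2 * (1 + cmod \<alpha>) / (real n)\<^sup>2)"
        by (intro mult_left_mono err divide_nonneg_nonneg) auto
      also have "\<dots> = C1" using n1 by (simp add: C1_def)
      finally show ?thesis .
    qed
    have T2: "cmod T2 \<le> 8 * pi * b * (3 * Q)"
    proof -
      have "real n * (cmod \<delta> / cmod \<rho>) \<le> 1"
      proof -
        have "real n * cmod \<delta> \<le> cmod \<rho> * 1" using d(2,4) by (intro mult_mono) auto
        then show ?thesis using \<rho>0 by (simp add: field_simps)
      qed
      then have "8 * pi * b * (real n * (cmod \<delta> / cmod \<rho>)) * cmod ?J \<le> 8 * pi * b * 1 * (3 * Q)"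
        using J b0 by (intro mult_mono mult_left_mono) auto
      moreover have "cmod T2 = 8 * pi * b * (real n * (cmod \<delta> / cmod \<rho>)) * cmod ?J"
        unfolding T2_def norm_mult b_def[symmetric] norm_divide[of \<delta> \<rho>] by simp
      ultimately show ?thesis by simp
    qed
    have nd: "real n * cmod \<delta> \<le> cmod z"
    proof -
      have "6 * (real n * cmod \<delta>) \<le> cmod z" using d(1) n1 by (simp add: field_simps)
      moreover have "0 \<le> real n * cmod \<delta>" by simp
      ultimately show ?thesis by linarith
    qed
    have T3: "cmod T3 \<le> 8 * pi * b * (3 * Q) * cmod z"
    proof -
      have "cmod T3 = 8 * pi * b * (real n * cmod (?J + ?s))" 
        unfolding T3_def norm_mult b_def[symmetric] by simp
      also have "\<dots> \<le> 8 * pi * b * (real n * (3 * Q * cmod \<delta>))"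
        using b0 by (intro mult_left_mono Js) auto
      also have "\<dots> = 8 * pi * b * (3 * Q) * (real n * cmod \<delta>)" by (simp add: mult_ac)
      also have "\<dots> \<le> 8 * pi * b * (3 * Q) * cmod z" using b0 Q0 by (intro mult_left_mono nd mult_nonneg_nonneg) auto
      finally show ?thesis .
    qed
    have n2: "real n * cmod \<delta> ^ 2 \<le> R\<^sup>2"
    proof -
      have "(cmod \<delta> * sqrt (real n))\<^sup>2 \<le> R\<^sup>2" using d(3) by (intro power_mono) auto
      then show ?thesis by (simp add: power_mult_distrib mult.commute)
    qed
    have n4: "(real n)\<^sup>2 * cmod \<delta> ^ 4 \<le> R ^ 4"
    proof -
      have "(real n * cmod \<delta> ^ 2)\<^sup>2 \<le> (R\<^sup>2)\<^sup>2" by (intro power_mono n2) auto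
      then show ?thesis by (simp add: power_mult_distrib flip: power_mult)
    qed
    have T4: "cmod T4 \<le> 16 * pi\<^sup>2 * R ^ 4"
    proof -
      have "cmod T4 = 32 * pi\<^sup>2 * (real n)\<^sup>2 * cmod (cos \<rho> - 1 + \<delta>\<^sup>2 / 2)" by (simp add: T4_def norm_mult nP)
      also have "\<dots> \<le> 32 * pi\<^sup>2 * (real n)\<^sup>2 * (cmod \<delta> ^ 4 / 2)" by (intro mult_left_mono cosd) auto
      also have "\<dots> = 16 * pi\<^sup>2 * ((real n)\<^sup>2 * cmod \<delta> ^ 4)" by simp
      also have "\<dots> \<le> 16 * pi\<^sup>2 * R ^ 4" by (intro mult_left_mono n4) auto
      finally show ?thesis .
    qed
    have T5: "cmod T5 \<le> 8 * pi * R ^ 3 + R ^ 4"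
    proof -
      have dR: "cmod \<delta> \<le> R"
      proof -
        have "cmod \<delta> * 1 \<le> cmod \<delta> * sqrt (real n)" using n1 by (intro mult_left_mono) auto
        then show ?thesis using d(3) by simp
      qed
      have "cmod T5 \<le> 8 * pi * real n * cmod \<delta> ^ 3 + cmod \<delta> ^ 4"
        unfolding T5_def norm_minus_cancel by (rule norm_triangle_le) (simp add: norm_mult norm_power)
      also have "8 * pi * real n * cmod \<delta> ^ 3 = 8 * pi * (real n * cmod \<delta> ^ 2 * cmod \<delta>)" by (simp add: eval_nat_numeral)
      also have "8 * pi * (real n * cmod \<delta> ^ 2 * cmod \<delta>) + cmod \<delta> ^ 4 \<le> 8 * pi * (R\<^sup>2 * R) + R ^ 4"
        using n2 dR by (intro add_mono mult_left_mono mult_mono power_mono) auto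
      finally show ?thesis by (simp add: eval_nat_numeral)
    qed
    have "cmod (T1 + T2 + T3 + T4 + T5) \<le> cmod T1 + cmod T2 + cmod T3 + cmod T4 + cmod T5"
      by (intro norm_triangle_le add_mono order_refl)
    also have "\<dots> \<le> C1 + 8 * pi * b * (3 * Q) + 8 * pi * b * (3 * Q) * cmod z + 16 * pi\<^sup>2 * R ^ 4 + (8 * pi * R ^ 3 + R ^ 4)"
      by (intro add_mono T1 T2 T3 T4 T5)
    also have "\<dots> \<le> C * (1 + cmod z)"
    proof -
      define D where "D = C1 + 8 * pi * b * (3 * Q) + 16 * pi\<^sup>2 * R ^ 4 + 8 * pi * R ^ 3 + R ^ 4"
      define B where "B = 8 * pi * b * (3 * Q)"
      have "D \<ge> 0" unfolding D_def using C10 b0 Q0 R by (intro add_nonneg_nonneg mult_nonneg_nonneg) auto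
      moreover have "B \<ge> 0" unfolding B_def using b0 Q0 by (intro mult_nonneg_nonneg) auto
      moreover have "C = D + B" by (simp add: C_def D_def B_def)
      ultimately have "D + B * cmod z \<le> C * (1 + cmod z)" using mult_nonneg_nonneg[of D "cmod z"] by (simp add: algebra_simps)
      then show ?thesis unfolding D_def B_def by (simp add: algebra_simps)
    qed
    finally show "cmod (- 32 * of_real pi ^ 2 * of_nat n ^ 2 / (1 - \<alpha>) * charfun q \<alpha> \<mu>
      - ((\<mu> - free_eigenvalue n)\<^sup>2 - splitting_square q \<alpha> n)) \<le> C * (1 + cmod (\<mu> - free_eigenvalue n))"
      unfolding decomp[symmetric] P_def z_def by simp
  qed
qed

end

text \<open>Within the distance \<open>R \<surd>n\<close> of \<open>(2\<pi>n)\<^sup>2\<close> the characteristic function has exactly two zeros, both simple: one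
  near each of the two points \<open>(2\<pi>n)\<^sup>2 \<plusminus> E\<close>. The discs of radius \<open>\<bar>E\<bar>/2\<close> are the ones to which Rouche's theorem
  applies; the bound \<open>C\<close>, which is uniform in \<open>n\<close>, carries the asymptotic formula.\<close>

definition zero_pair :: "(real \<Rightarrow> complex) \<Rightarrow> complex \<Rightarrow> real \<Rightarrow> real \<Rightarrow> nat \<Rightarrow> complex \<Rightarrow> bool" where
  "zero_pair q \<alpha> R C n E \<longleftrightarrow>
      3/2 * cmod E \<le> R * sqrt (real n) \<and>
      (\<forall>\<sigma>\<in>{1, -1}. \<exists>\<mu>. {\<mu>'\<in>ball (free_eigenvalue n + \<sigma> * E) (cmod E / 2). charfun q \<alpha> \<mu>' = 0} = {\<mu>} \<and>
         zorder (charfun q \<alpha>) \<mu> = 1 \<and> cmod (\<mu> - (free_eigenvalue n + \<sigma> * E)) \<le> C) \<and>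
      (\<forall>\<mu>. charfun q \<alpha> \<mu> = 0 \<and> cmod (\<mu> - free_eigenvalue n) \<le> R * sqrt (real n) \<longrightarrow>
         (\<exists>\<sigma>\<in>{1, -1}. \<mu> \<in> ball (free_eigenvalue n + \<sigma> * E) (cmod E / 2)))"

context
  fixes q :: "real \<Rightarrow> complex" and \<alpha> :: complex and Q :: real
  assumes q: "q absolutely_integrable_on {0..1}" and q0: "integral {0..1} q = 0" and \<alpha>: "\<alpha> \<noteq> 1"
  defines "Q \<equiv> integral {0..1} (\<lambda>t. cmod (q t))"
begin

text \<open>Otherwise it would vanish identically; but on large circles it differs from the free characteristic function by less
  than the modulus of the latter.\<close>

lemma charfun_not_locally_zero: "\<not> eventually (\<lambda>z. charfun q \<alpha> z = 0) (nhds \<mu>)"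
proof
  assume "eventually (\<lambda>z. charfun q \<alpha> z = 0) (nhds \<mu>)"
  then obtain S where S: "open S" "\<mu> \<in> S" "\<And>z. z \<in> S \<Longrightarrow> charfun q \<alpha> z = 0" by (auto simp: eventually_nhds)
  define N where "N = nat \<lceil>max (2 * Q) (localisation_const q \<alpha> + 1)\<rceil>"
  have N: "2 * pi * (real N + 1/2) \<ge> max (2 * Q) (localisation_const q \<alpha> + 1)"
  proof -
    have "max (2 * Q) (localisation_const q \<alpha> + 1) \<le> real N" unfolding N_def by linarith
    also have "\<dots> \<le> 2 * 3 * (real N + 1/2)" by simp
    also have "\<dots> \<le> 2 * pi * (real N + 1/2)" using pi_gt3 by (intro mult_right_mono) auto
    finally show ?thesis .
  qed
  define \<nu> where "\<nu> = complex_of_real ((2 * pi * (real N + 1/2))\<^sup>2)"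
  have "cmod \<nu> = (2 * pi * (real N + 1/2))\<^sup>2" unfolding \<nu>_def norm_of_real by simp
  from free_dominates_on_circle[OF q \<alpha> N[unfolded Q_def] this] have "charfun q \<alpha> \<nu> \<noteq> 0" by auto
  moreover have "charfun q \<alpha> \<nu> = 0"
    by (rule analytic_continuation_open[of S UNIV "charfun q \<alpha>" "\<lambda>_. 0"])
       (use S in \<open>auto intro!: charfun_holomorphic[OF q]\<close>)
  ultimately show False by contradiction
qed

lemma zorder_charfun_pos:
  assumes "charfun q \<alpha> \<mu> = 0"
  shows "zorder (charfun q \<alpha>) \<mu> \<ge> 1"
proof -
  have "frequently (\<lambda>z. charfun q \<alpha> z \<noteq> 0) (at \<mu>)"
    using charfun_not_locally_zero[of \<mu>] assms by (simp add: frequently_def eventually_nhds_conv_at)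
  then have "zorder (charfun q \<alpha>) \<mu> > 0"
    using zorder_pos_iff'[of "charfun q \<alpha>" \<mu>] charfun_analytic[OF q] assms by auto
  then show ?thesis by simp
qed

lemma norm_sine_coeff_le: "cmod (sine_coeff q k) \<le> Q"
proof -
  have "cmod (integral {0..1} (\<lambda>x. q x * of_real (sin (2 * pi * real k * x)))) \<le> Q * 1"
    unfolding Q_def by (rule norm_integral_mult_le[OF q]) (auto intro!: continuous_intros)
  then show ?thesis by (simp add: sine_coeff_def)
qed

lemma sum_eq_one_singleton:
  fixes f :: "'a \<Rightarrow> int"
  assumes "finite Z" "\<And>z. z \<in> Z \<Longrightarrow> f z \<ge> 1" "sum f Z = 1"
  shows "\<exists>p. Z = {p} \<and> f p = 1"
proof -
  have "Z \<noteq> {}" using assms(3) by auto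
  then obtain p where p: "p \<in> Z" by blast
  have s: "sum f Z = f p + sum f (Z - {p})" using assms(1) p by (rule sum.remove)
  have "Z - {p} = {}"
  proof (rule ccontr)
    assume ne: "Z - {p} \<noteq> {}"
    have "sum f (Z - {p}) > 0"
      using assms(1) ne assms(2) by (intro sum_pos) (auto simp: Suc_le_eq intro: less_le_trans[of _ 1])
    then show False using s assms(2)[OF p] assms(3) by simp
  qed
  then have Z: "Z = {p}" using p by auto
  then show ?thesis using assms(3) by auto
qed

text \<open>Near \<open>(2\<pi>n)\<^sup>2\<close> the characteristic function is, up to a constant factor, \<open>z\<^sup>2 - E\<^sup>2\<close> with an error \<open>O(1 + \<bar>z\<bar>)\<close>, where
  \<open>z = \<mu> - (2\<pi>n)\<^sup>2\<close>. If \<open>\<bar>E\<bar>\<close> is large, this error is smaller than \<open>\<bar>z\<^sup>2 - E\<^sup>2\<bar> \<ge> 3\<bar>E\<bar>\<^sup>2/4\<close> on the circles of radius \<open>\<bar>E\<bar>/2\<close> about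
  \<open>\<plusminus> E\<close>, so each disc contains one simple zero. Conversely at a zero the factor of \<open>z\<^sup>2 - E\<^sup>2\<close> for the more distant root
  is at least \<open>\<bar>E\<bar>\<close>, which bounds the other factor by a constant.\<close>

lemma charfun_zero_pair:
  obtains R C K N where "R \<ge> 16 * sqrt (localisation_const q \<alpha>)" "C \<ge> 0" "K \<ge> 1"
    "\<forall>n\<ge>N. \<forall>E. E\<^sup>2 = splitting_square q \<alpha> n \<and> cmod E \<ge> K \<longrightarrow>
      zero_pair q \<alpha> R C n E"
proof -
  define R0 where "R0 = sqrt (cmod (gamma3 \<alpha> / 2) * Q)"
  define R where "R = max (2 * R0) (16 * sqrt (localisation_const q \<alpha>))"
  have Q0: "Q \<ge> 0" unfolding Q_def by (rule potential_norm_nonneg[OF q \<alpha>])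
  have R00: "R0 \<ge> 0" using Q0 by (simp add: R0_def)
  have "R \<ge> 0" using R00 by (simp add: R_def)
  from charfun_near_free_eigenvalue[OF q q0 \<alpha> this] obtain C N where C: "C \<ge> 0" and
    core: "\<And>n \<mu>. n \<ge> N \<Longrightarrow> cmod (\<mu> - free_eigenvalue n) \<le> R * sqrt (real n) \<Longrightarrow>
      cmod (- 32 * of_real pi ^ 2 * of_nat n ^ 2 / (1 - \<alpha>) * charfun q \<alpha> \<mu>
      - ((\<mu> - free_eigenvalue n)\<^sup>2 - splitting_square q \<alpha> n)) \<le> C * (1 + cmod (\<mu> - free_eigenvalue n))"
    by blast
  define K where "K = 8 * C + 1"
  have main: "zero_pair q \<alpha> R (4 * C) n E"
    if n: "n \<ge> max N 1" and E: "E\<^sup>2 = splitting_square q \<alpha> n" "cmod E \<ge> K" for n E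
  proof -
    define l where "l = free_eigenvalue n"
    define P where "P = - 32 * of_real pi ^ 2 * of_nat n ^ 2 / (1 - \<alpha>)"
    have P0: "P \<noteq> 0" using n \<alpha> by (simp add: P_def)
    have E1: "cmod E \<ge> 1" "cmod E > 8 * C" using E(2) C by (auto simp: K_def)
    have ER: "3/2 * cmod E \<le> R * sqrt (real n)"
    proof -
      have "(cmod E)\<^sup>2 = cmod (gamma3 \<alpha> / 2) * real n * cmod (sine_coeff q (2 * n))"
        by (simp only: norm_power[symmetric] E(1) splitting_square_def norm_mult norm_of_nat)
      also have "\<dots> \<le> cmod (gamma3 \<alpha> / 2) * real n * Q" by (intro mult_left_mono norm_sine_coeff_le) auto
      also have "\<dots> = (R0 * sqrt (real n))\<^sup>2" using Q0 by (simp add: R0_def power_mult_distrib)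
      finally have "cmod E \<le> R0 * sqrt (real n)" by (rule power2_le_imp_le) (use R00 in auto)
      moreover have "2 * R0 * sqrt (real n) \<le> R * sqrt (real n)" by (intro mult_right_mono) (auto simp: R_def)
      ultimately show ?thesis using norm_ge_zero[of E] by linarith
    qed
    have core': "cmod (P * charfun q \<alpha> \<mu> - (\<mu> - l - \<sigma> * E) * (\<mu> - l + \<sigma> * E)) \<le> C * (1 + cmod (\<mu> - l))"
      if "cmod (\<mu> - l) \<le> R * sqrt (real n)" "\<sigma> \<in> {1, -1}" for \<mu> \<sigma>
    proof -
      have "(\<mu> - l - \<sigma> * E) * (\<mu> - l + \<sigma> * E) = (\<mu> - l)\<^sup>2 - splitting_square q \<alpha> n"
        using that(2) unfolding E(1)[symmetric] by (auto simp: power2_eq_square algebra_simps)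
      then show ?thesis using core[of n \<mu>] that(1) n unfolding P_def l_def by simp
    qed
    \<comment> \<open>A zero on the side of \<open>\<sigma> E\<close> is within a constant of it.\<close>
    have close: "cmod (\<mu> - l - \<sigma> * E) \<le> 4 * C"
      if z: "charfun q \<alpha> \<mu> = 0" "cmod (\<mu> - l) \<le> R * sqrt (real n)" "\<sigma> \<in> {1, -1}" and far: "cmod (\<mu> - l + \<sigma> * E) \<ge> cmod E" for \<mu> \<sigma>
    proof -
      define w where "w = cmod (\<mu> - l - \<sigma> * E)"
      have w0: "w \<ge> 0" by (simp add: w_def)
      have \<sigma>E: "cmod (\<sigma> * E) = cmod E" using z(3) by auto
      have "w * cmod E \<le> w * cmod (\<mu> - l + \<sigma> * E)" using far w0 by (intro mult_left_mono)
      also have "\<dots> \<le> C * (1 + cmod (\<mu> - l))"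
        using core'[OF z(2,3)] z(1) by (simp add: norm_mult w_def)
      also have "\<dots> \<le> C * (1 + (cmod E + w))"
        using norm_triangle_ineq[of "\<mu> - l - \<sigma> * E" "\<sigma> * E"] C by (intro mult_left_mono) (auto simp: w_def \<sigma>E)
      finally have "w * cmod E \<le> C + C * cmod E + C * w" by (simp add: algebra_simps)
      moreover have "C * w \<le> cmod E / 2 * w" using E1 w0 by (intro mult_right_mono) auto
      moreover have "C \<le> C * cmod E" using E1 C mult_left_mono[of 1 "cmod E" C] by simp
      ultimately have "w * cmod E / 2 \<le> 2 * C * cmod E" by (simp add: algebra_simps)
      then have "w * cmod E \<le> (4 * C) * cmod E" by simp
      then show ?thesis unfolding w_def[symmetric] by (rule mult_right_le_imp_le) (use E1 in auto)
    qed
    have disc: "\<exists>\<mu>. {\<mu>'\<in>ball (l + \<sigma> * E) (cmod E / 2). charfun q \<alpha> \<mu>' = 0} = {\<mu>} \<and>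
         zorder (charfun q \<alpha>) \<mu> = 1 \<and> cmod (\<mu> - (l + \<sigma> * E)) \<le> 4 * C" if \<sigma>: "\<sigma> \<in> {1, -1}" for \<sigma>
    proof -
      have \<sigma>E: "cmod (\<sigma> * E) = cmod E" and \<sigma>0: "\<sigma> \<noteq> 0" using \<sigma> by auto
      have E0: "E \<noteq> 0" using E1(1) by (metis norm_zero not_one_le_zero)
      let ?g = "\<lambda>\<mu>. (\<mu> - l - \<sigma> * E) * (\<mu> - l + \<sigma> * E) / P"
      have bd: "cmod (\<mu> - l) \<le> 3/2 * cmod E" "cmod (\<mu> - l + \<sigma> * E) \<ge> 3/2 * cmod E"
        if "cmod (\<mu> - l - \<sigma> * E) \<le> cmod E / 2" for \<mu>
      proof -
        show "cmod (\<mu> - l) \<le> 3/2 * cmod E"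
          using norm_triangle_ineq[of "\<mu> - l - \<sigma> * E" "\<sigma> * E"] that \<sigma>E by simp
        have "cmod (2 * (\<sigma> * E)) = 2 * cmod E" by (simp only: norm_mult \<sigma>E[unfolded norm_mult]) simp
        then show "cmod (\<mu> - l + \<sigma> * E) \<ge> 3/2 * cmod E"
          using norm_triangle_ineq2[of "2 * (\<sigma> * E)" "- (\<mu> - l - \<sigma> * E)"] that by (simp add: norm_minus_commute algebra_simps)
      qed
      have less: "cmod (charfun q \<alpha> \<mu> - ?g \<mu>) < cmod (?g \<mu>)" if "\<mu> \<in> sphere (l + \<sigma> * E) (cmod E / 2)" for \<mu>
      proof -
        have w: "cmod (\<mu> - l - \<sigma> * E) = cmod E / 2" using that by (simp add: dist_norm norm_minus_commute algebra_simps)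
        note b = bd[OF eq_refl[OF w]]
        have "cmod (P * charfun q \<alpha> \<mu> - (\<mu> - l - \<sigma> * E) * (\<mu> - l + \<sigma> * E)) \<le> C * (1 + cmod (\<mu> - l))"
          using core'[OF _ \<sigma>] b ER by simp
        also have "\<dots> \<le> C * (5/2 * cmod E)" using b E1 C by (intro mult_left_mono) auto
        also have "\<dots> \<le> (cmod E / 8) * (5/2 * cmod E)" using E1 by (intro mult_right_mono) auto
        also have "\<dots> < (cmod E / 2) * (3/2 * cmod E)"
          using E0 by (simp add: field_simps)
        also have "\<dots> \<le> cmod ((\<mu> - l - \<sigma> * E) * (\<mu> - l + \<sigma> * E))"
          unfolding norm_mult w using b by (intro mult_left_mono) auto
        finally have "cmod (P * charfun q \<alpha> \<mu> - (\<mu> - l - \<sigma> * E) * (\<mu> - l + \<sigma> * E)) / cmod P <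
            cmod ((\<mu> - l - \<sigma> * E) * (\<mu> - l + \<sigma> * E)) / cmod P"
          using P0 by (intro divide_strict_right_mono) auto
        moreover have "charfun q \<alpha> \<mu> - ?g \<mu> = (P * charfun q \<alpha> \<mu> - (\<mu> - l - \<sigma> * E) * (\<mu> - l + \<sigma> * E)) / P"
          using P0 by (simp add: diff_divide_distrib)
        ultimately show ?thesis by (simp only: norm_divide)
      qed
      have hg: "?g holomorphic_on UNIV" using P0 by (intro holomorphic_intros) auto
      have rr: "cmod E / 2 > 0" using E1 by linarith
      define Z where "Z = {\<mu>'\<in>ball (l + \<sigma> * E) (cmod E / 2). charfun q \<alpha> \<mu>' = 0}"
      have Ro: "sum (zorder (charfun q \<alpha>)) Z = sum (zorder ?g) {p \<in> ball (l + \<sigma> * E) (cmod E / 2). ?g p = 0}" "finite Z"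
        unfolding Z_def
        by (rule rouche_circle[OF charfun_holomorphic[OF q, of \<alpha>] hg rr]; rule less; assumption)+
      have gz: "{p \<in> ball (l + \<sigma> * E) (cmod E / 2). ?g p = 0} = {l + \<sigma> * E}"
      proof -
        have "p = l + \<sigma> * E" if "dist (l + \<sigma> * E) p < cmod E / 2" "?g p = 0" for p
        proof -
          have "cmod (p - l - \<sigma> * E) \<le> cmod E / 2" using that(1) by (simp add: dist_norm norm_minus_commute algebra_simps)
          from bd(2)[OF this] E1 have "p - l + \<sigma> * E \<noteq> 0" by auto
          then have "p - l - \<sigma> * E = 0" using that(2) P0 by simp
          then show ?thesis by (simp add: diff_diff_eq)
        qed
        then show ?thesis using rr by auto
      qed
      have zg: "zorder ?g (l + \<sigma> * E) = 1"
      proof (rule zorder_zero_eqI[OF hg])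
        have "(?g has_field_derivative 2 * \<sigma> * E / P) (at (l + \<sigma> * E))"
          using P0 by (auto intro!: derivative_eq_intros)
        then have "deriv ?g (l + \<sigma> * E) = 2 * \<sigma> * E / P" by (rule DERIV_imp_deriv)
        then show "(deriv ^^ nat 1) ?g (l + \<sigma> * E) \<noteq> 0" using P0 E0 \<sigma>0 by simp
      qed auto
      have "sum (zorder (charfun q \<alpha>)) Z = 1"
        unfolding Ro(1) gz by (simp add: zg)
      with Ro(2) obtain p where p: "Z = {p}" "zorder (charfun q \<alpha>) p = 1"
        using sum_eq_one_singleton[of Z "zorder (charfun q \<alpha>)"] zorder_charfun_pos by (auto simp: Z_def)
      have pz: "charfun q \<alpha> p = 0" "cmod (p - l - \<sigma> * E) \<le> cmod E / 2"
      proof -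
        have "p \<in> Z" using p by simp
        then show "charfun q \<alpha> p = 0" "cmod (p - l - \<sigma> * E) \<le> cmod E / 2"
          by (auto simp: Z_def dist_norm norm_minus_commute algebra_simps)
      qed
      have "cmod (p - l - \<sigma> * E) \<le> 4 * C"
        using bd[OF pz(2)] ER norm_ge_zero[of E] by (intro close pz(1) \<sigma>) linarith+
      then show ?thesis using p unfolding Z_def by (intro exI[of _ p]) (simp add: algebra_simps)
    qed
    have loc: "\<exists>\<sigma>\<in>{1, -1}. \<mu> \<in> ball (l + \<sigma> * E) (cmod E / 2)"
      if z: "charfun q \<alpha> \<mu> = 0" "cmod (\<mu> - l) \<le> R * sqrt (real n)" for \<mu>
    proof -
      have *: "\<mu> \<in> ball (l + \<sigma> * E) (cmod E / 2)" if \<sigma>: "\<sigma> \<in> {1, -1}" and le: "cmod (\<mu> - l - \<sigma> * E) \<le> cmod (\<mu> - l + \<sigma> * E)" for \<sigma>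
      proof -
        have "cmod (2 * (\<sigma> * E)) = 2 * cmod E" using \<sigma> by (auto simp: norm_mult)
        then have "2 * cmod E \<le> cmod (\<mu> - l + \<sigma> * E) + cmod (\<mu> - l - \<sigma> * E)"
          using norm_triangle_ineq4[of "\<mu> - l + \<sigma> * E" "\<mu> - l - \<sigma> * E"] by (simp add: mult.commute)
        then have "cmod (\<mu> - l - \<sigma> * E) \<le> 4 * C" using le by (intro close z \<sigma>) auto
        then show ?thesis using E1 by (simp add: dist_norm norm_minus_commute algebra_simps)
      qed
      show ?thesis
      proof (cases "cmod (\<mu> - l - 1 * E) \<le> cmod (\<mu> - l + 1 * E)")
        case True
        then show ?thesis using *[of 1] by blast
      next
        case False
        then show ?thesis using *[of "-1"] by auto
      qed
    qed
    show ?thesis using ER disc loc unfolding zero_pair_def l_def by blast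
  qed
  show ?thesis
    by (rule that[of R "4 * C" K "max N 1"]) (use main C in \<open>auto simp: R_def K_def\<close>)
qed

end

section \<open>Eigenfunctions\<close>

lemma integral_sin_squared:
  assumes "n \<ge> 1"
  shows "integral {0..1} (\<lambda>x. (sin (2 * pi * real n * x))\<^sup>2) = 1/2"
proof (rule integral_unique)
  define A where "A = 2 * pi * real n"
  have A: "A \<noteq> 0" using assms by (simp add: A_def)
  have "((\<lambda>x. (sin (A * x))\<^sup>2) has_integral
      ((1 / 2 - sin (A * 1) * cos (A * 1) / (2 * A)) - (0 / 2 - sin (A * 0) * cos (A * 0) / (2 * A)))) {0..1}"
  proof (rule fundamental_theorem_of_calculus)
    fix x :: real
    have "((\<lambda>x. x / 2 - sin (A * x) * cos (A * x) / (2 * A)) has_real_derivative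
        1 / 2 - ((cos (A * x) * A) * cos (A * x) + sin (A * x) * (- sin (A * x) * A)) / (2 * A)) (at x within {0..1})"
      using A by (auto intro!: derivative_eq_intros simp: field_simps)
    moreover have "1 / 2 - ((cos (A * x) * A) * cos (A * x) + sin (A * x) * (- sin (A * x) * A)) / (2 * A) = (sin (A * x))\<^sup>2"
    proof -
      have "1 / 2 - ((c * A) * c + s * (- s * A)) / (2 * A) = s\<^sup>2" if "s\<^sup>2 + c\<^sup>2 = 1" for s c :: real
      proof -
        have "((c * A) * c + s * (- s * A)) / (2 * A) = (c\<^sup>2 - s\<^sup>2) / 2" using A by (simp add: field_simps power2_eq_square)
        then show ?thesis using that by (simp add: field_simps)
      qed
      then show ?thesis by simp
    qed
    ultimately show "((\<lambda>x. x / 2 - sin (A * x) * cos (A * x) / (2 * A)) has_vector_derivative (sin (A * x))\<^sup>2) (at x within {0..1})"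
      by (simp add: has_real_derivative_iff_has_vector_derivative)
  qed simp
  moreover have "sin A = 0" using sin_npi2[of "2 * n"] by (simp add: A_def mult_ac)
  ultimately show "((\<lambda>x. (sin (2 * pi * real n * x))\<^sup>2) has_integral 1/2) {0..1}" by (simp add: A_def)
qed

lemma T3_eigenfunctionD:
  assumes q: "q absolutely_integrable_on {0..1}" and T: "T3_eigenfunction q \<alpha> \<mu> y"
  shows "\<exists>v. ivp (\<lambda>t. q t - \<mu>) (\<lambda>_. 0) y v \<and> v 0 = v 1 \<and> y 0 + \<alpha> * y 1 = 0 \<and> y \<noteq> 0 \<and>
    (\<forall>x. x \<notin> {0..1} \<longrightarrow> y x = 0)"
proof -
  have "T3 q \<alpha> y (\<lambda>x. \<mu> * y x + 0)" "y \<noteq> 0" using T by (simp_all add: T3_eigenfunction_def)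
  then show ?thesis
    unfolding T3_iff_ivp[OF q continuous_on_const] by auto
qed

abbreviation near_sine :: "real \<Rightarrow> nat \<Rightarrow> (real \<Rightarrow> complex) \<Rightarrow> bool" where
  "near_sine C n \<Psi> \<equiv> (\<exists>c. cmod c = 1 \<and>
     (\<forall>x\<in>{0..1}. cmod (c * \<Psi> x - of_real (sqrt 2 * sin (2 * pi * real n * x))) \<le> C / sqrt (real n)))"

text \<open>Write an eigenfunction as \<open>y(0) cos \<rho>x + B sin \<rho>x + O(1/n)\<close>. Since \<open>sin \<rho>\<close> and \<open>cos \<rho> - 1\<close> are \<open>O(n\<^sup>-\<^sup>1\<^sup>/\<^sup>2)\<close>, the
  condition \<open>y(0) + \<alpha> y(1) = 0\<close> reads \<open>(1 + \<alpha>) y(0) = O(n\<^sup>-\<^sup>1\<^sup>/\<^sup>2)(\<bar>y(0)\<bar> + \<bar>B\<bar>)\<close>, so the cosine is negligible. The normalization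
  determines \<open>\<bar>B\<bar>\<close> up to \<open>O(n\<^sup>-\<^sup>1\<^sup>/\<^sup>2)\<close>.\<close>

lemma eigenfunction_asymptotics:
  fixes \<alpha> :: complex
  assumes q: "q absolutely_integrable_on {0..1}" and \<alpha>: "\<alpha> \<noteq> -1" and R: "R \<ge> 0"
  shows "\<exists>C N. \<forall>n\<ge>N. \<forall>\<mu> \<Psi>. cmod (\<mu> - free_eigenvalue n) \<le> R * sqrt (real n) \<and>
      T3_eigenfunction q \<alpha> \<mu> \<Psi> \<and> L2_norm \<Psi> = 1 \<longrightarrow>
      near_sine C n \<Psi>"
proof -
  define Q where "Q = integral {0..1} (\<lambda>t. cmod (q t))"
  have Q0: "Q \<ge> 0" unfolding Q_def using absolutely_integrable_norm_integrable(2)[OF q, of 1] by (intro integral_nonneg) auto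
  define K where "K = cmod \<alpha> * (3 * R + 6 * Q) / cmod (1 + \<alpha>)"
  define K2 where "K2 = 6 * K + 3 * R + 12 * Q"
  define K3 where "K3 = K2 * (2 + K2)"
  define C where "C = 2 * K2 + 8 * K3"
  have K0: "K \<ge> 0" unfolding K_def using Q0 R by (intro divide_nonneg_nonneg mult_nonneg_nonneg) auto
  have K20: "K2 \<ge> 0" using K0 Q0 R by (simp add: K2_def)
  have K30: "K3 \<ge> 0" using K20 by (simp add: K3_def)
  define N where "N = nat \<lceil>max (max 1 (R\<^sup>2)) (max (2 * Q) (max ((2 * K)\<^sup>2) ((4 * K3)\<^sup>2)))\<rceil>"
  show ?thesis
  proof (rule exI[of _ C], rule exI[of _ N], intro allI impI)
    fix n \<mu> \<Psi>
    assume n: "n \<ge> N" and A: "cmod (\<mu> - free_eigenvalue n) \<le> R * sqrt (real n) \<and>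
      T3_eigenfunction q \<alpha> \<mu> \<Psi> \<and> L2_norm \<Psi> = 1"
    have nb: "real n \<ge> max (max 1 (R\<^sup>2)) (max (2 * Q) (max ((2 * K)\<^sup>2) ((4 * K3)\<^sup>2)))"
      using n unfolding N_def by linarith
    then have n1: "n \<ge> 1" and nR: "R\<^sup>2 \<le> real n" and nQ: "2 * Q \<le> real n" and nK: "(2 * K)\<^sup>2 \<le> real n" and nK3: "(4 * K3)\<^sup>2 \<le> real n" by auto
    define r where "r = sqrt (real n)"
    have r: "r \<ge> 1" "r * r = real n" using n1 by (auto simp: r_def)
    have rK: "2 * K \<le> r" unfolding r_def by (rule real_le_rsqrt[OF nK])
    have rK3: "4 * K3 \<le> r" unfolding r_def by (rule real_le_rsqrt[OF nK3])
    have eig: "T3_eigenfunction q \<alpha> \<mu> \<Psi>" using A by blast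
    obtain v where i: "ivp (\<lambda>t. q t - \<mu>) (\<lambda>_. 0) \<Psi> v" and bc: "\<Psi> 0 + \<alpha> * \<Psi> 1 = 0"
      using T3_eigenfunctionD[OF q eig] by blast
    note cu = ivp_continuous(1)[OF i]
    define a where "a = 2 * pi * real n"
    define \<rho> where "\<rho> = csqrt \<mu>"
    define \<delta> where "\<delta> = \<rho> - of_real a"
    note near = csqrt_near_free_eigenvalue[OF n1 conjunct1[OF A] nR, folded \<rho>_def a_def, folded \<delta>_def, folded r_def]
    have d16: "cmod \<delta> \<le> 1/6" and dR: "cmod \<delta> * r \<le> R" and \<rho>n: "cmod \<rho> \<ge> real n" using near(3,4,5) by auto
    have dr: "cmod \<delta> \<le> R / r" using dR r by (simp add: field_simps)
    have \<rho>a: "\<rho> = of_real a + \<delta>" by (simp add: \<delta>_def)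
    have \<rho>0: "\<rho> \<noteq> 0" using \<rho>n n1 by auto
    have Im: "\<bar>Im \<rho>\<bar> \<le> 1" using abs_Im_le_cmod[of \<delta>] d16 by (simp add: \<rho>a)
    have \<mu>\<rho>: "\<mu> = \<rho>\<^sup>2" by (simp add: \<rho>_def)
    have e3: "exp (\<bar>Im \<rho>\<bar> * x) \<le> 3" if "x \<in> {0..1}" for x
    proof -
      have "\<bar>Im \<rho>\<bar> * x \<le> 1 * 1" using Im that by (intro mult_mono) auto
      then have "exp (\<bar>Im \<rho>\<bar> * x) \<le> exp 1" by simp
      then show ?thesis using exp_le by linarith
    qed
    define a0 where "a0 = cmod (\<Psi> 0)"
    define B where "B = v 0 / \<rho>"
    define Am where "Am = a0 + cmod B"
    have Am0: "Am \<ge> 0" "a0 \<ge> 0" by (simp_all add: Am_def a0_def)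
    have n_r: "1 / real n \<le> 1 / r" using r by (intro divide_left_mono) (auto simp flip: r(2))
    have asy: "cmod (\<Psi> x - (\<Psi> 0 * cos (\<rho> * x) + B * sin (\<rho> * x))) \<le> 6 * Q * Am / r" if x: "x \<in> {0..1}" for x
    proof -
      have "cmod (\<Psi> x - (\<Psi> 0 * cos (\<rho> * x) + B * sin (\<rho> * x))) \<le> 2 * Q * Am * exp (\<bar>Im \<rho>\<bar> * x) / cmod \<rho>"
        unfolding B_def Am_def a0_def
        by (rule ivp_asymptotics(2)[OF q i[unfolded \<mu>\<rho>] Q_def \<rho>0 _ refl x]) (use nQ \<rho>n in simp)
      also have "\<dots> \<le> 2 * Q * Am * 3 / real n"
        using Q0 Am0 e3[OF x] \<rho>n n1 by (intro frac_le mult_left_mono mult_nonneg_nonneg) auto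
      also have "\<dots> = 6 * Q * Am * (1 / real n)" by simp
      also have "\<dots> \<le> 6 * Q * Am * (1 / r)" using Q0 Am0 by (intro mult_left_mono n_r mult_nonneg_nonneg) auto
      finally show ?thesis by simp
    qed
    have sinbound: "cmod (sin w - sin w') \<le> 3 * cmod (w - w')" if "\<bar>Im w\<bar> \<le> 1" "\<bar>Im w'\<bar> \<le> 1" for w w' :: complex
      by (rule sin_lipschitz_strip[OF that])
    have cosbound: "cmod (cos \<delta> - 1) \<le> 3 * cmod \<delta>"
    proof -
      have s: "cmod (sin (\<delta> / 2)) \<le> 3 * cmod (\<delta> / 2)"
        using sinbound[of "\<delta> / 2" 0] abs_Im_le_cmod[of "\<delta> / 2"] d16 by (simp add: norm_divide)
      then have s1: "cmod (sin (\<delta> / 2)) \<le> 1" using d16 by (simp add: norm_divide)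
      have "cmod (cos \<delta> - 1) = 2 * (cmod (sin (\<delta> / 2)) * cmod (sin (\<delta> / 2)))"
        unfolding cos_minus_one_half_angle by (simp add: norm_mult power2_eq_square)
      also have "\<dots> \<le> 2 * (3 * cmod (\<delta> / 2) * 1)"
        by (intro mult_left_mono mult_mono s s1) auto
      finally show ?thesis by (simp add: norm_divide)
    qed
    have per: "sin \<rho> = sin \<delta>" "cos \<rho> = cos \<delta>"
    proof -
      have sa: "sin a = 0" "cos a = 1" using sin_npi2[of "2 * n"] cos_npi2[of "2 * n"] by (simp_all add: a_def mult_ac)
      then show "sin \<rho> = sin \<delta>" "cos \<rho> = cos \<delta>" by (simp_all add: \<rho>a sin_add cos_add sin_of_real cos_of_real)
    qed
    have sd: "cmod (sin \<delta>) \<le> 3 * cmod \<delta>" using sinbound[of \<delta> 0] abs_Im_le_cmod[of \<delta>] d16 by simp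
    have a0K: "a0 \<le> K * Am / r"
    proof -
      define e1 where "e1 = \<Psi> 1 - (\<Psi> 0 * cos \<rho> + B * sin \<rho>)"
      have e1: "cmod e1 \<le> 6 * Q * Am / r" using asy[of 1] by (simp add: e1_def)
      have "(1 + \<alpha>) * \<Psi> 0 = - \<alpha> * (\<Psi> 0 * (cos \<delta> - 1) + B * sin \<delta> + e1)"
        using bc unfolding e1_def per by (simp add: algebra_simps add_eq_0_iff)
      then have "cmod (1 + \<alpha>) * a0 = cmod \<alpha> * cmod (\<Psi> 0 * (cos \<delta> - 1) + B * sin \<delta> + e1)"
        unfolding a0_def norm_mult[symmetric] by (simp only: norm_minus_cancel minus_mult_left[symmetric])
      also have "\<dots> \<le> cmod \<alpha> * (a0 * (3 * cmod \<delta>) + cmod B * (3 * cmod \<delta>) + 6 * Q * Am / r)"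
      proof (intro mult_left_mono norm_triangle_le add_mono e1)
        show "cmod (\<Psi> 0 * (cos \<delta> - 1)) \<le> a0 * (3 * cmod \<delta>)"
          unfolding norm_mult a0_def by (intro mult_left_mono cosbound) auto
        show "cmod (B * sin \<delta>) \<le> cmod B * (3 * cmod \<delta>)"
          unfolding norm_mult by (intro mult_left_mono sd) auto
      qed auto
      also have "a0 * (3 * cmod \<delta>) + cmod B * (3 * cmod \<delta>) + 6 * Q * Am / r = 3 * Am * cmod \<delta> + 6 * Q * Am / r"
        by (simp add: Am_def algebra_simps)
      also have "cmod \<alpha> * (3 * Am * cmod \<delta> + 6 * Q * Am / r) \<le> cmod \<alpha> * (3 * Am * (R / r) + 6 * Q * Am / r)"
        using Am0 dr by (intro mult_left_mono add_mono) auto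
      also have "\<dots> = (cmod \<alpha> * (3 * R + 6 * Q)) * Am / r" by (simp add: algebra_simps add_divide_distrib)
      also have "cmod \<alpha> * (3 * R + 6 * Q) = cmod (1 + \<alpha>) * K" using \<alpha> by (simp add: K_def add_eq_0_iff)
      also have "cmod (1 + \<alpha>) * K * Am / r = cmod (1 + \<alpha>) * (K * Am / r)" by simp
      finally show ?thesis
        by (rule mult_left_le_imp_le) (use \<alpha> in \<open>simp add: add_eq_0_iff\<close>)
    qed
    have AmB: "Am \<le> 2 * cmod B"
    proof -
      have "K * Am / r \<le> Am / 2" using rK r Am0 mult_right_mono[OF rK Am0(1)] by (simp add: field_simps)
      then have "a0 \<le> Am / 2" using a0K by linarith
      then show ?thesis by (simp add: Am_def)
    qed
    have diff: "cmod (\<Psi> x - B * of_real (sin (a * x))) \<le> K2 * cmod B / r" if x: "x \<in> {0..1}" for x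
    proof -
      have x01: "0 \<le> x" "x \<le> 1" using x by auto
      have Imx: "\<bar>Im (\<rho> * of_real x)\<bar> \<le> 1" using Im x mult_mono[of "\<bar>Im \<rho>\<bar>" 1 x 1] by (simp add: abs_mult)
      have "exp \<bar>Im (\<rho> * of_real x)\<bar> \<le> 3" using e3[OF x] x by (simp add: abs_mult)
      then have c3: "cmod (cos (\<rho> * of_real x)) \<le> 3" using norm_sin_cos_le_exp(2)[of "\<rho> * of_real x"] by linarith
      have "cmod (sin (\<rho> * of_real x) - sin (of_real a * of_real x)) \<le> 3 * cmod (\<rho> * of_real x - of_real a * of_real x)"
        by (rule sinbound[OF Imx]) simp
      also have "\<dots> = 3 * (cmod \<delta> * x)" using x by (simp add: left_diff_distrib[symmetric] \<delta>_def[symmetric] norm_mult)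
      also have "\<dots> \<le> 3 * cmod \<delta>" using x01 by (simp add: mult_left_le)
      also have "\<dots> \<le> 3 * (R / r)" using dr by simp
      finally have s: "cmod (sin (\<rho> * of_real x) - of_real (sin (a * x))) \<le> 3 * (R / r)"
        by (simp only: of_real_mult[symmetric] sin_of_real)
      have "\<Psi> x - B * of_real (sin (a * x)) = (\<Psi> x - (\<Psi> 0 * cos (\<rho> * x) + B * sin (\<rho> * x)))
          + \<Psi> 0 * cos (\<rho> * x) + B * (sin (\<rho> * x) - of_real (sin (a * x)))" by (simp add: algebra_simps)
      also have "cmod \<dots> \<le> 6 * Q * Am / r + a0 * 3 + cmod B * (3 * (R / r))"
      proof (intro norm_triangle_le add_mono asy x)
        show "cmod (\<Psi> 0 * cos (\<rho> * of_real x)) \<le> a0 * 3"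
          unfolding norm_mult a0_def by (intro mult_left_mono c3) auto
        show "cmod (B * (sin (\<rho> * of_real x) - of_real (sin (a * x)))) \<le> cmod B * (3 * (R / r))"
          unfolding norm_mult[of B] by (intro mult_left_mono s) auto
      qed
      also have "\<dots> \<le> 6 * Q * Am / r + (K * Am / r) * 3 + cmod B * (3 * (R / r))"
        by (intro add_right_mono add_left_mono mult_right_mono a0K) auto
      also have "\<dots> = (6 * Q + 3 * K) * Am / r + 3 * R * cmod B / r" using r by (simp add: field_simps)
      also have "\<dots> \<le> (6 * Q + 3 * K) * (2 * cmod B) / r + 3 * R * cmod B / r"
        by (intro add_right_mono divide_right_mono mult_left_mono AmB) (use Q0 K0 r in auto)
      also have "\<dots> = K2 * cmod B / r" using r by (simp add: K2_def field_simps)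
      finally show ?thesis .
    qed
    let ?s = "\<lambda>x. sin (a * x)"
    have half: "integral {0..1} (\<lambda>x. (cmod B)\<^sup>2 * (?s x)\<^sup>2) = (cmod B)\<^sup>2 / 2"
      using integral_sin_squared[OF n1] by (simp add: a_def)
    have one: "integral {0..1} (\<lambda>x. (cmod (\<Psi> x))\<^sup>2) = 1"
      using A by (simp add: L2_norm_def)
    have ic: "f integrable_on {0..1}" if "continuous_on {0..1} f" for f :: "real \<Rightarrow> real"
      by (rule integrable_continuous_real[OF that])
    have sq: "\<bar>(cmod (\<Psi> x))\<^sup>2 - (cmod B)\<^sup>2 * (?s x)\<^sup>2\<bar> \<le> K3 * (cmod B)\<^sup>2 / r" if x: "x \<in> {0..1}" for x
    proof -
      define p where "p = cmod (\<Psi> x)"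
      define t where "t = cmod (B * of_real (?s x))"
      have t: "t = cmod B * \<bar>?s x\<bar>" by (simp add: t_def norm_mult)
      have tB: "t \<le> cmod B" unfolding t by (simp add: mult_left_le)
      have pt: "\<bar>p - t\<bar> \<le> K2 * cmod B / r"
        unfolding p_def t_def by (rule order_trans[OF norm_triangle_ineq3 diff[OF x]])
      have "K2 * cmod B / r \<le> K2 * cmod B" using r K20 divide_left_mono[of 1 r "K2 * cmod B"] by simp
      then have pp: "p \<le> (1 + K2) * cmod B" using pt tB by (simp add: algebra_simps)
      have "\<bar>p\<^sup>2 - t\<^sup>2\<bar> = \<bar>p - t\<bar> * \<bar>p + t\<bar>" by (simp add: power2_eq_square algebra_simps flip: abs_mult)
      also have "\<dots> \<le> (K2 * cmod B / r) * ((2 + K2) * cmod B)"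
        using pt pp tB K20 r by (intro mult_mono) (auto simp: p_def t_def algebra_simps)
      also have "\<dots> = K3 * (cmod B)\<^sup>2 / r" by (simp add: K3_def power2_eq_square)
      finally show ?thesis unfolding p_def t by (simp add: power_mult_distrib)
    qed
    have "norm (integral {0..1} (\<lambda>x. (cmod (\<Psi> x))\<^sup>2 - (cmod B)\<^sup>2 * (?s x)\<^sup>2)) \<le> integral {0..1} (\<lambda>x::real. K3 * (cmod B)\<^sup>2 / r)"
      by (rule integral_norm_bound_integral) (use sq in \<open>auto intro!: ic continuous_intros cu\<close>)
    moreover have "integral {0..1} (\<lambda>x. (cmod (\<Psi> x))\<^sup>2 - (cmod B)\<^sup>2 * (?s x)\<^sup>2) = 1 - (cmod B)\<^sup>2 / 2"
    proof -
      have "integral {0..1} (\<lambda>x. (cmod (\<Psi> x))\<^sup>2 - (cmod B)\<^sup>2 * (?s x)\<^sup>2) =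
          integral {0..1} (\<lambda>x. (cmod (\<Psi> x))\<^sup>2) - integral {0..1} (\<lambda>x. (cmod B)\<^sup>2 * (?s x)\<^sup>2)"
        by (intro integral_diff ic continuous_intros cu)
      then show ?thesis by (simp only: half one)
    qed
    ultimately have nB: "\<bar>1 - (cmod B)\<^sup>2 / 2\<bar> \<le> K3 * (cmod B)\<^sup>2 / r" by simp
    define b where "b = cmod B"
    have b0: "b \<ge> 0" by (simp add: b_def)
    have nb: "\<bar>1 - b\<^sup>2 / 2\<bar> \<le> K3 * b\<^sup>2 / r" using nB by (simp add: b_def)
    have "K3 * b\<^sup>2 / r \<le> b\<^sup>2 / 4"
      using rK3 r mult_right_mono[OF rK3 zero_le_power2[of b]] by (simp add: field_simps)
    then have b4: "b\<^sup>2 \<le> 4" "b\<^sup>2 > 0" using nb by linarith+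
    then have b2: "b \<le> 2" "b > 0" using b0 power2_le_imp_le[of b 2] by (auto simp: less_le)
    have "\<bar>b - sqrt 2\<bar> \<le> 8 * K3 / r"
    proof -
      have "\<bar>b - sqrt 2\<bar> * 1 \<le> \<bar>b - sqrt 2\<bar> * (b + sqrt 2)"
        using b0 by (intro mult_left_mono) (auto intro: add_increasing)
      also have "\<dots> = \<bar>(b - sqrt 2) * (b + sqrt 2)\<bar>" using b0 by (simp add: abs_mult)
      also have "(b - sqrt 2) * (b + sqrt 2) = b\<^sup>2 - 2" by (simp add: algebra_simps power2_eq_square)
      also have "\<bar>b\<^sup>2 - 2\<bar> \<le> 2 * (K3 * b\<^sup>2 / r)" using nb by linarith
      also have "\<dots> \<le> 2 * (K3 * 4 / r)" using b4 K30 r by (intro mult_left_mono divide_right_mono) auto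
      finally show ?thesis by simp
    qed
    note bs = this
    \<comment> \<open>The unimodular constant turns the coefficient \<open>B\<close> of the sine into its modulus.\<close>
    define c where "c = cnj B / of_real b"
    have c1: "cmod c = 1" using b2 by (simp add: c_def norm_divide b_def)
    have cB: "c * B = of_real b"
    proof -
      have "cnj B * B = of_real b * of_real b" unfolding b_def by (metis complex_norm_square mult.commute power2_eq_square of_real_mult)
      then show ?thesis using b2 by (simp add: c_def)
    qed
    have "cmod (c * \<Psi> x - of_real (sqrt 2 * sin (2 * pi * real n * x))) \<le> C / sqrt (real n)" if x: "x \<in> {0..1}" for x
    proof -
      have "c * \<Psi> x - of_real (sqrt 2 * ?s x) = c * (\<Psi> x - B * of_real (?s x)) + of_real ((b - sqrt 2) * ?s x)"
        by (simp add: algebra_simps cB[symmetric])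
      also have "cmod \<dots> \<le> K2 * b / r + \<bar>b - sqrt 2\<bar> * \<bar>?s x\<bar>"
      proof (rule norm_triangle_le, rule add_mono)
        show "cmod (c * (\<Psi> x - B * of_real (?s x))) \<le> K2 * b / r"
          using diff[OF x] c1 by (simp add: norm_mult b_def)
        show "cmod (of_real ((b - sqrt 2) * ?s x)) \<le> \<bar>b - sqrt 2\<bar> * \<bar>?s x\<bar>"
          unfolding norm_of_real abs_mult ..
      qed
      also have "\<dots> \<le> K2 * 2 / r + 8 * K3 / r * 1"
        using b2 K20 K30 r bs by (intro add_mono mult_mono divide_right_mono mult_left_mono) auto
      also have "\<dots> = C / r" by (simp add: C_def add_divide_distrib)
      finally show ?thesis by (simp add: r_def a_def)
    qed
    with c1 show "\<exists>c. cmod c = 1 \<and> (\<forall>x\<in>{0..1}. cmod (c * \<Psi> x - of_real (sqrt 2 * sin (2 * pi * real n * x))) \<le> C / sqrt (real n))"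
      by blast
  qed
qed

section \<open>Riesz bases of root functions\<close>

lemma L2_norm_nonneg: "L2_norm f \<ge> 0"
proof (cases "(\<lambda>x. (cmod (f x))\<^sup>2) integrable_on {0..1}")
  case True
  then show ?thesis unfolding L2_norm_def by (intro real_sqrt_ge_zero integral_nonneg) auto
qed (simp add: L2_norm_def not_integrable_integral)

lemma L2_norm_cong:
  assumes "L2_eq f g"
  shows "L2_norm f = L2_norm g"
proof -
  obtain N where N: "negligible N" "\<And>x. x \<in> {0..1} - N \<Longrightarrow> f x = g x" using L2_eq_negligible[OF assms] by blast
  have "integral {0..1} (\<lambda>x. (cmod (f x))\<^sup>2) = integral {0..1} (\<lambda>x. (cmod (g x))\<^sup>2)"
    by (rule integral_spike[OF N(1)]) (use N(2) in auto)
  then show ?thesis by (simp add: L2_norm_def)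
qed

lemma L2_norm_scale: "L2_norm (\<lambda>x. c * f x) = cmod c * L2_norm f"
  by (simp add: L2_norm_def norm_mult power_mult_distrib real_sqrt_mult)

lemma L2_norm_le_sup:
  assumes f: "continuous_on {0..1} f" and D: "\<And>x. x \<in> {0..1} \<Longrightarrow> cmod (f x) \<le> D"
  shows "L2_norm f \<le> D"
proof -
  have D0: "D \<ge> 0" using D[of 0] norm_ge_zero[of "f 0"] by (simp del: norm_ge_zero)
  have "integral {0..1} (\<lambda>x. (cmod (f x))\<^sup>2) \<le> integral {0..1} (\<lambda>x::real. D\<^sup>2)"
    by (intro integral_le integrable_continuous_real continuous_intros f power_mono D) auto
  then have "L2_norm f \<le> sqrt (D\<^sup>2)" unfolding L2_norm_def by (intro real_sqrt_le_mono) simp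
  then show ?thesis using D0 by simp
qed

lemma L2_eq_trans: "L2_eq f g \<Longrightarrow> L2_eq g h \<Longrightarrow> L2_eq f h"
  unfolding L2_eq_def by (elim AE_mp) (auto elim!: AE_mp)

lemma L2_eq_sym: "L2_eq f g \<Longrightarrow> L2_eq g f"
  unfolding L2_eq_def by (auto simp: eq_commute)

lemma L2_eq_comb:
  assumes "L2_eq f f'" "L2_eq g g'"
  shows "L2_eq (\<lambda>x. a * f x + b * g x) (\<lambda>x. a * f' x + b * g' x)"
  using assms unfolding L2_eq_def by eventually_elim simp

lemma L2_product_integrable:
  assumes "L2 f" "L2 g"
  shows "(\<lambda>x. f x * cnj (g x)) integrable_on {0..1}"
proof (rule measurable_bounded_by_integrable_imp_integrable)
  have "f \<in> borel_measurable (lebesgue_on {0..1})" "g \<in> borel_measurable (lebesgue_on {0..1})"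
    using assms by (auto simp: L2_def)
  moreover have "cnj \<in> borel_measurable borel" by (intro borel_measurable_continuous_onI continuous_intros)
  ultimately show "(\<lambda>x. f x * cnj (g x)) \<in> borel_measurable (lebesgue_on {0..1})"
    by (intro borel_measurable_times measurable_compose[of g _ _ cnj])
  show "(\<lambda>x. (cmod (f x))\<^sup>2 + (cmod (g x))\<^sup>2) integrable_on {0..1}"
    using assms by (auto simp: L2_def intro: integrable_add)
  show "norm (f x * cnj (g x)) \<le> (cmod (f x))\<^sup>2 + (cmod (g x))\<^sup>2" for x
  proof -
    have "norm (f x * cnj (g x)) = cmod (f x) * cmod (g x)" by (simp add: norm_mult)
    moreover have "0 \<le> cmod (f x) * cmod (g x)" by simp
    ultimately show ?thesis using sum_squares_bound[of "cmod (f x)" "cmod (g x)"] by linarith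
  qed
qed auto

lemma L2_comb:
  assumes "L2 f" "L2 g"
  shows "L2 (\<lambda>x. a * f x + b * g x)"
  unfolding L2_def
proof (intro conjI)
  have fg: "f \<in> borel_measurable (lebesgue_on {0..1})" "g \<in> borel_measurable (lebesgue_on {0..1})"
    using assms by (auto simp: L2_def)
  then show m: "(\<lambda>x. a * f x + b * g x) \<in> borel_measurable (lebesgue_on {0..1})" by auto
  show "(\<lambda>x. (cmod (a * f x + b * g x))\<^sup>2) integrable_on {0..1}"
  proof (rule measurable_bounded_by_integrable_imp_integrable)
    show "(\<lambda>x. (cmod (a * f x + b * g x))\<^sup>2) \<in> borel_measurable (lebesgue_on {0..1})" using m by auto
    show "(\<lambda>x. 2 * (cmod a)\<^sup>2 * (cmod (f x))\<^sup>2 + 2 * (cmod b)\<^sup>2 * (cmod (g x))\<^sup>2) integrable_on {0..1}"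
      using assms by (auto simp: L2_def intro!: integrable_add integrable_on_mult_right)
    fix x
    have "cmod (a * f x + b * g x) \<le> cmod (a * f x) + cmod (b * g x)" by (rule norm_triangle_ineq)
    then have "(cmod (a * f x + b * g x))\<^sup>2 \<le> (cmod (a * f x) + cmod (b * g x))\<^sup>2" by (intro power_mono) auto
    also have "\<dots> \<le> 2 * (cmod (a * f x))\<^sup>2 + 2 * (cmod (b * g x))\<^sup>2"
      using sum_squares_bound[of "cmod (a * f x)" "cmod (b * g x)"] by (simp add: power2_sum)
    finally show "norm ((cmod (a * f x + b * g x))\<^sup>2) \<le> 2 * (cmod a)\<^sup>2 * (cmod (f x))\<^sup>2 + 2 * (cmod b)\<^sup>2 * (cmod (g x))\<^sup>2"
      by (simp add: norm_mult power_mult_distrib)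
  qed auto
qed

lemma L2_norm_orthonormal_pair:
  assumes u: "L2_orthonormal_basis u" and ij: "i \<noteq> j"
  shows "(L2_norm (\<lambda>x. s * u i x + t * u j x))\<^sup>2 = (cmod s)\<^sup>2 + (cmod t)\<^sup>2"
proof -
  have L: "L2 (u k)" for k using u by (auto simp: L2_orthonormal_basis_def)
  have hi: "((\<lambda>x. u k x * cnj (u l x)) has_integral (if k = l then 1 else 0)) {0..1}" for k l
    using integrable_integral[OF L2_product_integrable[OF L[of k] L[of l]]] u
    by (simp add: L2_orthonormal_basis_def L2_inner_def)
  let ?f = "\<lambda>x. s * u i x + t * u j x"
  have "((\<lambda>x. s * cnj s * (u i x * cnj (u i x)) + s * cnj t * (u i x * cnj (u j x)) + t * cnj s * (u j x * cnj (u i x))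
      + t * cnj t * (u j x * cnj (u j x))) has_integral (s * cnj s * 1 + s * cnj t * 0 + t * cnj s * 0 + t * cnj t * 1)) {0..1}"
    using hi[of i i] hi[of i j] hi[of j i] hi[of j j] ij
    by (intro has_integral_add has_integral_mult_right) auto
  moreover have "s * cnj s * (u i x * cnj (u i x)) + s * cnj t * (u i x * cnj (u j x)) + t * cnj s * (u j x * cnj (u i x))
      + t * cnj t * (u j x * cnj (u j x)) = complex_of_real ((cmod (?f x))\<^sup>2)" for x
    by (simp only: complex_norm_square) (simp add: algebra_simps)
  ultimately have "((\<lambda>x. complex_of_real ((cmod (?f x))\<^sup>2)) has_integral complex_of_real ((cmod s)\<^sup>2 + (cmod t)\<^sup>2)) {0..1}"
    by (simp add: complex_norm_square[symmetric] del: of_real_power)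
  then have "((\<lambda>x. Re (complex_of_real ((cmod (?f x))\<^sup>2))) has_integral Re (complex_of_real ((cmod s)\<^sup>2 + (cmod t)\<^sup>2))) {0..1}"
    by (rule has_integral_Re)
  then have "integral {0..1} (\<lambda>x. (cmod (?f x))\<^sup>2) = (cmod s)\<^sup>2 + (cmod t)\<^sup>2" by (intro integral_unique) simp
  then show ?thesis by (simp add: L2_norm_def)
qed

text \<open>Transport to the orthonormal basis: \<open>A\<close> being bounded gives the upper bound, its bounded inverse \<open>B\<close> the lower one.\<close>

lemma riesz_basis_bounds:
  assumes "L2_riesz_basis e"
  shows "\<exists>\<kappa> M. \<kappa> > 0 \<and> M > 0 \<and> (\<forall>i. L2_norm (e i) \<le> M) \<and>
    (\<forall>i j s t. i \<noteq> j \<longrightarrow> \<kappa> * cmod s \<le> L2_norm (\<lambda>x. s * e i x + t * e j x))"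
proof -
  obtain u A B where u: "L2_orthonormal_basis u" and A: "L2_bounded_operator A" and B: "L2_bounded_operator B"
    and BA: "\<And>f. L2 f \<Longrightarrow> L2_eq (B (A f)) f" and e: "\<And>i. L2_eq (e i) (A (u i))"
    using assms unfolding L2_riesz_basis_def by blast
  obtain MA where MA: "\<And>f. L2 f \<Longrightarrow> L2_norm (A f) \<le> MA * L2_norm f" using A unfolding L2_bounded_operator_def by blast
  obtain MB where MB: "\<And>f. L2 f \<Longrightarrow> L2_norm (B f) \<le> MB * L2_norm f" using B unfolding L2_bounded_operator_def by blast
  have Lu: "L2 (u k)" for k using u by (auto simp: L2_orthonormal_basis_def)
  have lin: "L2_eq (A (\<lambda>x. a * f x + b * g x)) (\<lambda>x. a * A f x + b * A g x)" and LA: "L2 (A f)"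
    if "L2 f" "L2 g" for f g a b using A that unfolding L2_bounded_operator_def by blast+
  have n1: "L2_norm (u i) = 1" for i
  proof -
    have "(L2_norm (\<lambda>x. 1 * u i x + 0 * u (Suc i) x))\<^sup>2 = (cmod 1)\<^sup>2 + (cmod 0)\<^sup>2"
      by (rule L2_norm_orthonormal_pair[OF u]) simp
    then show ?thesis using L2_norm_nonneg[of "u i"] by (simp add: power2_eq_1_iff)
  qed
  define M where "M = max MA 1"
  define K where "K = max MB 1"
  have "L2_norm (e i) \<le> M" for i
    using MA[OF Lu[of i]] n1[of i] L2_norm_cong[OF e[of i]] by (simp add: M_def)
  moreover have "(1 / K) * cmod s \<le> L2_norm (\<lambda>x. s * e i x + t * e j x)" if ij: "i \<noteq> j" for i j s t
  proof -
    let ?g = "\<lambda>x. s * u i x + t * u j x"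
    have Lg: "L2 ?g" by (rule L2_comb[OF Lu Lu])
    have "L2_eq (\<lambda>x. s * e i x + t * e j x) (\<lambda>x. s * A (u i) x + t * A (u j) x)" by (rule L2_eq_comb[OF e e])
    then have "L2_eq (\<lambda>x. s * e i x + t * e j x) (A ?g)" using L2_eq_sym[OF lin[OF Lu Lu]] by (rule L2_eq_trans)
    then have n: "L2_norm (\<lambda>x. s * e i x + t * e j x) = L2_norm (A ?g)" by (rule L2_norm_cong)
    have "cmod s \<le> L2_norm ?g"
    proof (rule power2_le_imp_le)
      show "(cmod s)\<^sup>2 \<le> (L2_norm ?g)\<^sup>2" unfolding L2_norm_orthonormal_pair[OF u ij] by simp
    qed (rule L2_norm_nonneg)
    also have "\<dots> = L2_norm (B (A ?g))" by (rule L2_norm_cong[OF BA[OF Lg], symmetric])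
    also have "\<dots> \<le> MB * L2_norm (A ?g)" by (rule MB[OF LA[OF Lg Lg]])
    also have "\<dots> \<le> K * L2_norm (A ?g)" by (intro mult_right_mono L2_norm_nonneg) (simp add: K_def)
    finally show ?thesis unfolding n using max.cobounded2[of 1 MB] by (simp add: K_def field_simps)
  qed
  ultimately show ?thesis by (intro exI[of _ "1 / K"] exI[of _ M]) (auto simp: K_def M_def)
qed

text \<open>Subtracting the two equations leaves \<open>(\<mu> - \<nu>) y = 0\<close>.\<close>

lemma eigenfunctions_distinct:
  assumes q: "q absolutely_integrable_on {0..1}" and "T3_eigenfunction q \<alpha> \<mu> y" "T3_eigenfunction q \<alpha> \<nu> y"
  shows "\<mu> = \<nu>"
proof (rule ccontr)
  assume ne: "\<mu> \<noteq> \<nu>"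
  obtain v where i: "ivp (\<lambda>t. q t - \<mu>) (\<lambda>_. 0) y v" and y: "y \<noteq> 0" "\<And>x. x \<notin> {0..1} \<Longrightarrow> y x = 0"
    using T3_eigenfunctionD[OF q assms(2)] by blast
  obtain w where j: "ivp (\<lambda>t. q t - \<nu>) (\<lambda>_. 0) y w"
    using T3_eigenfunctionD[OF q assms(3)] by blast
  have vw: "v x = w x" if "x \<in> {0..1}" for x
    using vector_derivative_unique_within_closed_interval[of 0 1 x y "v x" "w x"]
      ivp_has_vector_derivative[OF i that] ivp_has_vector_derivative[OF j that] that by simp
  have "(\<mu> - \<nu>) * y x = 0" if "x \<in> {0..1}" for x
  proof (rule continuous_zero_if_integrals_zero[OF _ _ that, of "\<lambda>x. (\<mu> - \<nu>) * y x"])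
    show "continuous_on {0..1} (\<lambda>x. (\<mu> - \<nu>) * y x)" by (intro continuous_intros ivp_continuous(1)[OF i])
    fix x :: real assume x: "x \<in> {0..1}"
    have "((\<lambda>t. ((q t - \<nu>) * y t + 0) - ((q t - \<mu>) * y t + 0)) has_integral ((w x - w 0) - (v x - v 0))) {0..x}"
      using i j x unfolding ivp_def by (intro has_integral_diff) blast+
    then show "((\<lambda>x. (\<mu> - \<nu>) * y x) has_integral 0) {0..x}"
      using vw[OF x] vw[of 0] by (simp add: algebra_simps)
  qed
  then have "y = 0" using ne y(2) by (auto simp: fun_eq_iff)
  then show False using y(1) by contradiction
qed

text \<open>The elements of the system in a root space span it, so a root space that is not zero contains one of them.\<close>

lemma root_function_of_simple_eigenvalue:
  assumes e: "T3_root_function_system q \<alpha> e" and simple: "T3_alg_mult q \<alpha> \<mu> = 1"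
    and root: "T3_root_space q \<alpha> \<mu> = T3_kernel q \<alpha> \<mu> 1"
  shows "\<exists>i. T3_eigenfunction q \<alpha> \<mu> (e i)"
proof -
  let ?V = "T3_root_space q \<alpha> \<mu>" and ?B = "range e \<inter> T3_root_space q \<alpha> \<mu>"
  have ind: "cfun.independent ?B" and sp: "?V \<subseteq> cfun.span ?B"
    using e by (auto simp: T3_root_function_system_def)
  have "?B \<noteq> {}"
  proof
    assume "?B = {}"
    then have "?V \<subseteq> cfun.span {}" using sp by metis
    then have "cfun.dim ?V = 0" by (intro cfun.dim_unique[of "{}"] cfun.independent_empty) auto
    then show False using simple by (simp add: T3_alg_mult_def cfun_dim_def)
  qed
  then obtain i where i: "e i \<in> ?V" by blast
  have "e i \<noteq> 0"
  proof
    assume "e i = 0"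
    then have "0 \<in> ?B" using i by (metis IntI rangeI)
    then have "cfun.dependent ?B" by (rule cfun.dependent_zero)
    with ind show False by contradiction
  qed
  moreover have "T3 q \<alpha> (e i) (\<lambda>x. \<mu> * e i x)"
  proof -
    have "e i \<in> T3_kernel q \<alpha> \<mu> (Suc 0)" using i root by (metis One_nat_def)
    then have "T3 q \<alpha> (e i) (\<lambda>x. \<mu> * e i x + (0 :: real \<Rightarrow> complex) x)"
      by (simp only: T3_kernel.simps mem_Collect_eq bex_simps singleton_iff simp_thms)
    then show ?thesis by (simp only: zero_fun_def add_0_right)
  qed
  ultimately show ?thesis by (auto simp: T3_eigenfunction_def)
qed

lemma T3_eigenfunction_scale:
  assumes q: "q absolutely_integrable_on {0..1}" and y: "T3_eigenfunction q \<alpha> \<mu> y" and c: "c \<noteq> 0"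
  shows "T3_eigenfunction q \<alpha> \<mu> (\<lambda>x. c * y x)"
proof -
  obtain v where i: "ivp (\<lambda>t. q t - \<mu>) (\<lambda>_. 0) y v" "v 0 = v 1" "y 0 + \<alpha> * y 1 = 0" "y \<noteq> 0"
    "\<And>x. x \<notin> {0..1} \<Longrightarrow> y x = 0"
    using T3_eigenfunctionD[OF q y] by blast
  have "ivp (\<lambda>t. q t - \<mu>) (\<lambda>t. - 0) (\<lambda>x. c * y x) (\<lambda>x. c * v x)" using ivp_scale[OF i(1), of c] by simp
  moreover have "c * v 0 - c * v 1 = 0" "c * y 0 + \<alpha> * (c * y 1) = 0"
    using i(2) arg_cong[OF i(3), of "\<lambda>z. c * z"] by (simp_all add: algebra_simps)
  ultimately have "T3 q \<alpha> (\<lambda>x. c * y x) (\<lambda>x. \<mu> * (c * y x) + 0)"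
    unfolding T3_iff_ivp[OF q continuous_on_const]
    by (intro conjI exI[of _ "\<lambda>x. c * v x"]) (simp_all add: i(5))
  then show ?thesis using i(4) c by (auto simp: T3_eigenfunction_def fun_eq_iff)
qed

section \<open>The eigenvalue sequences and the theorem\<close>

text \<open>Index the zeros with repetition by pairs of a zero and a number below its multiplicity; a bijection of the labels with
  these pairs does it.\<close>

lemma assignment_with_multiplicities:
  fixes m :: "'a \<Rightarrow> nat"
  assumes I: "finite I" and Z: "finite Z" and card: "card I = (\<Sum>z\<in>Z. m z)"
  shows "\<exists>f. (\<forall>i\<in>I. f i \<in> Z) \<and> (\<forall>z\<in>Z. card {i\<in>I. f i = z} = m z)"
proof -
  let ?S = "Sigma Z (\<lambda>z. {..<m z})"
  have "card ?S = card I" using Z card by (subst card_SigmaI) auto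
  moreover have "finite ?S" using Z by auto
  ultimately obtain h where h: "bij_betw h I ?S" using I finite_same_card_bij by metis
  have hS: "h i \<in> ?S" if "i \<in> I" for i using h that by (auto simp: bij_betw_def)
  have c: "card {i\<in>I. fst (h i) = z} = m z" if z: "z \<in> Z" for z
  proof -
    have im: "h ` {i\<in>I. fst (h i) = z} = {z} \<times> {..<m z}"
    proof
      show "h ` {i\<in>I. fst (h i) = z} \<subseteq> {z} \<times> {..<m z}" using hS by fastforce
      show "{z} \<times> {..<m z} \<subseteq> h ` {i\<in>I. fst (h i) = z}"
      proof
        fix p assume p: "p \<in> {z} \<times> {..<m z}"
        then have "p \<in> h ` I" using z h by (auto simp: bij_betw_def)
        then obtain i where i: "i \<in> I" "h i = p" by blast
        then have "fst (h i) = z" using p by auto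
        then show "p \<in> h ` {i\<in>I. fst (h i) = z}" using i by blast
      qed
    qed
    have "inj_on h {i\<in>I. fst (h i) = z}" by (rule inj_on_subset[OF bij_betw_imp_inj_on[OF h]]) auto
    from card_image[OF this] show ?thesis unfolding im by simp
  qed
  have d: "fst (h i) \<in> Z" if "i \<in> I" for i
    using hS[OF that] by (cases "h i") auto
  show ?thesis by (rule exI[of _ "\<lambda>i. fst (h i)"], intro conjI ballI) (erule d c)+
qed

text \<open>The branch of the square root of \<open>splitting_square\<close> is the product of two principal roots that occurs in the
  asymptotic formula.\<close>

definition splitting :: "(real \<Rightarrow> complex) \<Rightarrow> complex \<Rightarrow> nat \<Rightarrow> complex" where
  "splitting q \<alpha> n = csqrt (2 * gamma3 \<alpha>) / 2 * csqrt (of_nat n * sine_coeff q (2 * n))"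

lemma splitting_squared: "(splitting q \<alpha> n)\<^sup>2 = splitting_square q \<alpha> n"
  by (simp add: splitting_def splitting_square_def power_mult_distrib power_divide)

text \<open>Since \<open>ln n \<ge> 1\<close> for \<open>n \<ge> 3\<close>, the hypothesis drives \<open>n s\<^sub>2\<^sub>n\<close>, and with it the splitting, to infinity.\<close>

lemma splitting_at_top:
  fixes m :: "nat \<Rightarrow> nat"
  assumes \<alpha>: "\<alpha> \<noteq> 1" "\<alpha> \<noteq> -1" and m: "filterlim m at_top sequentially"
    and nz: "\<forall>\<^sub>F k in sequentially. sine_coeff q (2 * m k) \<noteq> 0"
    and lim: "(\<lambda>k. of_real (ln (real (m k))) / (of_nat (m k) * sine_coeff q (2 * m k))) \<longlonglongrightarrow> (0::complex)"
  shows "\<forall>\<^sub>F k in sequentially. K \<le> cmod (splitting q \<alpha> (m k))"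
proof -
  define g where "g = cmod (gamma3 \<alpha> / 2)"
  have g: "g > 0" using \<alpha> by (simp add: g_def gamma3_def add_eq_0_iff)
  define \<eta> where "\<eta> = g / (K\<^sup>2 + 1)"
  have \<eta>: "\<eta> > 0" using g by (auto simp: \<eta>_def intro!: divide_pos_pos add_nonneg_pos)
  have "\<forall>\<^sub>F k in sequentially. cmod (of_real (ln (real (m k))) / (of_nat (m k) * sine_coeff q (2 * m k))) < \<eta>"
    using tendstoD[OF lim \<eta>] by simp
  moreover have "\<forall>\<^sub>F k in sequentially. m k \<ge> 3" using m by (auto simp: filterlim_at_top)
  ultimately show ?thesis using nz
  proof eventually_elim
    case (elim k)
    define X where "X = cmod (of_nat (m k) * sine_coeff q (2 * m k))"
    have X: "X > 0" using elim by (simp add: X_def)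
    have "ln (real (m k)) \<ge> ln (exp 1)"
      using elim exp_le by (intro ln_mono) auto
    then have l: "ln (real (m k)) \<ge> 1" by simp
    have "ln (real (m k)) / X < \<eta>" using elim(1) l by (simp only: norm_divide norm_of_real X_def)
    then have "ln (real (m k)) < \<eta> * X" using X by (simp add: field_simps)
    then have "1 < \<eta> * X" using l by simp
    moreover have "K\<^sup>2 + 1 > 0" by (simp add: add_nonneg_pos)
    ultimately have "K\<^sup>2 + 1 < g * X" by (simp add: \<eta>_def pos_less_divide_eq)
    also have "g * X = (cmod (splitting q \<alpha> (m k)))\<^sup>2"
      unfolding norm_power[symmetric] splitting_squared splitting_square_def g_def X_def by (simp only: norm_mult mult.assoc)
    finally have "K\<^sup>2 \<le> (cmod (splitting q \<alpha> (m k)))\<^sup>2" by simp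
    then show ?case by (rule power2_le_imp_le) simp
  qed
qed

lemma discs_disjoint:
  fixes E :: complex
  assumes "\<mu> \<in> ball (l + \<sigma> * E) (cmod E / 2)" "\<mu> \<in> ball (l + \<tau> * E) (cmod E / 2)" "\<sigma> \<in> {1, -1}" "\<tau> \<in> {1, -1}"
  shows "\<sigma> = \<tau>"
proof (rule ccontr)
  assume "\<sigma> \<noteq> \<tau>"
  then have "dist (l + \<sigma> * E) (l + \<tau> * E) = 2 * cmod E"
  proof -
    have "l + \<sigma> * E - (l + \<tau> * E) = (\<sigma> - \<tau>) * E" by (simp add: algebra_simps)
    moreover have "cmod (\<sigma> - \<tau>) = 2" using \<open>\<sigma> \<noteq> \<tau>\<close> assms(3,4) by auto
    ultimately show ?thesis by (simp only: dist_norm norm_mult)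
  qed
  moreover have "dist (l + \<sigma> * E) (l + \<tau> * E) < cmod E"
    using dist_triangle_less_add[of "l + \<sigma> * E" \<mu> "cmod E / 2" "l + \<tau> * E" "cmod E / 2"] assms(1,2)
    by (simp add: dist_commute)
  ultimately show False using norm_ge_zero[of E] by linarith
qed

context
  fixes q :: "real \<Rightarrow> complex" and \<alpha> :: complex
  assumes q: "q absolutely_integrable_on {0..1}" and q0: "integral {0..1} q = 0" and \<alpha>: "\<alpha> \<noteq> 1" "\<alpha> \<noteq> -1"
begin

lemma alg_mult_zorder: "T3_alg_mult q \<alpha> \<mu> = nat (zorder (charfun q \<alpha>) \<mu>)"
  "T3_root_space q \<alpha> \<mu> = T3_kernel q \<alpha> \<mu> (T3_alg_mult q \<alpha> \<mu>)"
  using alg_mult_eq_order[OF q \<alpha>(2) charfun_not_locally_zero[OF q q0 \<alpha>(1)]] by auto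

lemma alg_mult_zero:
  assumes "charfun q \<alpha> \<mu> \<noteq> 0"
  shows "T3_alg_mult q \<alpha> \<mu> = 0"
  using zorder_eq_0I[OF charfun_analytic[OF q] assms] by (simp add: alg_mult_zorder)

text \<open>Each of the two simple eigenvalues near \<open>(2\<pi>n)\<^sup>2\<close> contributes an eigenfunction to the system. Normalized suitably,
  both are within \<open>O(n\<^sup>-\<^sup>1\<^sup>/\<^sup>2)\<close> of the same sine, hence of each other, while the lower bound for Riesz bases keeps them apart.\<close>

lemma not_riesz_basis:
  fixes m :: "nat \<Rightarrow> nat"
  assumes m: "filterlim m at_top sequentially" and E: "\<And>K. \<forall>\<^sub>F k in sequentially. K \<le> cmod (splitting q \<alpha> (m k))"
    and root: "T3_root_function_system q \<alpha> e" and riesz: "L2_riesz_basis e"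
  shows False
proof -
  obtain R C K N where R: "R \<ge> 16 * sqrt (localisation_const q \<alpha>)" and "C \<ge> 0" "K \<ge> 1" and
    pair: "\<forall>n\<ge>N. \<forall>E. E\<^sup>2 = splitting_square q \<alpha> n \<and> cmod E \<ge> K \<longrightarrow>
      zero_pair q \<alpha> R C n E"
    using charfun_zero_pair[OF q q0 \<alpha>(1)] .
  have R0: "R \<ge> 0" using R localisation_const_nonneg[OF q \<alpha>(1)] real_sqrt_ge_zero[of "localisation_const q \<alpha>"] by linarith
  obtain C' N' where ef: "\<forall>n\<ge>N'. \<forall>\<mu> \<Psi>. cmod (\<mu> - free_eigenvalue n) \<le> R * sqrt (real n) \<and>
      T3_eigenfunction q \<alpha> \<mu> \<Psi> \<and> L2_norm \<Psi> = 1 \<longrightarrow>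
      near_sine C' n \<Psi>"
    using eigenfunction_asymptotics[OF q \<alpha>(2) R0] by blast
  obtain \<kappa> M where \<kappa>: "\<kappa> > 0" "M > 0" "\<And>i. L2_norm (e i) \<le> M"
    and low: "\<And>i j s t. i \<noteq> j \<Longrightarrow> \<kappa> * cmod s \<le> L2_norm (\<lambda>x. s * e i x + t * e j x)"
    using riesz_basis_bounds[OF riesz] by blast
  define L where "L = nat \<lceil>(2 * C' * M / \<kappa>)\<^sup>2\<rceil> + 1"
  have "\<forall>\<^sub>F k in sequentially. m k \<ge> max (max N N') L" using m unfolding filterlim_at_top by blast
  then have "\<forall>\<^sub>F k in sequentially. m k \<ge> max (max N N') L \<and> K \<le> cmod (splitting q \<alpha> (m k))"
    using E[of K] by (rule eventually_conj)
  then obtain k where k: "m k \<ge> max (max N N') L" "K \<le> cmod (splitting q \<alpha> (m k))"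
    by (auto simp: eventually_sequentially)
  define n where "n = m k"
  define F where "F = splitting q \<alpha> n"
  define l where "l = free_eigenvalue n"
  have n: "n \<ge> N" "n \<ge> N'" "n \<ge> L" using k by (auto simp: n_def)
  have F: "F\<^sup>2 = splitting_square q \<alpha> n" "cmod F \<ge> K" using k by (auto simp: F_def n_def splitting_squared)
  have P: "3/2 * cmod F \<le> R * sqrt (real n)"
      "\<forall>\<sigma>\<in>{1, -1}. \<exists>\<mu>. {\<mu>'\<in>ball (l + \<sigma> * F) (cmod F / 2). charfun q \<alpha> \<mu>' = 0} = {\<mu>} \<and>
         zorder (charfun q \<alpha>) \<mu> = 1 \<and> cmod (\<mu> - (l + \<sigma> * F)) \<le> C"
    using pair[rule_format, OF n(1), of F] F unfolding zero_pair_def l_def by blast+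
  have ex: "\<exists>\<mu> i. \<mu> \<in> ball (l + \<sigma> * F) (cmod F / 2) \<and> T3_eigenfunction q \<alpha> \<mu> (e i)" if \<sigma>: "\<sigma> \<in> {1, -1}" for \<sigma>
  proof -
    obtain \<mu> where \<mu>: "{\<mu>'\<in>ball (l + \<sigma> * F) (cmod F / 2). charfun q \<alpha> \<mu>' = 0} = {\<mu>}" "zorder (charfun q \<alpha>) \<mu> = 1"
      using P(2) \<sigma> by blast
    have 1: "T3_alg_mult q \<alpha> \<mu> = 1" using \<mu>(2) by (simp add: alg_mult_zorder)
    then have "T3_root_space q \<alpha> \<mu> = T3_kernel q \<alpha> \<mu> 1" using alg_mult_zorder(2)[of \<mu>] by (simp only:)
    from root_function_of_simple_eigenvalue[OF root 1 this] show ?thesis using \<mu>(1) by blast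
  qed
  obtain \<mu>1 i where 1: "\<mu>1 \<in> ball (l + 1 * F) (cmod F / 2)" "T3_eigenfunction q \<alpha> \<mu>1 (e i)" using ex[of 1] by blast
  obtain \<mu>2 j where 2: "\<mu>2 \<in> ball (l + (-1) * F) (cmod F / 2)" "T3_eigenfunction q \<alpha> \<mu>2 (e j)" using ex[of "-1"] by blast
  have ij: "i \<noteq> j"
  proof
    assume "i = j"
    then have "\<mu>1 = \<mu>2" using eigenfunctions_distinct[OF q 1(2)] 2(2) by simp
    then show False using discs_disjoint[of \<mu>1 l 1 F "-1"] 1(1) 2(1) by simp
  qed
  have norm_pos: "L2_norm (e p) > 0" for p
  proof -
    have "\<kappa> * cmod 1 \<le> L2_norm (\<lambda>x. 1 * e p x + 0 * e (Suc p) x)" by (rule low) simp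
    then show ?thesis using \<kappa>(1) by simp
  qed
  have approx: "\<exists>c. cmod c = 1 / L2_norm (e p) \<and>
      (\<forall>x\<in>{0..1}. cmod (c * e p x - of_real (sqrt 2 * sin (2 * pi * real n * x))) \<le> C' / sqrt (real n))"
    if p: "\<mu> \<in> ball (l + \<sigma> * F) (cmod F / 2)" "\<sigma> \<in> {1, -1}" "T3_eigenfunction q \<alpha> \<mu> (e p)" for \<mu> \<sigma> p
  proof -
    let ?c0 = "complex_of_real (1 / L2_norm (e p))"
    have "T3_eigenfunction q \<alpha> \<mu> (\<lambda>x. ?c0 * e p x)"
      by (rule T3_eigenfunction_scale[OF q p(3)]) (use norm_pos[of p] in simp)
    moreover have "L2_norm (\<lambda>x. ?c0 * e p x) = 1"
      unfolding L2_norm_scale norm_of_real using norm_pos[of p] by simp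
    moreover have "cmod (\<mu> - l) \<le> R * sqrt (real n)"
    proof -
      have "cmod (\<mu> - l - \<sigma> * F) < cmod F / 2"
        using p(1) by (simp add: dist_norm norm_minus_commute diff_diff_eq)
      moreover have "cmod (\<sigma> * F) = cmod F" using p(2) by auto
      moreover have "cmod (\<mu> - l) \<le> cmod (\<mu> - l - \<sigma> * F) + cmod (\<sigma> * F)"
        using norm_triangle_ineq[of "\<mu> - l - \<sigma> * F" "\<sigma> * F"] by simp
      ultimately show ?thesis using P(1) by linarith
    qed
    ultimately obtain c where c: "cmod c = 1" "\<And>x. x \<in> {0..1} \<Longrightarrow>
        cmod (c * (?c0 * e p x) - of_real (sqrt 2 * sin (2 * pi * real n * x))) \<le> C' / sqrt (real n)"
      using ef[rule_format, OF n(2), of \<mu> "\<lambda>x. ?c0 * e p x"] unfolding l_def by blast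
    have "cmod (c * ?c0) = 1 / L2_norm (e p)"
      unfolding norm_mult norm_of_real using c(1) norm_pos[of p] by simp
    then show ?thesis using c(2) by (intro exI[of _ "c * ?c0"]) (simp add: mult.assoc)
  qed
  obtain c1 where c1: "cmod c1 = 1 / L2_norm (e i)"
    "\<And>x. x \<in> {0..1} \<Longrightarrow> cmod (c1 * e i x - of_real (sqrt 2 * sin (2 * pi * real n * x))) \<le> C' / sqrt (real n)"
    using approx[OF 1(1) insertI1 1(2)] by blast
  obtain c2 where c2: "\<And>x. x \<in> {0..1} \<Longrightarrow> cmod (c2 * e j x - of_real (sqrt 2 * sin (2 * pi * real n * x))) \<le> C' / sqrt (real n)"
    using approx[OF 2(1) insertI2[OF singletonI] 2(2)] by blast
  have cont: "continuous_on {0..1} (e p)" if "T3_eigenfunction q \<alpha> \<mu> (e p)" for p \<mu>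
    using T3_eigenfunctionD[OF q that] ivp_continuous(1) by blast
  have "\<kappa> / M \<le> \<kappa> * cmod c1"
    unfolding c1(1) using \<kappa> norm_pos[of i] by (simp add: divide_left_mono)
  also have "\<dots> \<le> L2_norm (\<lambda>x. c1 * e i x + (- c2) * e j x)" by (rule low[OF ij])
  also have "\<dots> \<le> 2 * (C' / sqrt (real n))"
  proof (rule L2_norm_le_sup)
    show "continuous_on {0..1} (\<lambda>x. c1 * e i x + (- c2) * e j x)"
      by (intro continuous_intros cont[OF 1(2)] cont[OF 2(2)])
    fix x :: real assume x: "x \<in> {0..1}"
    have "c1 * e i x + (- c2) * e j x = (c1 * e i x - of_real (sqrt 2 * sin (2 * pi * real n * x))) -
        (c2 * e j x - of_real (sqrt 2 * sin (2 * pi * real n * x)))" by simp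
    also have "cmod \<dots> \<le> C' / sqrt (real n) + C' / sqrt (real n)"
      by (rule norm_triangle_le_diff[OF add_mono[OF c1(2)[OF x] c2[OF x]]])
    finally show "cmod (c1 * e i x + (- c2) * e j x) \<le> 2 * (C' / sqrt (real n))" by simp
  qed
  finally have "\<kappa> / M \<le> 2 * (C' / sqrt (real n))" .
  moreover have "n \<ge> 1" using n(3) by (simp add: L_def)
  ultimately have "sqrt (real n) \<le> 2 * C' * M / \<kappa>" using \<kappa> by (simp add: field_simps)
  then have "(sqrt (real n))\<^sup>2 \<le> (2 * C' * M / \<kappa>)\<^sup>2" by (intro power_mono) auto
  then have "real n \<le> (2 * C' * M / \<kappa>)\<^sup>2" by simp
  moreover have "real L > (2 * C' * M / \<kappa>)\<^sup>2" unfolding L_def by linarith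
  ultimately show False using n(3) by linarith
qed

text \<open>For \<open>n > N\<close> the two zeros of the pair are labelled by the sign of the root. All other zeros lie in a disc and have
  total order \<open>2 N + 1\<close>, which is the number of the remaining labels, so they can be distributed over these labels
  arbitrarily.\<close>

lemma eigenvalue_sequences:
  assumes E: "\<And>K. \<forall>\<^sub>F n in sequentially. K \<le> cmod (splitting q \<alpha> n)"
  shows "\<exists>lam N R C. T3_eigenvalue_sequences q \<alpha> lam \<and> R \<ge> 0 \<and> (\<forall>n>N. \<forall>j\<in>{1, 2}. T3_simple_eigenvalue q \<alpha> (lam n j) \<and>
     cmod (lam n j - free_eigenvalue n) \<le> R * sqrt (real n) \<and> splitting q \<alpha> n \<noteq> 0 \<and>
     cmod (lam n j - (free_eigenvalue n + (-1) ^ j * splitting q \<alpha> n)) \<le> C)"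
proof -
  obtain R C K N0 where R: "R \<ge> 16 * sqrt (localisation_const q \<alpha>)" and C: "C \<ge> 0" and K: "K \<ge> 1" and
    pair: "\<forall>n\<ge>N0. \<forall>E. E\<^sup>2 = splitting_square q \<alpha> n \<and> cmod E \<ge> K \<longrightarrow>
      zero_pair q \<alpha> R C n E"
    using charfun_zero_pair[OF q q0 \<alpha>(1)] .
  have R0: "R \<ge> 0" using R localisation_const_nonneg[OF q \<alpha>(1)] real_sqrt_ge_zero[of "localisation_const q \<alpha>"] by linarith
  obtain N1 where N1: "\<And>n. n \<ge> N1 \<Longrightarrow> K \<le> cmod (splitting q \<alpha> n)" using E[of K] by (auto simp: eventually_sequentially)
  define Q where "Q = integral {0..1} (\<lambda>t. cmod (q t))"
  define N where "N = max (max N0 N1) (nat \<lceil>max (max (2 * Q) (max (localisation_const q \<alpha> + 1) 10)) (R\<^sup>2)\<rceil>)"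
  have Nb: "real N \<ge> max (max (2 * Q) (max (localisation_const q \<alpha> + 1) 10)) (R\<^sup>2)"
    by (rule order_trans[OF real_nat_ceiling_ge], subst of_nat_le_iff, unfold N_def, rule max.cobounded2)
  have NN: "N \<ge> N0" "N \<ge> N1" by (auto simp: N_def)
  have piN: "2 * pi * (real N + 1/2) \<ge> real N"
  proof -
    have "real N \<le> 2 * 3 * (real N + 1/2)" by simp
    also have "\<dots> \<le> 2 * pi * (real N + 1/2)" using pi_gt3 by (intro mult_right_mono) auto
    finally show ?thesis .
  qed
  define rad where "rad = (2 * pi * (real N + 1/2))\<^sup>2"
  define l where "l = (\<lambda>n. free_eigenvalue n)"
  define F where "F = splitting q \<alpha>"
  define D where "D = (\<lambda>n j. ball (l n + (-1) ^ j * F n) (cmod (F n) / 2))"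
  define Z where "Z = {\<mu>\<in>ball 0 rad. charfun q \<alpha> \<mu> = 0}"
  have sgn: "(-1) ^ j \<in> {1, -1 :: complex}" for j :: nat by (cases "even j") auto
  have F: "F n \<noteq> 0" "3/2 * cmod (F n) \<le> R * sqrt (real n)"
    "\<exists>\<mu>. {\<mu>'\<in>D n j. charfun q \<alpha> \<mu>' = 0} = {\<mu>} \<and> zorder (charfun q \<alpha>) \<mu> = 1 \<and> cmod (\<mu> - (l n + (-1) ^ j * F n)) \<le> C"
    "charfun q \<alpha> \<mu> = 0 \<Longrightarrow> cmod (\<mu> - l n) \<le> R * sqrt (real n) \<Longrightarrow> \<exists>j\<in>{1, 2}. \<mu> \<in> D n j"
    if n: "n > N" for n j \<mu>
  proof -
    have FK: "cmod (F n) \<ge> K" unfolding F_def using N1[of n] NN n by simp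
    then show "F n \<noteq> 0" using K by auto
    have n0: "n \<ge> N0" using NN n by simp
    note p = pair[rule_format, OF n0, of "F n", OF conjI[OF _ FK], unfolded F_def, OF splitting_squared, folded F_def, unfolded zero_pair_def]
    show "3/2 * cmod (F n) \<le> R * sqrt (real n)" using p by blast
    show "\<exists>\<mu>. {\<mu>'\<in>D n j. charfun q \<alpha> \<mu>' = 0} = {\<mu>} \<and> zorder (charfun q \<alpha>) \<mu> = 1 \<and> cmod (\<mu> - (l n + (-1) ^ j * F n)) \<le> C"
      using p sgn[of j] unfolding D_def l_def by blast
    assume "charfun q \<alpha> \<mu> = 0" "cmod (\<mu> - l n) \<le> R * sqrt (real n)"
    then obtain \<sigma> where \<sigma>: "\<sigma> \<in> {1, -1}" "\<mu> \<in> ball (l n + \<sigma> * F n) (cmod (F n) / 2)" using p unfolding l_def by blast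
    then have "\<mu> \<in> D n (if \<sigma> = 1 then 2 else 1)" by (auto simp: D_def)
    then show "\<exists>j\<in>{1, 2}. \<mu> \<in> D n j" by (metis insert_iff)
  qed
  define big where "big = (\<lambda>n j. SOME \<mu>. {\<mu>'\<in>D n j. charfun q \<alpha> \<mu>' = 0} = {\<mu>} \<and> zorder (charfun q \<alpha>) \<mu> = 1 \<and>
      cmod (\<mu> - (l n + (-1) ^ j * F n)) \<le> C)"
  have big: "{\<mu>'\<in>D n j. charfun q \<alpha> \<mu>' = 0} = {big n j}" "zorder (charfun q \<alpha>) (big n j) = 1"
      "cmod (big n j - (l n + (-1) ^ j * F n)) \<le> C" if "n > N" for n j
    using someI_ex[OF F(3)[OF that, of j]] unfolding big_def by blast+
  have bigD: "big n j \<in> D n j" "charfun q \<alpha> (big n j) = 0" if "n > N" for n j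
    using big(1)[OF that, of j] by blast+
  have near: "cmod (\<mu> - l n) \<le> R * sqrt (real n)" if n: "n > N" and \<mu>: "\<mu> \<in> D n j" for \<mu> n j
  proof -
    have "cmod (\<mu> - l n - (-1) ^ j * F n) < cmod (F n) / 2"
      using \<mu> by (simp add: D_def dist_norm norm_minus_commute diff_diff_eq)
    moreover have "cmod ((-1) ^ j * F n) = cmod (F n)" by (simp add: norm_mult norm_power)
    moreover have "cmod (\<mu> - l n) \<le> cmod (\<mu> - l n - (-1) ^ j * F n) + cmod ((-1) ^ j * F n)"
      using norm_triangle_ineq[of "\<mu> - l n - (-1) ^ j * F n" "(-1) ^ j * F n"] by simp
    ultimately show ?thesis using F(2)[OF n] by linarith
  qed
  have cn: "cmod (complex_of_real (2 * pi * real n)) = 2 * pi * real n" for n :: nat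
    unfolding norm_of_real by simp
  have sqr: "cmod (csqrt \<mu> - of_real (2 * pi * real n)) \<le> 1/6" if n: "n > N" and \<mu>: "cmod (\<mu> - l n) \<le> R * sqrt (real n)" for n \<mu>
    by (rule csqrt_near_free_eigenvalue(3)) (use n \<mu> Nb in \<open>auto simp: l_def\<close>)
  have unique: "n = n'" if n: "n > N" "n' > N" and \<mu>: "cmod (\<mu> - l n) \<le> R * sqrt (real n)" "cmod (\<mu> - l n') \<le> R * sqrt (real n')" for n n' \<mu>
  proof -
    have "cmod (of_real (2 * pi * real n) - of_real (2 * pi * real n')) \<le> 1/6 + 1/6"
      by (rule norm_diff_triangle_le[OF _ sqr[OF n(2) \<mu>(2)]]) (use sqr[OF n(1) \<mu>(1)] in \<open>simp add: norm_minus_commute\<close>)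
    then have "\<bar>2 * pi * real n - 2 * pi * real n'\<bar> \<le> 1/3" by (simp only: of_real_diff[symmetric] norm_of_real)
    then have "2 * pi * \<bar>real n - real n'\<bar> \<le> 1/3" by (simp add: abs_mult flip: right_diff_distrib)
    have "2 * 3 * \<bar>real n - real n'\<bar> \<le> 2 * pi * \<bar>real n - real n'\<bar>" using pi_gt3 by (intro mult_right_mono) auto
    also have "\<dots> \<le> 1/3" by fact
    finally have "\<bar>real n - real n'\<bar> < 1" by simp
    then show ?thesis by linarith
  qed
  have outside: "\<mu> \<notin> ball 0 rad" if n: "n > N" and \<mu>: "cmod (\<mu> - l n) \<le> R * sqrt (real n)" for \<mu> n
  proof -
    have "2 * pi * (real N + 1) \<le> 2 * pi * real n" using n by (intro mult_left_mono) auto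
    moreover have "2 * pi * real n \<le> cmod (csqrt \<mu>) + 1/6"
      using norm_triangle_ineq2[of "complex_of_real (2 * pi * real n)" "csqrt \<mu>"] sqr[OF n \<mu>]
      unfolding norm_minus_commute[of "csqrt \<mu>"] cn by linarith
    ultimately have "2 * pi * (real N + 1/2) \<le> cmod (csqrt \<mu>)" using pi_gt3 by (simp add: algebra_simps)
    then have "rad \<le> (cmod (csqrt \<mu>))\<^sup>2" unfolding rad_def by (intro power_mono) auto
    also have "\<dots> = cmod \<mu>" by (simp flip: norm_power)
    finally show ?thesis by simp
  qed
  \<comment> \<open>Together with \<open>unique\<close> and \<open>outside\<close> this identifies the zeros outside the disc with those near some
      \<open>(2\<pi>n)\<^sup>2\<close>, \<open>n > N\<close>, where \<open>n\<close> is determined by the zero.\<close>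
  have find: "\<exists>n>N. cmod (\<mu> - l n) \<le> R * sqrt (real n)" if z: "charfun q \<alpha> \<mu> = 0" and \<mu>: "\<mu> \<notin> ball 0 rad" for \<mu>
  proof -
    have "rad \<le> (cmod (csqrt \<mu>))\<^sup>2" using \<mu> by (simp flip: norm_power)
    then have b: "2 * pi * (real N + 1/2) \<le> cmod (csqrt \<mu>)" unfolding rad_def by (rule power2_le_imp_le) simp
    have "cmod (csqrt \<mu>) \<ge> max (2 * Q) (max (localisation_const q \<alpha> + 1) 10)" using b piN Nb by auto
    from charfun_zero_localised[OF q \<alpha>(1) z this[unfolded Q_def]] obtain n where
      n: "cmod (csqrt \<mu> - of_real (2 * pi * real n)) < 2" "cmod (\<mu> - l n) \<le> 16 * sqrt (localisation_const q \<alpha>) * sqrt (real n)"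
      unfolding l_def by blast
    have "cmod (csqrt \<mu>) \<le> 2 * pi * real n + 2"
      using norm_triangle_ineq2[of "csqrt \<mu>" "complex_of_real (2 * pi * real n)"] n(1) unfolding cn by linarith
    then have "2 * pi * real N + pi \<le> 2 * pi * real n + 2" using b by (simp add: algebra_simps)
    then have "2 * pi * real N < 2 * pi * real n" using pi_gt3 by linarith
    then have "n > N" by simp
    moreover have "16 * sqrt (localisation_const q \<alpha>) * sqrt (real n) \<le> R * sqrt (real n)" by (intro mult_right_mono R) auto
    ultimately show ?thesis using order_trans[OF n(2)] by blast
  qed
  have cond: "2 * pi * (real N + 1/2) \<ge> max (2 * Q) (localisation_const q \<alpha> + 1)" using piN Nb by auto
  have Zf: "finite Z" and Zs: "(\<Sum>\<mu>\<in>Z. zorder (charfun q \<alpha>) \<mu>) = 2 * int N + 1"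
    using charfun_zeros_in_disc[OF q \<alpha>(1) cond[unfolded Q_def]] unfolding Z_def rad_def by auto
  define I where "I = {(n::nat, j::nat). n \<le> N \<and> j \<in> {1, 2} \<and> (n = 0 \<longrightarrow> j = 1)}"
  have Ieq: "I = insert (0, 1) ({1..N} \<times> {1, 2})" by (auto simp: I_def)
  have If: "finite I" and Ic: "card I = 2 * N + 1" unfolding Ieq by (auto simp: card_insert_if)
  have "int (\<Sum>\<mu>\<in>Z. nat (zorder (charfun q \<alpha>) \<mu>)) = (\<Sum>\<mu>\<in>Z. zorder (charfun q \<alpha>) \<mu>)"
    using zorder_charfun_pos[OF q q0 \<alpha>(1)] by (simp add: Z_def) (rule sum.cong, auto, fastforce)
  then have "card I = (\<Sum>\<mu>\<in>Z. nat (zorder (charfun q \<alpha>) \<mu>))" using Zs Ic by linarith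
  from assignment_with_multiplicities[OF If Zf this] obtain f where
    f: "\<And>i. i \<in> I \<Longrightarrow> f i \<in> Z" "\<And>\<mu>. \<mu> \<in> Z \<Longrightarrow> card {i\<in>I. f i = \<mu>} = nat (zorder (charfun q \<alpha>) \<mu>)" by blast
  define lam where "lam = (\<lambda>n j. if n \<le> N then f (n, j) else big n j)"
  let ?S = "\<lambda>\<mu>. {(n, j). j \<in> {1, 2} \<and> (n = 0 \<longrightarrow> j = 1) \<and> lam n j = \<mu>}"
  have small: "lam n j \<in> Z" if "n \<le> N" "j \<in> {1, 2}" "n = 0 \<longrightarrow> j = 1" for n j
    using f(1)[of "(n, j)"] that by (auto simp: lam_def I_def)
  have lam_big: "lam n j = big n j" if "n > N" for n j using that by (simp add: lam_def)
  have lam_out: "lam n j \<notin> ball 0 rad" if "n > N" for n j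
    unfolding lam_big[OF that] by (rule outside[OF that near[OF that bigD(1)[OF that]]])
  have lam0: "charfun q \<alpha> (lam n j) = 0" if "j \<in> {1, 2}" "n = 0 \<longrightarrow> j = 1" for n j
    using small[of n j] that bigD(2)[of n j] lam_big[of n j] by (cases "n \<le> N") (auto simp: Z_def)
  have count: "finite (?S \<mu>) \<and> card (?S \<mu>) = T3_alg_mult q \<alpha> \<mu>" for \<mu>
  proof -
    consider (inner) "\<mu> \<in> Z" | (non) "charfun q \<alpha> \<mu> \<noteq> 0" | (outer) "charfun q \<alpha> \<mu> = 0" "\<mu> \<notin> ball 0 rad"
      by (auto simp: Z_def)
    then show ?thesis
    proof cases
      case inner
      have S: "?S \<mu> = {i\<in>I. f i = \<mu>}"
      proof (intro set_eqI iffI)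
        fix i assume i: "i \<in> ?S \<mu>"
        then obtain n j where nj: "i = (n, j)" "j \<in> {1, 2}" "n = 0 \<longrightarrow> j = 1" "lam n j = \<mu>" by blast
        have "n \<le> N"
        proof (rule ccontr)
          assume "\<not> n \<le> N"
          then have "\<mu> \<notin> ball 0 rad" using lam_out[of n j] nj(4) by simp
          then show False using inner by (simp add: Z_def)
        qed
        then show "i \<in> {i\<in>I. f i = \<mu>}" using nj by (auto simp: I_def lam_def)
      qed (auto simp: I_def lam_def)
      show ?thesis unfolding S using f(2)[OF inner] If by (simp add: alg_mult_zorder)
    next
      case non
      have S: "?S \<mu> = {}"
      proof (rule equals0I)
        fix i assume "i \<in> ?S \<mu>"
        then obtain n j where nj: "i = (n, j)" "j \<in> {1, 2}" "n = 0 \<longrightarrow> j = 1" "lam n j = \<mu>" by blast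
        from lam0[OF nj(2,3)] nj(4) non show False by simp
      qed
      show ?thesis unfolding S using alg_mult_zero[OF non] by simp
    next
      case outer
      obtain n where n: "n > N" "cmod (\<mu> - l n) \<le> R * sqrt (real n)" using find[OF outer] by blast
      obtain j where j: "j \<in> {1, 2}" "\<mu> \<in> D n j" using F(4)[OF n(1) outer(1) n(2)] by blast
      have \<mu>: "\<mu> = big n j" using big(1)[OF n(1), of j] j(2) outer(1) by blast
      have S: "?S \<mu> = {(n, j)}"
      proof (intro set_eqI iffI)
        fix i assume i: "i \<in> ?S \<mu>"
        then obtain n' j' where nj: "i = (n', j')" "j' \<in> {1, 2}" "n' = 0 \<longrightarrow> j' = 1" "lam n' j' = \<mu>" by blast
        have n': "n' > N"
        proof (rule ccontr)
          assume "\<not> n' > N"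
          then have "\<mu> \<in> Z" using small[OF _ nj(2,3)] nj(4) by simp
          then show False using outer(2) by (simp add: Z_def)
        qed
        have D': "\<mu> \<in> D n' j'" using bigD(1)[OF n', of j'] nj(4) lam_big[OF n', of j'] by simp
        have nn: "n' = n" by (rule unique[OF n' n(1) near[OF n' D'] n(2)])
        have "(-1 :: complex) ^ j' = (-1) ^ j"
          by (rule discs_disjoint[OF D'[unfolded D_def nn] j(2)[unfolded D_def] sgn sgn])
        then have "j' = j" using nj(2) j(1) by auto
        then show "i \<in> {(n, j)}" using nj(1) nn by simp
      next
        fix i assume "i \<in> {(n, j)}"
        then show "i \<in> ?S \<mu>" using j(1) n(1) \<mu> lam_big[OF n(1), of j] by auto
      qed
      show ?thesis unfolding S using big(2)[OF n(1), of j] \<mu> by (simp add: alg_mult_zorder)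
    qed
  qed
  have bound: "cmod (lam n j - l n) \<le> R * sqrt (real n)" if "n > N" for n j
    unfolding lam_big[OF that] by (rule near[OF that bigD(1)[OF that]])
  have "(\<lambda>n. cmod (lam n j - l n)) \<in> O(\<lambda>n. sqrt (real n))" for j
  proof (rule bigoI[of _ R])
    show "\<forall>\<^sub>F n in sequentially. norm (cmod (lam n j - l n)) \<le> R * norm (sqrt (real n))"
      using eventually_gt_at_top[of N] by eventually_elim (simp add: bound)
  qed
  then have "T3_eigenvalue_sequences q \<alpha> lam"
    unfolding T3_eigenvalue_sequences_def using count unfolding l_def by blast
  moreover have "T3_simple_eigenvalue q \<alpha> (lam n j) \<and> cmod (lam n j - l n) \<le> R * sqrt (real n) \<and> F n \<noteq> 0 \<and>
      cmod (lam n j - (l n + (-1) ^ j * F n)) \<le> C" if "n > N" for n j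
    using bound[OF that, of j] big(2,3)[OF that, of j] F(1)[OF that] lam_big[OF that, of j]
    by (simp add: T3_simple_eigenvalue_def alg_mult_zorder)
  ultimately show ?thesis using R0 unfolding l_def F_def by blast
qed

end

theorem theorem3:
  fixes q :: "real \<Rightarrow> complex" and \<alpha> :: complex
  assumes "q absolutely_integrable_on {0..1}"
    and "integral {0..1} q = 0"
    and "\<alpha> \<noteq> 1" and "\<alpha> \<noteq> -1"
  shows
    "((\<forall>\<^sub>F n in sequentially. sine_coeff q (2 * n) \<noteq> 0) \<and>
      (\<lambda>n. of_real (ln (real n)) / (of_nat n * sine_coeff q (2 * n))) \<longlonglongrightarrow> 0
      \<longrightarrow>
      (\<exists>lam :: nat \<Rightarrow> nat \<Rightarrow> complex.
        T3_eigenvalue_sequences q \<alpha> lam \<and>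
        (\<exists>N. \<forall>n>N. \<forall>j\<in>{1, 2}. T3_simple_eigenvalue q \<alpha> (lam n j)) \<and>
        (\<forall>j\<in>{1, 2}. \<exists>\<epsilon> :: nat \<Rightarrow> complex. \<epsilon> \<longlonglongrightarrow> 0 \<and>
          (\<forall>\<^sub>F n in sequentially.
            lam n j = of_real ((2 * pi * real n)\<^sup>2) +
              (-1) ^ j * (csqrt (2 * gamma3 \<alpha>) / 2) *
              csqrt (of_nat n * sine_coeff q (2 * n)) * (1 + \<epsilon> n))) \<and>
        (\<exists>C N. \<forall>n>N. \<forall>j\<in>{1, 2}. \<forall>\<Psi>.
          T3_eigenfunction q \<alpha> (lam n j) \<Psi> \<and> L2_norm \<Psi> = 1 \<longrightarrow>
          (\<exists>c. cmod c = 1 \<and>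
            (\<forall>x\<in>{0..1}. cmod (c * \<Psi> x - of_real (sqrt 2 * sin (2 * pi * real n * x)))
               \<le> C / sqrt (real n))))))
     \<and>
     ((\<exists>m :: nat \<Rightarrow> nat.
         (\<forall>k. m k > 0) \<and> filterlim m at_top sequentially \<and>
         (\<forall>\<^sub>F k in sequentially. sine_coeff q (2 * m k) \<noteq> 0) \<and>
         (\<lambda>k. of_real (ln (real (m k))) / (of_nat (m k) * sine_coeff q (2 * m k))) \<longlonglongrightarrow> 0)
      \<longrightarrow>
      \<not> (\<exists>e. T3_root_function_system q \<alpha> e \<and> L2_riesz_basis e))"
    (is "(?A \<longrightarrow> ?B) \<and> (?M \<longrightarrow> \<not> ?Rz)")
proof (intro conjI impI)
  assume A: ?A
  have large: "\<forall>\<^sub>F n in sequentially. K \<le> cmod (splitting q \<alpha> n)" for K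
    using splitting_at_top[OF assms(3,4) filterlim_ident, of q K] A by simp
  obtain lam N R C where seq: "T3_eigenvalue_sequences q \<alpha> lam" and R: "R \<ge> 0" and
    lam: "\<forall>n>N. \<forall>j\<in>{1, 2}. T3_simple_eigenvalue q \<alpha> (lam n j) \<and>
     cmod (lam n j - of_real ((2 * pi * real n)\<^sup>2)) \<le> R * sqrt (real n) \<and> splitting q \<alpha> n \<noteq> 0 \<and>
     cmod (lam n j - (of_real ((2 * pi * real n)\<^sup>2) + (-1) ^ j * splitting q \<alpha> n)) \<le> C"
    using eigenvalue_sequences[OF assms large] by (elim exE conjE) (rule that)
  obtain C' N' where ef: "\<forall>n\<ge>N'. \<forall>\<mu> \<Psi>. cmod (\<mu> - of_real ((2 * pi * real n)\<^sup>2)) \<le> R * sqrt (real n) \<and>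
      T3_eigenfunction q \<alpha> \<mu> \<Psi> \<and> L2_norm \<Psi> = 1 \<longrightarrow>
      near_sine C' n \<Psi>"
    using eigenfunction_asymptotics[OF assms(1,4) R] by blast
  have asym: "\<exists>\<epsilon> :: nat \<Rightarrow> complex. \<epsilon> \<longlonglongrightarrow> 0 \<and>
          (\<forall>\<^sub>F n in sequentially.
            lam n j = of_real ((2 * pi * real n)\<^sup>2) +
              (-1) ^ j * (csqrt (2 * gamma3 \<alpha>) / 2) *
              csqrt (of_nat n * sine_coeff q (2 * n)) * (1 + \<epsilon> n))" if j: "j \<in> {1, 2}" for j
  proof -
    define G where "G = (\<lambda>n. (-1) ^ j * splitting q \<alpha> n)"
    have nG: "cmod (G n) = cmod (splitting q \<alpha> n)" for n by (simp add: G_def norm_mult norm_power)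
    define \<epsilon> where "\<epsilon> = (\<lambda>n. (lam n j - (of_real ((2 * pi * real n)\<^sup>2) + G n)) / G n)"
    have "\<epsilon> \<longlonglongrightarrow> 0"
    proof (rule Lim_null_comparison)
      show "\<forall>\<^sub>F n in sequentially. cmod (\<epsilon> n) \<le> C * inverse (cmod (splitting q \<alpha> n))"
        using eventually_gt_at_top[of N]
      proof eventually_elim
        case (elim n)
        have "cmod (\<epsilon> n) = cmod (lam n j - (of_real ((2 * pi * real n)\<^sup>2) + G n)) / cmod (splitting q \<alpha> n)"
          by (simp only: \<epsilon>_def norm_divide nG)
        also have "\<dots> \<le> C / cmod (splitting q \<alpha> n)"
          unfolding G_def using lam[rule_format, OF elim j] by (intro divide_right_mono) auto
        finally show ?case by (simp only: divide_inverse)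
      qed
      have "filterlim (\<lambda>n. cmod (splitting q \<alpha> n)) at_top sequentially"
        unfolding filterlim_at_top using large by blast
      then have "(\<lambda>n. inverse (cmod (splitting q \<alpha> n))) \<longlonglongrightarrow> 0"
        by (rule filterlim_compose[OF tendsto_inverse_0_at_top, rotated]) (rule filterlim_ident)
      from tendsto_mult[OF tendsto_const this, of C] show "(\<lambda>n. C * inverse (cmod (splitting q \<alpha> n))) \<longlonglongrightarrow> 0" by simp
    qed
    moreover have "\<forall>\<^sub>F n in sequentially.
            lam n j = of_real ((2 * pi * real n)\<^sup>2) +
              (-1) ^ j * (csqrt (2 * gamma3 \<alpha>) / 2) *
              csqrt (of_nat n * sine_coeff q (2 * n)) * (1 + \<epsilon> n)"
      using eventually_gt_at_top[of N]
    proof eventually_elim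
      case (elim n)
      have "splitting q \<alpha> n \<noteq> 0" using lam elim by blast
      then have "G n \<noteq> 0" by (simp add: G_def)
      then have "lam n j = of_real ((2 * pi * real n)\<^sup>2) + G n * (1 + \<epsilon> n)"
        by (simp add: \<epsilon>_def distrib_left)
      then show ?case by (simp only: G_def splitting_def mult.assoc)
    qed
    ultimately show ?thesis by blast
  qed
  have eig: "\<forall>n>max N N'. \<forall>j\<in>{1, 2}. \<forall>\<Psi>.
          T3_eigenfunction q \<alpha> (lam n j) \<Psi> \<and> L2_norm \<Psi> = 1 \<longrightarrow>
          (\<exists>c. cmod c = 1 \<and>
            (\<forall>x\<in>{0..1}. cmod (c * \<Psi> x - of_real (sqrt 2 * sin (2 * pi * real n * x)))
               \<le> C' / sqrt (real n)))"
  proof (intro allI ballI impI)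
    fix n j \<Psi> assume n: "max N N' < n" and j: "j \<in> {1, 2}" and \<Psi>: "T3_eigenfunction q \<alpha> (lam n j) \<Psi> \<and> L2_norm \<Psi> = 1"
    have "n \<ge> N'" using n by simp
    moreover have "cmod (lam n j - of_real ((2 * pi * real n)\<^sup>2)) \<le> R * sqrt (real n)" using lam n j by auto
    ultimately show "\<exists>c. cmod c = 1 \<and> (\<forall>x\<in>{0..1}. cmod (c * \<Psi> x - of_real (sqrt 2 * sin (2 * pi * real n * x))) \<le> C' / sqrt (real n))"
      using ef \<Psi> by blast
  qed
  have simple: "\<forall>n>N. \<forall>j\<in>{1, 2}. T3_simple_eigenvalue q \<alpha> (lam n j)" using lam by blast
  show ?B
    by (rule exI[of _ lam], intro conjI ballI seq exI[of _ N] exI[of _ C'] exI[of _ "max N N'"])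
       (fact simple asym eig)+
next
  assume ?M
  then obtain m :: "nat \<Rightarrow> nat" where m: "filterlim m at_top sequentially"
    "\<forall>\<^sub>F k in sequentially. sine_coeff q (2 * m k) \<noteq> 0"
    "(\<lambda>k. of_real (ln (real (m k))) / (of_nat (m k) * sine_coeff q (2 * m k))) \<longlonglongrightarrow> (0::complex)" by blast
  show "\<not> ?Rz"
    using not_riesz_basis[OF assms m(1) splitting_at_top[OF assms(3,4) m]] by blast
qed

end
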